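(* Let $\mathbf G$ and $\mathbf H$ be nilpotent groups, neither of which is a Prüfer group. If the power graphs $\mathcal G(\mathbf G)$ and $\mathcal G(\mathbf H)$ are isomorphic as graphs, then the directed power graphs $\vec{\mathcal G}(\mathbf G)$ and $\vec{\mathcal G}(\mathbf H)$ are isomorphic as directed graphs.
   Context: Groups may be infinite. A Prüfer (quasicyclic) group is a group isomorphic to $\mathbf C_{p^\infty}$ for some prime number $p$, where $\mathbf C_{p^\infty}$ is the Prüfer $p$-group. The directed power graph $\vec{\mathcal G}(\mathbf G)$ of a group $\mathbf G$ is the simple directed graph (no loops) whose vertex set is the underlying set $G$ and in which, for distinct $x,y\in G$, there is an arc $x\rightarrow y$ if and only if $y=x^n$ for some nonzero integer $n$. The power graph $\mathcal G(\mathbf G)$ is the underlying simple undirected graph: distinct $x,y\in G$ are adjacent if and only if $x\rightarrow y$ or $y\rightarrow x$. *)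

theory Defs
  imports
    "HOL-Algebra.Generated_Groups"
    "HOL-Computational_Algebra.Primes"
    "HOL.Complex"
    "Graph_Theory.Pair_Digraph"
    "Graph_Theory.Digraph_Isomorphism"
begin

text \<open>Commutators follow the convention of \<open>derived_set\<close>.\<close>

primrec lower_central :: "('a, 'b) monoid_scheme \<Rightarrow> nat \<Rightarrow> 'a set" where
  "lower_central G 0 = carrier G"
| "lower_central G (Suc n) =
     generate G (\<Union>h \<in> lower_central G n. \<Union>g \<in> carrier G.
       { h \<otimes>\<^bsub>G\<^esub> g \<otimes>\<^bsub>G\<^esub> (inv\<^bsub>G\<^esub> h) \<otimes>\<^bsub>G\<^esub> (inv\<^bsub>G\<^esub> g) })"

definition nilpotent :: "('a, 'b) monoid_scheme \<Rightarrow> bool" where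
  "nilpotent G \<longleftrightarrow> (\<exists>n. lower_central G n = { \<one>\<^bsub>G\<^esub> })"

text \<open>The Pruefer \<open>p\<close>-group, realised as the complex roots of unity of \<open>p\<close>-power order.\<close>

definition pruefer :: "nat \<Rightarrow> complex monoid" where
  "pruefer p = \<lparr> carrier = {z. \<exists>k. z ^ (p ^ k) = 1}, monoid.mult = (*), one = 1 \<rparr>"

definition is_pruefer :: "('a, 'b) monoid_scheme \<Rightarrow> bool" where
  "is_pruefer G \<longleftrightarrow> (\<exists>p. prime p \<and> G \<cong> pruefer p)"

definition directed_power_graph :: "('a, 'b) monoid_scheme \<Rightarrow> 'a pair_pre_digraph" where
  "directed_power_graph G =
     \<lparr> pverts = carrier G,
       parcs = {(x, y). x \<in> carrier G \<and> y \<in> carrier G \<and> x \<noteq> y \<and>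
                        (\<exists>n::int. n \<noteq> 0 \<and> y = x [^]\<^bsub>G\<^esub> n)} \<rparr>"

text \<open>As usual in \<^theory>\<open>Graph_Theory.Digraph\<close>, an undirected graph is a symmetric digraph: an edge
  is represented by the two opposite arcs between its ends.\<close>

definition power_graph :: "('a, 'b) monoid_scheme \<Rightarrow> 'a pair_pre_digraph" where
  "power_graph G = mk_symmetric (with_proj (directed_power_graph G))"

lemma power_graph_adjacent_iff:
  "(x, y) \<in> parcs (power_graph G) \<longleftrightarrow>
     (x, y) \<in> parcs (directed_power_graph G) \<or> (y, x) \<in> parcs (directed_power_graph G)"
proof -
  have "parcs (power_graph G) = parcs (directed_power_graph G) \<union> (parcs (directed_power_graph G))\<inverse>"
    by (auto simp: power_graph_def parcs_mk_symmetric intro: rev_bexI)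
  then show ?thesis by blast
qed

text \<open>On digraphs whose arcs are pairs, \<^const>\<open>digraph_iso\<close> is the existence of a bijection between
  the vertex sets that preserves and reflects arcs.\<close>

lemma digraph_iso_pair_iff:
  fixes G :: "'a pair_pre_digraph" and H :: "'b pair_pre_digraph"
  assumes G: "parcs G \<subseteq> pverts G \<times> pverts G" and H: "parcs H \<subseteq> pverts H \<times> pverts H"
  shows "digraph_iso (with_proj G) (with_proj H) \<longleftrightarrow>
    (\<exists>f. bij_betw f (pverts G) (pverts H) \<and>
         (\<forall>x \<in> pverts G. \<forall>y \<in> pverts G. (x, y) \<in> parcs G \<longleftrightarrow> (f x, f y) \<in> parcs H))"
    (is "?L \<longleftrightarrow> ?R")
proof
  assume ?L
  then obtain h where h: "pre_digraph.digraph_isomorphism (with_proj G) h"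
    and eq: "with_proj H = app_iso h (with_proj G)"
    unfolding digraph_iso_def by blast
  let ?f = "iso_verts h"
  have vH: "pverts H = ?f ` pverts G" and aH: "parcs H = iso_arcs h ` parcs G"
    and t: "iso_tail h = fst" and hd: "iso_head h = snd"
    using eq by (auto simp: with_proj_def app_iso_def)
  have inj: "inj_on ?f (pverts G)"
    and arc: "\<And>a. a \<in> parcs G \<Longrightarrow> iso_arcs h a = (?f (fst a), ?f (snd a))"
    using h t hd by (auto simp: pre_digraph.digraph_isomorphism_def prod_eq_iff)
  have "(x, y) \<in> parcs G \<longleftrightarrow> (?f x, ?f y) \<in> parcs H"
    if xy: "x \<in> pverts G" "y \<in> pverts G" for x y
  proof
    assume "(x, y) \<in> parcs G" then show "(?f x, ?f y) \<in> parcs H"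
      using arc aH by force
  next
    assume "(?f x, ?f y) \<in> parcs H"
    then obtain u v where uv: "(u, v) \<in> parcs G" "(?f x, ?f y) = (?f u, ?f v)"
      using arc aH by auto
    then have "u = x" "v = y" using xy inj G by (auto dest: inj_onD)
    then show "(x, y) \<in> parcs G" using uv by simp
  qed
  then show ?R using inj vH by (auto simp: bij_betw_def)
next
  assume ?R
  then obtain f where f: "bij_betw f (pverts G) (pverts H)"
    and arc: "\<And>x y. x \<in> pverts G \<Longrightarrow> y \<in> pverts G \<Longrightarrow> (x, y) \<in> parcs G \<longleftrightarrow> (f x, f y) \<in> parcs H"
    by blast
  let ?h = "\<lparr> iso_verts = f, iso_arcs = map_prod f f, iso_head = snd, iso_tail = fst \<rparr>"
  have inj: "inj_on f (pverts G)" and im: "f ` pverts G = pverts H"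
    using f by (auto simp: bij_betw_def)
  have "inj_on (map_prod f f) (parcs G)"
    using inj_on_subset[OF map_prod_inj_on[OF inj inj] G] .
  moreover have "wf_digraph (with_proj G)"
    using G by unfold_locales auto
  ultimately have "pre_digraph.digraph_isomorphism (with_proj G) ?h"
    using inj by (auto simp: pre_digraph.digraph_isomorphism_def)
  moreover have "map_prod f f ` parcs G = parcs H"
  proof
    show "map_prod f f ` parcs G \<subseteq> parcs H" using G arc by auto
    show "parcs H \<subseteq> map_prod f f ` parcs G"
    proof
      fix e assume e: "e \<in> parcs H"
      then obtain x y where xy: "x \<in> pverts G" "y \<in> pverts G" "e = (f x, f y)"
        using H im by (cases e) blast
      then show "e \<in> map_prod f f ` parcs G" using arc e by force
    qed
  qed
  then have "with_proj H = app_iso ?h (with_proj G)"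
    using im by (simp add: with_proj_def app_iso_def)
  ultimately show ?L unfolding digraph_iso_def by blast
qed

end

theory Submission
  imports Defs "HOL-Algebra.Multiplicative_Group" "HOL-Number_Theory.Totient"
begin

text \<open>
  Call \<open>y\<close> a power of \<open>x\<close> if \<open>y = x\<^sup>n\<close> with \<open>n \<noteq> 0\<close>. Two elements lie in the same component of the
  power graph iff they are commensurable, that is, have a common power (\<open>commens_iff_padj\<close>). A
  graph isomorphism \<open>f\<close> therefore permutes commensurability classes, arcs never leave a class, and
  it is enough to find for each class a directed isomorphism onto its image; these are glued in
  \<open>glue_classes\<close>. The torsion elements form one class, the class of \<open>1\<close>, and \<open>f\<close> maps torsion to
  torsion, because otherwise the torsion elements would have the power graph of the nonzero
  integers (\<open>f_one_torsion\<close>).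

  Consider a class of elements of infinite order. The cyclic subgroups generated by its elements
  form a poset under inclusion, and the power graph is its comparability graph. If no vertex is
  adjacent to all others, this graph has exactly two compatible orientations, the given one and
  its reverse (\<open>orientation_unique\<close>), so \<open>f\<close> preserves all arcs or reverses all arcs. In the
  second case any two elements have a common root and every element has roots of every degree, so
  the class is the set of nonzero elements of a copy of the rational numbers, on both sides. If
  some vertex is adjacent to all others, the class is an infinite cyclic group without its
  identity. In these two cases \<open>rank_one_dir_iso\<close> gives the directed isomorphism.

  For torsion elements the direction is read off from closed neighbourhoods. Suppose first that
  elements of two different prime orders exist. In a nilpotent group elements of coprime orders
  commute, and it follows that elements with equal closed neighbourhoods generate the same cyclic
  subgroup, unless they are adjacent to all torsion elements. So sizes of twin classes are values
  of the totient function, which decide the direction of an arc up to one ambiguity that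
  involutions resolve (\<open>mixed_dir_iso\<close>); the exceptional case is that of a finite cyclic torsion
  subgroup. Suppose next that all orders are powers of one prime \<open>p\<close>. Then cyclic subgroups form a
  tree, a twin class is an unbranched segment of it, and the graph together with \<open>p\<close> determines
  how many elements of each order a twin class contains (\<open>p_torsion_dir_iso\<close>). The two situations
  are told apart by comparing sizes of twin classes along an edge (\<open>p_torsion_not_mixed\<close>).

  It remains to see that the prime \<open>p\<close> is determined. Some set of vertices that is described by
  the graph has \<open>p\<^sup>k > 1\<close> elements, unless the torsion elements are trivial or form a Pruefer
  group (\<open>equal_primes_or_complete\<close>; this uses nilpotency through \<open>finite_dominators\<close>). In the
  latter case the group also has elements of infinite order, since it is not itself a Pruefer
  group. The torsion subgroup is central, and \<open>p\<close> is recovered from a class of elements of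
  infinite order as the largest number of minimal proper roots, pairwise without common root, that
  an element can have (\<open>quasicyclic_prime_le\<close>).
\<close>

section \<open>Powers, commensurability and torsion\<close>

definition pow_to :: "('a, 'c) monoid_scheme \<Rightarrow> 'a \<Rightarrow> 'a \<Rightarrow> bool" where
  "pow_to G x y \<longleftrightarrow> (\<exists>n::int. n \<noteq> 0 \<and> y = x [^]\<^bsub>G\<^esub> n)"

text \<open>
  Reflexive version of adjacency in the power graph, so that sets of neighbours are closed
  neighbourhoods and isomorphisms need no case distinction on equality.
\<close>

definition padj :: "('a, 'c) monoid_scheme \<Rightarrow> 'a \<Rightarrow> 'a \<Rightarrow> bool" where
  "padj G x y \<longleftrightarrow> pow_to G x y \<or> pow_to G y x"

definition commens :: "('a, 'c) monoid_scheme \<Rightarrow> 'a \<Rightarrow> 'a \<Rightarrow> bool" where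
  "commens G x y \<longleftrightarrow> (\<exists>(a::int) (b::int). a \<noteq> 0 \<and> b \<noteq> 0 \<and> x [^]\<^bsub>G\<^esub> a = y [^]\<^bsub>G\<^esub> b)"

definition commens_class :: "('a, 'c) monoid_scheme \<Rightarrow> 'a \<Rightarrow> 'a set" where
  "commens_class G x = {y \<in> carrier G. commens G x y}"

definition torsion :: "('a, 'c) monoid_scheme \<Rightarrow> 'a set" where
  "torsion G = {x \<in> carrier G. group.ord G x \<noteq> 0}"

text \<open>
  Names starting with \<open>inf\<close> concern elements of infinite order.
\<close>

definition inf_class :: "('a, 'c) monoid_scheme \<Rightarrow> 'a set \<Rightarrow> bool" where
  "inf_class G C \<longleftrightarrow> (\<exists>x \<in> carrier G. x \<notin> torsion G \<and> C = commens_class G x)"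

lemma padj_sym: "padj G x y \<longleftrightarrow> padj G y x"
  by (auto simp: padj_def)

context group
begin

lemma pow_toI: "n \<noteq> 0 \<Longrightarrow> pow_to G x (x [^] (n::int))"
  by (auto simp: pow_to_def)

lemma pow_to_refl: "x \<in> carrier G \<Longrightarrow> pow_to G x x"
  by (metis int_pow_1 pow_toI zero_neq_one)

lemma pow_to_closed: "pow_to G x y \<Longrightarrow> x \<in> carrier G \<Longrightarrow> y \<in> carrier G"
  by (auto simp: pow_to_def)

lemma pow_to_trans: "pow_to G x y \<Longrightarrow> pow_to G y z \<Longrightarrow> x \<in> carrier G \<Longrightarrow> pow_to G x z"
  by (auto simp: pow_to_def int_pow_pow) (metis mult_eq_0_iff)

lemma padj_refl: "x \<in> carrier G \<Longrightarrow> padj G x x"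
  by (simp add: padj_def pow_to_refl)

lemma in_torsion_iff: "x \<in> torsion G \<longleftrightarrow> x \<in> carrier G \<and> ord x \<noteq> 0"
  by (simp add: torsion_def)

lemma torsion_carrier: "x \<in> torsion G \<Longrightarrow> x \<in> carrier G"
  by (simp add: torsion_def)

lemma one_torsion: "\<one> \<in> torsion G"
  by (simp add: torsion_def)

lemma torsion_iff_int_pow:
  assumes "x \<in> carrier G"
  shows "x \<in> torsion G \<longleftrightarrow> (\<exists>n::int. n \<noteq> 0 \<and> x [^] n = \<one>)"
  using assms
  by (metis dvd_0_left_iff dvd_refl in_torsion_iff int_pow_eq_id of_nat_0_eq_iff)

lemma int_pow_torsion_iff:
  assumes "x \<in> carrier G" "n \<noteq> 0"
  shows "x [^] (n::int) \<in> torsion G \<longleftrightarrow> x \<in> torsion G"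
proof
  assume "x [^] n \<in> torsion G"
  then obtain m::int where "m \<noteq> 0" "(x [^] n) [^] m = \<one>"
    using assms torsion_iff_int_pow by (metis int_pow_closed)
  then show "x \<in> torsion G"
    using assms by (metis int_pow_pow mult_eq_0_iff torsion_iff_int_pow)
next
  assume "x \<in> torsion G"
  then obtain m::int where "m \<noteq> 0" "x [^] m = \<one>"
    using assms torsion_iff_int_pow by metis
  then have "(x [^] n) [^] m = \<one>"
    using assms by (metis int_pow_one int_pow_pow mult.commute)
  then show "x [^] n \<in> torsion G"
    using assms \<open>m \<noteq> 0\<close> by (metis int_pow_closed torsion_iff_int_pow)
qed

lemma pow_to_torsion_iff:
  "pow_to G x y \<Longrightarrow> x \<in> carrier G \<Longrightarrow> y \<in> torsion G \<longleftrightarrow> x \<in> torsion G"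
  by (auto simp: pow_to_def int_pow_torsion_iff)

lemma inf_int_pow_eq:
  assumes "x \<in> carrier G" "x \<notin> torsion G"
  shows "x [^] (m::int) = x [^] n \<longleftrightarrow> m = n"
  using assms by (auto simp: int_pow_eq in_torsion_iff)

lemma commens_refl: "x \<in> carrier G \<Longrightarrow> commens G x x"
  unfolding commens_def by (rule exI[of _ 1], rule exI[of _ 1]) simp

lemma commens_sym: "commens G x y \<Longrightarrow> commens G y x"
  unfolding commens_def by metis

lemma commens_trans:
  assumes "commens G x y" "commens G y z" "x \<in> carrier G" "y \<in> carrier G" "z \<in> carrier G"
  shows "commens G x z"
proof -
  obtain a b c d :: int where "a \<noteq> 0" "b \<noteq> 0" "c \<noteq> 0" "d \<noteq> 0"
    and e: "x [^] a = y [^] b" "y [^] c = z [^] d"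
    using assms unfolding commens_def by metis
  moreover have "x [^] (a * c) = z [^] (d * b)"
    using e assms by (metis int_pow_pow mult.commute)
  ultimately show ?thesis unfolding commens_def by (metis mult_eq_0_iff)
qed

lemma pow_to_commens: "pow_to G x y \<Longrightarrow> x \<in> carrier G \<Longrightarrow> commens G x y"
  unfolding pow_to_def commens_def by (metis int_pow_1 int_pow_closed zero_neq_one)

lemma padj_commens: "padj G x y \<Longrightarrow> x \<in> carrier G \<Longrightarrow> y \<in> carrier G \<Longrightarrow> commens G x y"
  unfolding padj_def using pow_to_commens commens_sym by blast

text \<open>
  A common power of two elements is a common neighbour, and commensurability is transitive; this
  makes commensurability a notion of the undirected graph.
\<close>

lemma commens_iff_padj:
  assumes "x \<in> carrier G" "y \<in> carrier G"
  shows "commens G x y \<longleftrightarrow> (\<exists>z \<in> carrier G. padj G x z \<and> padj G z y)"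
proof
  assume "commens G x y"
  then obtain a b :: int where "a \<noteq> 0" "b \<noteq> 0" "x [^] a = y [^] b"
    unfolding commens_def by blast
  then show "\<exists>z \<in> carrier G. padj G x z \<and> padj G z y"
    using assms pow_toI[of a x] pow_toI[of b y]
    by (intro bexI[of _ "x [^] a"]) (auto simp: padj_def)
qed (use assms commens_trans padj_commens in blast)

lemma commens_torsion:
  assumes "commens G x y" "x \<in> carrier G" "y \<in> carrier G"
  shows "x \<in> torsion G \<longleftrightarrow> y \<in> torsion G"
  using assms unfolding commens_def by (metis int_pow_torsion_iff)

lemma torsion_commens:
  assumes "x \<in> torsion G" "y \<in> torsion G"
  shows "commens G x y"
  using assms unfolding commens_def by (metis torsion_carrier torsion_iff_int_pow)

lemma commens_class_torsion: "x \<in> torsion G \<Longrightarrow> commens_class G x = torsion G"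
  unfolding commens_class_def
  using commens_torsion torsion_commens torsion_carrier by blast

lemma inf_classD:
  assumes "inf_class G C"
  shows inf_class_carrier: "\<And>x. x \<in> C \<Longrightarrow> x \<in> carrier G"
    and inf_class_not_torsion: "\<And>x. x \<in> C \<Longrightarrow> x \<notin> torsion G"
    and inf_class_commens: "\<And>x y. x \<in> C \<Longrightarrow> y \<in> C \<Longrightarrow> commens G x y"
    and inf_class_mem: "\<And>x y. x \<in> C \<Longrightarrow> y \<in> carrier G \<Longrightarrow> commens G x y \<Longrightarrow> y \<in> C"
    and inf_class_nonempty: "C \<noteq> {}"
proof -
  obtain x0 where x0: "x0 \<in> carrier G" "x0 \<notin> torsion G" "C = commens_class G x0"
    using assms unfolding inf_class_def by blast
  show "\<And>x. x \<in> C \<Longrightarrow> x \<in> carrier G"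
    "\<And>x. x \<in> C \<Longrightarrow> x \<notin> torsion G" "C \<noteq> {}"
    using x0 commens_torsion commens_refl by (auto simp: commens_class_def)
  show "\<And>x y. x \<in> C \<Longrightarrow> y \<in> C \<Longrightarrow> commens G x y"
    "\<And>x y. x \<in> C \<Longrightarrow> y \<in> carrier G \<Longrightarrow> commens G x y \<Longrightarrow> y \<in> C"
    using x0 unfolding commens_class_def by (blast intro: commens_trans commens_sym)+
qed

lemma inf_class_pow:
  assumes "inf_class G C" "x \<in> C" "n \<noteq> 0"
  shows "x [^] (n::int) \<in> C"
proof (rule inf_class_mem[OF assms(1,2)])
  show "x [^] n \<in> carrier G" using inf_class_carrier assms by blast
  show "commens G x (x [^] n)" using inf_class_carrier assms pow_toI pow_to_commens by blast
qed

lemma inf_class_pow_to: "inf_class G C \<Longrightarrow> x \<in> C \<Longrightarrow> pow_to G x y \<Longrightarrow> y \<in> C"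
  by (metis pow_to_def inf_class_pow)

lemma inf_class_root:
  "inf_class G C \<Longrightarrow> y \<in> C \<Longrightarrow> x \<in> carrier G \<Longrightarrow> pow_to G x y \<Longrightarrow> x \<in> C"
  using inf_class_mem commens_sym pow_to_commens by blast

lemma inf_pow_to_iff:
  assumes "x \<in> carrier G" "x \<notin> torsion G" "m \<noteq> 0" "n \<noteq> 0"
  shows "pow_to G (x [^] (m::int)) (x [^] n) \<longleftrightarrow> m dvd n"
  using assms by (auto simp: pow_to_def int_pow_pow inf_int_pow_eq dvd_def)

lemma inf_padj_iff:
  assumes "x \<in> carrier G" "x \<notin> torsion G" "m \<noteq> 0" "n \<noteq> 0"
  shows "padj G (x [^] (m::int)) (x [^] n) \<longleftrightarrow> m dvd n \<or> n dvd m"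
  using assms by (simp add: padj_def inf_pow_to_iff)

lemma inf_pow_to_base_iff:
  assumes "x \<in> carrier G" "x \<notin> torsion G" "n \<noteq> 0"
  shows "pow_to G (x [^] (n::int)) x \<longleftrightarrow> \<bar>n\<bar> = 1"
  using inf_pow_to_iff[of x n 1] assms by simp

end

section \<open>Orientations of a class of elements of infinite order\<close>

text \<open>
  The number \<open>n m + 1\<close> is coprime to \<open>n\<close> and \<open>m\<close>. It serves to connect two powers of an element by
  way of a third that is adjacent to neither.
\<close>

lemma incomparable_integer:
  fixes n m :: int
  assumes "1 < \<bar>n\<bar>" "1 < \<bar>m\<bar>"
  shows "\<exists>k. 1 < \<bar>k\<bar> \<and> \<not> n dvd k \<and> \<not> k dvd n \<and> \<not> m dvd k \<and> \<not> k dvd m"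
proof -
  let ?k = "n * m + 1"
  have "2 * 2 \<le> \<bar>n\<bar> * \<bar>m\<bar>" using assms by (intro mult_mono) auto
  then have "4 \<le> \<bar>n * m\<bar>" by (simp add: abs_mult)
  then have k: "1 < \<bar>?k\<bar>" by linarith
  have "\<not> n dvd ?k" "\<not> m dvd ?k"
    using assms dvd_add_right_iff[of n "n * m" 1] dvd_add_right_iff[of m "n * m" 1] by simp_all
  moreover have "\<not> ?k dvd n * m"
  proof
    assume "?k dvd n * m"
    then have "?k dvd 1" using dvd_add_right_iff[of ?k "n * m" 1] by simp
    then show False using k by simp
  qed
  then have "\<not> ?k dvd n" "\<not> ?k dvd m" using dvd_mult2 dvd_mult by blast+
  ultimately show ?thesis using k by blast
qed

text \<open>
  The relations \<open>Q\<close> obtained by pulling the power relation of another group back along a graph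
  isomorphism: preorders with symmetrisation \<open>padj\<close>. The last clause fixes \<open>Q\<close> between vertices
  that the graph does not separate, such as an element and its inverse.
\<close>

definition orients :: "('a, 'c) monoid_scheme \<Rightarrow> 'a set \<Rightarrow> ('a \<Rightarrow> 'a \<Rightarrow> bool) \<Rightarrow> bool" where
  "orients G C Q \<longleftrightarrow> (\<forall>x \<in> C. \<forall>y \<in> C. \<forall>z \<in> C. Q x y \<longrightarrow> Q y z \<longrightarrow> Q x z) \<and>
     (\<forall>x \<in> C. \<forall>y \<in> C. padj G x y \<longleftrightarrow> Q x y \<or> Q y x) \<and>
     (\<forall>x \<in> C. \<forall>y \<in> C. (\<forall>w \<in> C. padj G x w \<longleftrightarrow> padj G y w) \<longrightarrow> Q x y)"

definition forward_at :: "('a, 'c) monoid_scheme \<Rightarrow> ('a \<Rightarrow> 'a \<Rightarrow> bool) \<Rightarrow> 'a \<Rightarrow> bool" where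
  "forward_at G Q x \<longleftrightarrow> (\<forall>n::int. 1 < \<bar>n\<bar> \<longrightarrow> Q x (x [^]\<^bsub>G\<^esub> n))"

lemma orientsD:
  assumes "orients G C Q"
  shows orients_trans: "\<And>x y z. x \<in> C \<Longrightarrow> y \<in> C \<Longrightarrow> z \<in> C \<Longrightarrow> Q x y \<Longrightarrow> Q y z \<Longrightarrow> Q x z"
    and orients_padj: "\<And>x y. x \<in> C \<Longrightarrow> y \<in> C \<Longrightarrow> padj G x y \<longleftrightarrow> Q x y \<or> Q y x"
    and orients_twin: "\<And>x y. x \<in> C \<Longrightarrow> y \<in> C \<Longrightarrow> (\<And>w. w \<in> C \<Longrightarrow> padj G x w \<longleftrightarrow> padj G y w) \<Longrightarrow> Q x y"
  using assms unfolding orients_def by blast+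

lemma orients_converse:
  assumes "orients G C Q"
  shows "orients G C (\<lambda>x y. Q y x)"
  unfolding orients_def
proof (intro conjI ballI impI)
  fix x y z assume "x \<in> C" "y \<in> C" "z \<in> C" "Q y x" "Q z y"
  then show "Q z x" using orients_trans[OF assms] by blast
next
  fix x y assume "x \<in> C" "y \<in> C"
  then show "padj G x y \<longleftrightarrow> Q y x \<or> Q x y" using orients_padj[OF assms] by blast
next
  fix x y assume "x \<in> C" "y \<in> C" "\<forall>w \<in> C. padj G x w \<longleftrightarrow> padj G y w"
  then show "Q y x" using orients_twin[OF assms, of y x] by blast
qed

text \<open>
  If \<open>b\<close> and \<open>c\<close> are not adjacent, arcs \<open>a b\<close> and \<open>a c\<close> point the same way at \<open>a\<close>, since otherwise
  transitivity would produce an arc between \<open>b\<close> and \<open>c\<close>.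
\<close>

lemma orients_forcing:
  assumes "orients G C Q" "a \<in> C" "b \<in> C" "c \<in> C" "padj G a c" "\<not> padj G b c" "Q a b"
  shows "Q a c"
proof (rule ccontr)
  assume "\<not> Q a c"
  then have "Q c a" using assms orients_padj[OF assms(1)] by blast
  then have "Q c b" using assms orients_trans[OF assms(1)] by blast
  then show False using assms orients_padj[OF assms(1)] by blast
qed

context group
begin

lemma inf_padj_pow:
  "n \<noteq> 0 \<Longrightarrow> padj G x (x [^] (n::int))"
  by (simp add: padj_def pow_toI)

text \<open>
  Any two proper powers of \<open>x\<close> are both non-adjacent to a third one, so forcing gives all of them
  the same direction.
\<close>

lemma forward_dichotomy:
  assumes C: "inf_class G C" and Q: "orients G C Q" and x: "x \<in> C"
  shows "forward_at G Q x \<or> forward_at G (\<lambda>x y. Q y x) x"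
proof -
  have xc: "x \<in> carrier G" "x \<notin> torsion G" using C x inf_classD by blast+
  have step: "R x (x [^] m)" if R: "orients G C R" and n: "1 < \<bar>n\<bar>" "R x (x [^] n)" and m: "1 < \<bar>m\<bar>"
    for R and n m :: int
  proof -
    obtain k where k: "1 < \<bar>k\<bar>" "\<not> n dvd k" "\<not> k dvd n" "\<not> m dvd k" "\<not> k dvd m"
      using incomparable_integer n m by blast
    have C': "x [^] n \<in> C" "x [^] m \<in> C" "x [^] k \<in> C"
      using n m k by (auto intro!: inf_class_pow[OF C x])
    have "\<not> padj G (x [^] n) (x [^] k)" "\<not> padj G (x [^] k) (x [^] m)"
      using xc n m k by (subst inf_padj_iff; force)+
    moreover have "padj G x (x [^] k)" "padj G x (x [^] m)"
      using k m by (auto intro!: inf_padj_pow)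
    ultimately show ?thesis
      using orients_forcing[OF R x] C' n by metis
  qed
  have "x [^] (2::int) \<in> C" by (intro inf_class_pow[OF C x]) simp
  moreover have "padj G x (x [^] (2::int))" by (intro inf_padj_pow) simp
  ultimately have "Q x (x [^] (2::int)) \<or> Q (x [^] (2::int)) x"
    using orients_padj[OF Q x] by blast
  then show ?thesis
    using step[OF Q, of 2] step[OF orients_converse[OF Q], of 2] unfolding forward_at_def by auto
qed

text \<open>
  A common power \<open>z\<close> of \<open>x\<close> and \<open>w\<close> is a proper power of both. If the arcs at \<open>x\<close> and at \<open>w\<close> had
  opposite directions, transitivity through \<open>z\<close> would make \<open>x\<close> and \<open>w\<close> adjacent.
\<close>

lemma forward_nonadjacent:
  assumes C: "inf_class G C" and Q: "orients G C Q" and x: "x \<in> C" and w: "w \<in> C"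
    and n: "\<not> padj G x w" and F: "forward_at G Q x"
  shows "forward_at G Q w"
proof -
  have xc: "x \<in> carrier G" "x \<notin> torsion G" "w \<in> carrier G" using C x w inf_classD by blast+
  obtain a b :: int where ab: "a \<noteq> 0" "b \<noteq> 0" "x [^] a = w [^] b"
    using inf_class_commens[OF C x w] unfolding commens_def by blast
  have unit: "pow_to G (y [^] k) y" if "y \<in> carrier G" "\<bar>k\<bar> = 1" for y and k :: int
  proof -
    have "k * k = 1" using that by (metis abs_mult_self_eq mult_1)
    then have "(y [^] k) [^] k = y" using that by (simp add: int_pow_pow)
    then show ?thesis using that unfolding pow_to_def by (metis abs_0 zero_neq_one)
  qed
  have "\<bar>a\<bar> \<noteq> 1" "\<bar>b\<bar> \<noteq> 1"
    using n unit[OF xc(1), of a] unit[OF xc(3), of b] pow_to_trans pow_toI[OF ab(1), of x]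
      pow_toI[OF ab(2), of w] xc ab(3) unfolding padj_def by metis+
  then have ab1: "1 < \<bar>a\<bar>" "1 < \<bar>b\<bar>" using ab by linarith+
  have z: "x [^] a \<in> C" by (intro inf_class_pow[OF C x] ab)
  show ?thesis
  proof (rule ccontr)
    assume "\<not> ?thesis"
    then have "forward_at G (\<lambda>x y. Q y x) w" using forward_dichotomy[OF C Q w] by blast
    then have "Q (w [^] b) w" using ab1 unfolding forward_at_def by blast
    moreover have "Q x (x [^] a)" using F ab1 unfolding forward_at_def by blast
    ultimately have "Q x w" using orients_trans[OF Q x z w] ab by simp
    then show False using n orients_padj[OF Q x w] by blast
  qed
qed

lemma forward_proper_powers:
  assumes C: "inf_class G C" and Q: "orients G C Q" and x: "x \<in> C"
    and n: "1 < \<bar>n\<bar>" and m: "1 < \<bar>m\<bar>" and F: "forward_at G Q (x [^] (n::int))"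
  shows "forward_at G Q (x [^] (m::int))"
proof -
  have xc: "x \<in> carrier G" "x \<notin> torsion G" using C x inf_classD by blast+
  obtain k where k: "1 < \<bar>k\<bar>" "\<not> n dvd k" "\<not> k dvd n" "\<not> m dvd k" "\<not> k dvd m"
    using incomparable_integer n m by blast
  have C': "x [^] n \<in> C" "x [^] m \<in> C" "x [^] k \<in> C"
    using n m k by (auto intro!: inf_class_pow[OF C x])
  have "\<not> padj G (x [^] n) (x [^] k)" "\<not> padj G (x [^] k) (x [^] m)"
    using xc n m k by (subst inf_padj_iff; force)+
  then show ?thesis using forward_nonadjacent[OF C Q] C' F by metis
qed

text \<open>
  This is the step from an element to its powers. It fails for a generator of an infinite cyclic
  class, whence the vertex \<open>w\<close> that is not adjacent to \<open>x\<close>. The direction is carried from \<open>x\<close> to a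
  power of \<open>w\<close> not adjacent to \<open>x\<close>, then among the proper powers of \<open>w\<close> to a common power of \<open>w\<close>
  and \<open>x\<close>.
\<close>

lemma forward_powers_iff:
  assumes C: "inf_class G C" and Q: "orients G C Q" and x: "x \<in> C"
    and nd: "w \<in> C" "\<not> padj G x w" and n: "1 < \<bar>n\<bar>"
  shows "forward_at G Q (x [^] (n::int)) \<longleftrightarrow> forward_at G Q x"
proof -
  have xc: "x \<in> carrier G" "x \<notin> torsion G" "w \<in> carrier G" "w \<notin> torsion G"
    using C x nd inf_classD by blast+
  obtain a b :: int where ab: "a \<noteq> 0" "b \<noteq> 0" "x [^] a = w [^] b"
    using inf_class_commens[OF C x nd(1)] unfolding commens_def by blast
  \<comment> \<open>if \<open>w\<^sup>2\<close> and \<open>w\<^sup>3\<close> were both powers of \<open>x\<close>, so would be \<open>w\<close>\<close>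
  have "\<exists>l::int. 1 < \<bar>l\<bar> \<and> \<not> padj G x (w [^] l)"
  proof (rule ccontr)
    assume *: "\<not> ?thesis"
    have nw: "\<not> pow_to G (w [^] l) x" if "l \<noteq> 0" for l :: int
      using nd(2) that pow_to_trans[OF pow_toI] xc(3) unfolding padj_def by blast
    have "pow_to G x (w [^] (2::int))" "pow_to G x (w [^] (3::int))"
      using * nw[of 2] nw[of 3] unfolding padj_def
      by (metis abs_numeral one_less_numeral_iff semiring_norm(76) zero_neq_numeral, metis abs_numeral one_less_numeral_iff semiring_norm(77) zero_neq_numeral)
    then obtain i j :: int where ij: "w [^] (2::int) = x [^] i" "w [^] (3::int) = x [^] j"
      unfolding pow_to_def by blast
    have "w = w [^] (3 + - 2 :: int)" using xc by simp
    also have "\<dots> = w [^] (3::int) \<otimes> inv (w [^] (2::int))"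
      using xc by (simp only: int_pow_mult int_pow_neg)
    also have "\<dots> = x [^] (j - i)"
      using ij xc by (simp add: int_pow_diff)
    finally have w: "w = x [^] (j - i)" .
    moreover have "j - i \<noteq> 0"
      using w xc one_torsion by (metis int_pow_0)
    ultimately show False using nd(2) unfolding padj_def by (metis pow_toI)
  qed
  then obtain l :: int where l: "1 < \<bar>l\<bar>" "\<not> padj G x (w [^] l)" by blast
  have wl: "w [^] l \<in> C" using l by (intro inf_class_pow[OF C nd(1)]) auto
  have one: "forward_at G Q x \<longleftrightarrow> forward_at G Q (w [^] l)"
    using forward_nonadjacent[OF C Q] x wl l padj_sym by metis
  \<comment> \<open>doubling makes the exponents of the common power proper\<close>
  have ab2: "1 < \<bar>a * 2\<bar>" "1 < \<bar>b * 2\<bar>" using ab by linarith+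
  have "x [^] (a * 2) = w [^] (b * 2)"
    using ab xc by (metis int_pow_pow)
  then have "forward_at G Q (w [^] l) \<longleftrightarrow> forward_at G Q (x [^] (a * 2))"
    using forward_proper_powers[OF C Q nd(1)] ab2 l by metis
  also have "\<dots> \<longleftrightarrow> forward_at G Q (x [^] n)"
    using forward_proper_powers[OF C Q x] ab2 n by blast
  finally show ?thesis using one by blast
qed

lemma forward_everywhere:
  assumes C: "inf_class G C" and Q: "orients G C Q"
    and nd: "\<And>x. x \<in> C \<Longrightarrow> \<exists>w \<in> C. \<not> padj G x w"
    and x: "x \<in> C" and y: "y \<in> C" and F: "forward_at G Q x"
  shows "forward_at G Q y"
proof -
  have xc: "x \<in> carrier G" "y \<in> carrier G" using C x y inf_classD by blast+
  obtain a b :: int where ab: "a \<noteq> 0" "b \<noteq> 0" "x [^] a = y [^] b"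
    using inf_class_commens[OF C x y] unfolding commens_def by blast
  have ab2: "1 < \<bar>a * 2\<bar>" "1 < \<bar>b * 2\<bar>" using ab by linarith+
  have e: "x [^] (a * 2) = y [^] (b * 2)"
    using ab xc by (metis int_pow_pow)
  show ?thesis
    using forward_powers_iff[OF C Q x _ _ ab2(1)] forward_powers_iff[OF C Q y _ _ ab2(2)] nd x y e F
    by metis
qed

lemma inf_mutual_pow:
  assumes "x \<in> carrier G" "x \<notin> torsion G" "pow_to G x y" "pow_to G y x"
  shows "y = x \<or> y = inv x"
proof -
  obtain n :: int where n: "n \<noteq> 0" "y = x [^] n" using assms by (auto simp: pow_to_def)
  then have "\<bar>n\<bar> = 1" using inf_pow_to_base_iff assms by blast
  then have "n = 1 \<or> n = - 1" by linarith
  then show ?thesis using n assms by (auto simp: int_pow_neg)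
qed

lemma pow_to_inv: "x \<in> carrier G \<Longrightarrow> pow_to G x (inv x)"
  unfolding pow_to_def by (rule exI[of _ "- 1"]) (simp add: int_pow_neg)

text \<open>
  If \<open>u = v\<^sup>k\<close> with \<open>\<bar>k\<bar> > 1\<close>, then some power of \<open>v\<close> is not adjacent to \<open>u\<close>; so only mutual
  powers have the same closed neighbourhood.
\<close>

lemma inf_twin_pow_to:
  assumes C: "inf_class G C" and u: "u \<in> C" and v: "v \<in> C"
    and N: "\<And>w. w \<in> C \<Longrightarrow> padj G u w \<longleftrightarrow> padj G v w"
  shows "pow_to G u v"
proof -
  have uc: "u \<in> carrier G" "v \<in> carrier G" "u \<notin> torsion G" "v \<notin> torsion G"
    using C u v inf_classD by blast+
  have "padj G u v" using N[OF v] padj_refl uc by blast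
  moreover have "pow_to G u v" if "pow_to G v u"
  proof -
    obtain k :: int where k: "k \<noteq> 0" "u = v [^] k" using \<open>pow_to G v u\<close> by (auto simp: pow_to_def)
    have "\<bar>k\<bar> = 1"
    proof (rule ccontr)
      assume "\<bar>k\<bar> \<noteq> 1"
      then have k1: "1 < \<bar>k\<bar>" using k by linarith
      obtain m where m: "1 < \<bar>m\<bar>" "\<not> k dvd m" "\<not> m dvd k"
        using incomparable_integer[OF k1 k1] by blast
      have "v [^] m \<in> C" using m by (intro inf_class_pow[OF C v]) auto
      moreover have "padj G v (v [^] m)" using m by (intro inf_padj_pow) auto
      moreover have "\<not> padj G u (v [^] m)"
        unfolding k(2) using uc k m by (subst inf_padj_iff) auto
      ultimately show False using N by blast
    qed
    then show ?thesis using inf_pow_to_base_iff k uc by blast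
  qed
  ultimately show ?thesis unfolding padj_def by blast
qed

lemma mutual_pow_padj:
  assumes "pow_to G x y" "pow_to G y x" "x \<in> carrier G" "y \<in> carrier G" "w \<in> carrier G"
  shows "padj G x w \<longleftrightarrow> padj G y w"
  using assms pow_to_trans unfolding padj_def by blast

lemma orients_forward:
  assumes C: "inf_class G C" and Q: "orients G C Q"
    and F: "\<And>x. x \<in> C \<Longrightarrow> forward_at G Q x" and x: "x \<in> C" and y: "y \<in> C"
  shows "Q x y \<longleftrightarrow> pow_to G x y"
proof -
  have tr: "Q a b \<Longrightarrow> Q b c \<Longrightarrow> Q a c" and ad: "padj G a b \<longleftrightarrow> Q a b \<or> Q b a"
    and tw: "(\<And>w. w \<in> C \<Longrightarrow> padj G a w \<longleftrightarrow> padj G b w) \<Longrightarrow> Q a b"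
    if "a \<in> C" "b \<in> C" "c \<in> C" for a b c
    using orientsD[OF Q] that by blast+
  have cc: "a \<in> carrier G" "a \<notin> torsion G" if "a \<in> C" for a using that C inf_classD by blast+
  have to: "Q u v" if uv: "u \<in> C" "v \<in> C" "pow_to G u v" for u v
  proof -
    obtain n :: int where n: "n \<noteq> 0" "v = u [^] n" using uv by (auto simp: pow_to_def)
    show ?thesis
    proof (cases "\<bar>n\<bar> = 1")
      case True
      then have "pow_to G v u" using n inf_pow_to_base_iff cc uv by blast
      then show ?thesis
        using tw[OF uv(1,2)] mutual_pow_padj uv cc by meson
    next
      case False
      then have "1 < \<bar>n\<bar>" using n by linarith
      then show ?thesis using F[OF uv(1)] n unfolding forward_at_def by blast
    qed
  qed
  show ?thesis
  proof
    assume q: "Q x y"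
    then have "padj G x y" using ad x y by blast
    moreover have "pow_to G x y" if "pow_to G y x"
    proof (rule inf_twin_pow_to[OF C x y])
      have "Q y x" using to x y that by blast
      then show "padj G x w \<longleftrightarrow> padj G y w" if "w \<in> C" for w
        using q tr[OF x y that] tr[OF y x that] tr[OF that x y] tr[OF that y x]
          ad[OF x that that] ad[OF y that that] by blast
    qed
    ultimately show "pow_to G x y" unfolding padj_def by blast
  qed (use to x y in blast)
qed

text \<open>
  The comparability graph of a class without a vertex adjacent to all others is uniquely
  orientable up to reversal: all arcs force each other.
\<close>

lemma orientation_unique:
  assumes C: "inf_class G C" and Q: "orients G C Q"
    and nd: "\<And>x. x \<in> C \<Longrightarrow> \<exists>w \<in> C. \<not> padj G x w"
  shows "(\<forall>x \<in> C. \<forall>y \<in> C. Q x y \<longleftrightarrow> pow_to G x y) \<or> (\<forall>x \<in> C. \<forall>y \<in> C. Q x y \<longleftrightarrow> pow_to G y x)"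
proof -
  obtain x where x: "x \<in> C" using inf_class_nonempty[OF C] by blast
  consider "forward_at G Q x" | "forward_at G (\<lambda>x y. Q y x) x"
    using forward_dichotomy[OF C Q x] by blast
  then show ?thesis
  proof cases
    case 1
    then have "forward_at G Q y" if "y \<in> C" for y
      using forward_everywhere[OF C Q nd x that] by blast
    then show ?thesis using orients_forward[OF C Q] by blast
  next
    case 2
    note Q' = orients_converse[OF Q]
    have "forward_at G (\<lambda>x y. Q y x) y" if "y \<in> C" for y
      using forward_everywhere[OF C Q' nd x that] 2 by blast
    then show ?thesis using orients_forward[OF C Q'] by blast
  qed
qed

end

section \<open>Directed isomorphisms between classes of elements of infinite order\<close>

definition dir_iso_on :: "('a, 'c) monoid_scheme \<Rightarrow> 'a set \<Rightarrow> ('b, 'd) monoid_scheme \<Rightarrow> 'b set \<Rightarrow> bool" where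
  "dir_iso_on G C H D \<longleftrightarrow> (\<exists>g. bij_betw g C D \<and>
     (\<forall>x \<in> C. \<forall>y \<in> C. pow_to G x y \<longleftrightarrow> pow_to H (g x) (g y)))"

text \<open>
  The partial correspondence \<open>u\<^sup>r \<mapsto> v\<^sup>r\<close> for rational exponents \<open>r = a / b\<close>.
\<close>

definition power_match :: "('a, 'c) monoid_scheme \<Rightarrow> 'a \<Rightarrow> ('b, 'd) monoid_scheme \<Rightarrow> 'b \<Rightarrow> 'a \<Rightarrow> 'b \<Rightarrow> bool" where
  "power_match G u H v x y \<longleftrightarrow> (\<exists>(a::int) (b::int). a \<noteq> 0 \<and> b \<noteq> 0 \<and>
     x [^]\<^bsub>G\<^esub> b = u [^]\<^bsub>G\<^esub> a \<and> y [^]\<^bsub>H\<^esub> b = v [^]\<^bsub>H\<^esub> a)"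

definition unique_roots :: "('a, 'c) monoid_scheme \<Rightarrow> 'a set \<Rightarrow> bool" where
  "unique_roots G C \<longleftrightarrow> (\<forall>x \<in> C. \<forall>y \<in> C. \<forall>n::int. n \<noteq> 0 \<longrightarrow> x [^]\<^bsub>G\<^esub> n = y [^]\<^bsub>G\<^esub> n \<longrightarrow> x = y)"

lemma power_match_sym: "power_match G u H v x y \<longleftrightarrow> power_match H v G u y x"
  unfolding power_match_def by blast

text \<open>
  The exponent \<open>a / b\<close> is determined by \<open>x\<close> because \<open>u\<close> has infinite order, and determines \<open>y\<close>
  because roots in \<open>D\<close> are unique.
\<close>

lemma power_match_functional:
  assumes "group G" "group H" and C: "inf_class G C" and D: "inf_class H D" "unique_roots H D"
    and m: "power_match G u H v x y" "power_match G u H v x y'"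
    and mem: "u \<in> C" "v \<in> D" "x \<in> C" "y \<in> D" "y' \<in> D"
  shows "y = y'"
proof -
  interpret G: group G by fact
  interpret H: group H by fact
  have c: "u \<in> carrier G" "u \<notin> torsion G" "x \<in> carrier G"
    "v \<in> carrier H" "y \<in> carrier H" "y' \<in> carrier H"
    using C D mem G.inf_classD H.inf_classD by blast+
  obtain a b a' b' :: int where ab: "b \<noteq> 0" "b' \<noteq> 0"
    and e: "x [^]\<^bsub>G\<^esub> b = u [^]\<^bsub>G\<^esub> a" "y [^]\<^bsub>H\<^esub> b = v [^]\<^bsub>H\<^esub> a"
    "x [^]\<^bsub>G\<^esub> b' = u [^]\<^bsub>G\<^esub> a'" "y' [^]\<^bsub>H\<^esub> b' = v [^]\<^bsub>H\<^esub> a'"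
    using m unfolding power_match_def by blast
  have "u [^]\<^bsub>G\<^esub> (a * b') = x [^]\<^bsub>G\<^esub> (b * b')" using e c by (metis G.int_pow_pow)
  also have "\<dots> = u [^]\<^bsub>G\<^esub> (a' * b)" using e c by (metis G.int_pow_pow mult.commute)
  finally have aa: "a * b' = a' * b" using G.inf_int_pow_eq c by blast
  have "y [^]\<^bsub>H\<^esub> (b * b') = v [^]\<^bsub>H\<^esub> (a * b')" using e c by (metis H.int_pow_pow)
  also have "\<dots> = y' [^]\<^bsub>H\<^esub> (b * b')" using aa e c by (metis H.int_pow_pow mult.commute)
  finally show ?thesis using D mem ab unfolding unique_roots_def by (metis mult_eq_0_iff)
qed

text \<open>
  Classes with unique roots behave like torsion-free groups of rank one: they are isomorphic as
  soon as some \<open>u\<close> and \<open>v\<close> have the same type, that is, admit the same rational exponents.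
\<close>

lemma rank_one_dir_iso:
  assumes "group G" "group H" and C: "inf_class G C" "unique_roots G C" and D: "inf_class H D" "unique_roots H D"
    and mem: "u \<in> C" "v \<in> D"
    and type: "\<And>(a::int) (b::int). a \<noteq> 0 \<Longrightarrow> b \<noteq> 0 \<Longrightarrow>
      (\<exists>x \<in> C. x [^]\<^bsub>G\<^esub> b = u [^]\<^bsub>G\<^esub> a) \<longleftrightarrow> (\<exists>y \<in> D. y [^]\<^bsub>H\<^esub> b = v [^]\<^bsub>H\<^esub> a)"
  shows "dir_iso_on G C H D"
proof -
  interpret G: group G by fact
  interpret H: group H by fact
  let ?m = "power_match G u H v"
  have cC: "x \<in> carrier G" if "x \<in> C" for x using that C G.inf_classD by blast
  have cD: "x \<in> carrier H" if "x \<in> D" for x using that D H.inf_classD by blast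
  have fun1: "y = y'" if "?m x y" "?m x y'" "x \<in> C" "y \<in> D" "y' \<in> D" for x y y'
    using power_match_functional[OF assms(1,2) C(1) D that(1,2) mem] that by blast
  have fun2: "x = x'" if "?m x y" "?m x' y" "x \<in> C" "x' \<in> C" "y \<in> D" for x x' y
    using power_match_functional[OF assms(2,1) D(1) C, of v u y x x'] that mem power_match_sym by metis
  have ex1: "\<exists>y \<in> D. ?m x y" if x: "x \<in> C" for x
  proof -
    obtain a b :: int where ab: "a \<noteq> 0" "b \<noteq> 0" "x [^]\<^bsub>G\<^esub> b = u [^]\<^bsub>G\<^esub> a"
      using G.inf_class_commens[OF C(1) x mem(1)] unfolding commens_def by blast
    then show ?thesis using type[of a b] x unfolding power_match_def by blast
  qed
  have ex2: "\<exists>x \<in> C. ?m x y" if y: "y \<in> D" for y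
  proof -
    obtain a b :: int where ab: "a \<noteq> 0" "b \<noteq> 0" "y [^]\<^bsub>H\<^esub> b = v [^]\<^bsub>H\<^esub> a"
      using H.inf_class_commens[OF D(1) y mem(2)] unfolding commens_def by blast
    then show ?thesis using type[of a b] y unfolding power_match_def by blast
  qed
  have pw: "?m (x [^]\<^bsub>G\<^esub> n) (y [^]\<^bsub>H\<^esub> n)" if m: "?m x y" and c: "x \<in> C" "y \<in> D" and n: "n \<noteq> 0" for x y and n :: int
  proof -
    obtain a b :: int where ab: "a \<noteq> 0" "b \<noteq> 0" "x [^]\<^bsub>G\<^esub> b = u [^]\<^bsub>G\<^esub> a" "y [^]\<^bsub>H\<^esub> b = v [^]\<^bsub>H\<^esub> a"
      using m unfolding power_match_def by blast
    have "(x [^]\<^bsub>G\<^esub> n) [^]\<^bsub>G\<^esub> b = u [^]\<^bsub>G\<^esub> (a * n)" "(y [^]\<^bsub>H\<^esub> n) [^]\<^bsub>H\<^esub> b = v [^]\<^bsub>H\<^esub> (a * n)"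
      using ab c cC cD mem by (metis G.int_pow_pow mult.commute, metis H.int_pow_pow mult.commute)
    then show ?thesis using ab n unfolding power_match_def by (metis mult_eq_0_iff)
  qed
  obtain g where g: "\<And>x. x \<in> C \<Longrightarrow> g x \<in> D \<and> ?m x (g x)" using ex1 by metis
  have "inj_on g C" using g fun2 by (intro inj_onI) metis
  moreover have "g ` C = D"
  proof
    show "D \<subseteq> g ` C"
    proof
      fix y assume y: "y \<in> D"
      then obtain x where "x \<in> C" "?m x y" using ex2 by blast
      then show "y \<in> g ` C" using fun1 g y by blast
    qed
  qed (use g in blast)
  moreover have "pow_to G x y \<longleftrightarrow> pow_to H (g x) (g y)" if xy: "x \<in> C" "y \<in> C" for x y
  proof
    assume "pow_to G x y"
    then obtain n :: int where n: "n \<noteq> 0" "y = x [^]\<^bsub>G\<^esub> n" unfolding pow_to_def by blast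
    have "g y = g x [^]\<^bsub>H\<^esub> n"
      using fun1[of y "g y" "g x [^]\<^bsub>H\<^esub> n"] pw[of x "g x" n] g xy n H.inf_class_pow[OF D(1)] by blast
    then show "pow_to H (g x) (g y)" using n unfolding pow_to_def by blast
  next
    assume "pow_to H (g x) (g y)"
    then obtain n :: int where n: "n \<noteq> 0" "g y = g x [^]\<^bsub>H\<^esub> n" unfolding pow_to_def by blast
    have "?m (x [^]\<^bsub>G\<^esub> n) (g y)" using pw[of x "g x" n] g xy n by simp
    then have "y = x [^]\<^bsub>G\<^esub> n"
      using fun2 g xy n G.inf_class_pow[OF C(1)] by blast
    then show "pow_to G x y" using n unfolding pow_to_def by blast
  qed
  ultimately show ?thesis unfolding dir_iso_on_def bij_betw_def by blast
qed

context group
begin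

text \<open>
  A vertex \<open>d = w\<^sup>n\<close> with \<open>\<bar>n\<bar> > 1\<close> is not adjacent to every power of \<open>w\<close>. So a vertex adjacent to
  its whole class has no proper roots.
\<close>

lemma dominated_class_cyclic:
  assumes C: "inf_class G C" and d: "d \<in> C" and dom: "\<And>w. w \<in> C \<Longrightarrow> padj G d w" and w: "w \<in> C"
  shows "pow_to G d w"
proof -
  have c: "d \<in> carrier G" "w \<in> carrier G" "w \<notin> torsion G" using C d w inf_classD by blast+
  have "pow_to G d w" if "pow_to G w d"
  proof -
    obtain n :: int where n: "n \<noteq> 0" "d = w [^] n" using \<open>pow_to G w d\<close> by (auto simp: pow_to_def)
    have "\<bar>n\<bar> = 1"
    proof (rule ccontr)
      assume "\<bar>n\<bar> \<noteq> 1"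
      then have n1: "1 < \<bar>n\<bar>" using n by linarith
      obtain k where k: "1 < \<bar>k\<bar>" "\<not> n dvd k" "\<not> k dvd n"
        using incomparable_integer[OF n1 n1] by blast
      then have "w [^] k \<in> C" by (intro inf_class_pow[OF C w]) auto
      moreover have "\<not> padj G (w [^] n) (w [^] k)" using c n k by (subst inf_padj_iff) auto
      ultimately show False using dom n by blast
    qed
    then show ?thesis using inf_pow_to_base_iff n c by blast
  qed
  then show ?thesis using dom[OF w] unfolding padj_def by blast
qed

lemma common_root_unique_roots:
  assumes C: "inf_class G C"
    and up: "\<And>x y. x \<in> C \<Longrightarrow> y \<in> C \<Longrightarrow> \<exists>s \<in> C. pow_to G s x \<and> pow_to G s y"
  shows "unique_roots G C"
  unfolding unique_roots_def
proof (intro ballI allI impI)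
  fix x y and n :: int
  assume xy: "x \<in> C" "y \<in> C" and n: "n \<noteq> 0" "x [^] n = y [^] n"
  obtain s i j where s: "s \<in> C" "x = s [^] (i::int)" "y = s [^] (j::int)"
    using up[OF xy] unfolding pow_to_def by blast
  have sc: "s \<in> carrier G" "s \<notin> torsion G" using s C inf_classD by blast+
  have "s [^] (i * n) = s [^] (j * n)" using s sc n by (metis int_pow_pow)
  then have "i = j" using n inf_int_pow_eq[OF sc] by simp
  then show "x = y" using s by simp
qed

lemma cyclic_class_roots_iff:
  assumes C: "inf_class G C" and d: "d \<in> C" and cyc: "\<And>w. w \<in> C \<Longrightarrow> pow_to G d w"
    and a: "(a::int) \<noteq> 0" and b: "(b::int) \<noteq> 0"
  shows "(\<exists>x \<in> C. x [^] b = d [^] a) \<longleftrightarrow> b dvd a"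
proof
  have c: "d \<in> carrier G" "d \<notin> torsion G" using C d inf_classD by blast+
  show "b dvd a" if ex: "\<exists>x \<in> C. x [^] b = d [^] a"
  proof -
    obtain x where x: "x \<in> C" "x [^] b = d [^] a" using ex by blast
    then obtain n :: int where "x = d [^] n" using cyc unfolding pow_to_def by blast
    then have "d [^] (n * b) = d [^] a" using x c by (simp add: int_pow_pow)
    then show ?thesis using inf_int_pow_eq[OF c] by auto
  qed
  show "\<exists>x \<in> C. x [^] b = d [^] a" if "b dvd a"
  proof -
    obtain k where k: "a = b * k" using \<open>b dvd a\<close> by (rule dvdE)
    then have "(d [^] k) [^] b = d [^] a" using c by (simp add: int_pow_pow mult.commute)
    moreover have "d [^] k \<in> C" using k a by (intro inf_class_pow[OF C d]) auto
    ultimately show ?thesis by blast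
  qed
qed

end

text \<open>
  Common powers always exist; reversing arcs turns them into common roots.
\<close>

lemma reversal_common_root:
  assumes "group G" "group H" and C: "inf_class G C" and D: "inf_class H D"
    and f: "bij_betw f C D" and rev: "\<And>x y. x \<in> C \<Longrightarrow> y \<in> C \<Longrightarrow> pow_to G x y \<longleftrightarrow> pow_to H (f y) (f x)"
    and y: "y \<in> D" "y' \<in> D"
  shows "\<exists>s \<in> D. pow_to H s y \<and> pow_to H s y'"
proof -
  interpret G: group G by fact
  obtain x x' where x: "x \<in> C" "x' \<in> C" "y = f x" "y' = f x'"
    using y f by (auto simp: bij_betw_def)
  obtain a b :: int where ab: "a \<noteq> 0" "b \<noteq> 0" "x [^]\<^bsub>G\<^esub> a = x' [^]\<^bsub>G\<^esub> b"
    using G.inf_class_commens[OF C x(1,2)] unfolding commens_def by blast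
  have z: "x [^]\<^bsub>G\<^esub> a \<in> C" using G.inf_class_pow[OF C x(1) ab(1)] .
  have "pow_to G x (x [^]\<^bsub>G\<^esub> a)" "pow_to G x' (x [^]\<^bsub>G\<^esub> a)"
    using ab by (auto simp: pow_to_def)
  then show ?thesis using rev z x f by (metis bij_betwE)
qed

text \<open>
  Write \<open>u\<close> and \<open>u\<^sup>p\<close> as images of \<open>x\<^sup>n\<close> and \<open>x\<close>. Then \<open>n\<close> is prime up to sign, as nothing lies
  strictly between \<open>u\<close> and \<open>u\<^sup>p\<close>. The elements between \<open>x\<close> and \<open>x\<^bsup>n n\<^esup>\<close> form a chain, so those
  between \<open>u\<^sup>p\<close> and the image \<open>s\<close> of \<open>x\<^bsup>n n\<^esup>\<close> do too. Comparing \<open>s\<^sup>p\<close> with \<open>u = s\<^sup>r\<close> inside this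
  chain shows that \<open>p\<close> divides \<open>r\<close>.
\<close>

lemma reversal_prime_root:
  fixes p :: int
  assumes "group G" "group H" and C: "inf_class G C" and D: "inf_class H D"
    and f: "bij_betw f C D" and rev: "\<And>x y. x \<in> C \<Longrightarrow> y \<in> C \<Longrightarrow> pow_to G x y \<longleftrightarrow> pow_to H (f y) (f x)"
    and u: "u \<in> D" and p: "prime p"
  shows "\<exists>s \<in> D. s [^]\<^bsub>H\<^esub> p = u"
proof -
  interpret G: group G by fact
  interpret H: group H by fact
  have cC: "x \<in> carrier G" "x \<notin> torsion G" if "x \<in> C" for x using that C G.inf_classD by blast+
  have cD: "x \<in> carrier H" "x \<notin> torsion H" if "x \<in> D" for x using that D H.inf_classD by blast+
  have p1: "1 < p" using p by (simp add: prime_gt_1_int)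
  have pdvd: "\<bar>c\<bar> = 1 \<or> \<bar>c\<bar> = p" if "c dvd p" for c
    using p that by (metis abs_dvd_iff abs_ge_zero prime_int_iff)
  let ?v = "u [^]\<^bsub>H\<^esub> p"
  have v: "?v \<in> D" using p1 by (intro H.inf_class_pow[OF D u]) simp
  obtain x y where xy: "x \<in> C" "y \<in> C" "f x = ?v" "f y = u"
    using u v f by (auto simp: bij_betw_def)
  have "pow_to H u ?v" using p1 by (intro H.pow_toI) simp
  then have "pow_to G x y" using rev[OF xy(1,2)] xy by simp
  then obtain n :: int where n: "n \<noteq> 0" "y = x [^]\<^bsub>G\<^esub> n" unfolding pow_to_def by blast
  have "\<bar>n\<bar> \<noteq> 1"
  proof
    assume "\<bar>n\<bar> = 1"
    then have "pow_to G y x" using G.inf_pow_to_base_iff n cC xy by blast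
    then have "pow_to H ?v u" using rev[OF xy(2,1)] xy by simp
    then have "\<bar>p\<bar> = 1" using H.inf_pow_to_base_iff[OF cD[OF u]] p1 by simp
    then show False using p1 by simp
  qed
  then have n1: "1 < \<bar>n\<bar>" using n by linarith
  \<comment> \<open>\<open>x\<^sup>m\<close> lies between \<open>x\<close> and \<open>x\<^sup>n\<close>, so its image lies between \<open>u\<close> and \<open>u\<^sup>p\<close>\<close>
  have irr: "m = 1 \<or> m = \<bar>n\<bar>" if m: "m \<ge> 0" "m dvd \<bar>n\<bar>" for m
  proof -
    have mn: "m dvd n" "m \<noteq> 0" using m n by auto
    have s: "x [^]\<^bsub>G\<^esub> m \<in> C" using G.inf_class_pow[OF C xy(1) mn(2)] .
    have "pow_to G x (x [^]\<^bsub>G\<^esub> m)" using mn by (intro G.pow_toI)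
    moreover have "pow_to G (x [^]\<^bsub>G\<^esub> m) y" unfolding n(2) using mn n G.inf_pow_to_iff[OF cC[OF xy(1)]] by blast
    ultimately have fs: "pow_to H (f (x [^]\<^bsub>G\<^esub> m)) ?v" "pow_to H u (f (x [^]\<^bsub>G\<^esub> m))"
      using rev[OF xy(1) s] rev[OF s xy(2)] xy by simp_all
    then obtain c :: int where c: "c \<noteq> 0" "f (x [^]\<^bsub>G\<^esub> m) = u [^]\<^bsub>H\<^esub> c" unfolding pow_to_def by blast
    have "c dvd p" using fs(1) c p1 H.inf_pow_to_iff[OF cD[OF u], of c p] by simp
    then consider "\<bar>c\<bar> = 1" | "\<bar>c\<bar> = p" using pdvd by blast
    then show ?thesis
    proof cases
      case 1
      then have "pow_to H (f (x [^]\<^bsub>G\<^esub> m)) u" using c H.inf_pow_to_base_iff[OF cD[OF u]] by simp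
      then have "pow_to G (x [^]\<^bsub>G\<^esub> n) (x [^]\<^bsub>G\<^esub> m)" using rev[OF xy(2) s] xy n by simp
      then have "n dvd m" using G.inf_pow_to_iff[OF cC[OF xy(1)]] n mn by blast
      then have "\<bar>n\<bar> = \<bar>m\<bar>" using mn zdvd_antisym_abs by blast
      then show ?thesis using m by simp
    next
      case 2
      then have "p dvd c" by (metis abs_dvd_iff dvd_abs_iff dvd_refl)
      then have "pow_to H ?v (f (x [^]\<^bsub>G\<^esub> m))" unfolding c(2)
        using H.inf_pow_to_iff[OF cD[OF u], of p c] c p1 by simp
      then have "pow_to G (x [^]\<^bsub>G\<^esub> m) x" using rev[OF s xy(1)] xy by simp
      then show ?thesis using m G.inf_pow_to_base_iff[OF cC[OF xy(1)] mn(2)] by simp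
    qed
  qed
  then have np: "prime \<bar>n\<bar>" using n1 by (simp add: prime_int_iff)
  have nn: "n * n \<noteq> 0" using n by simp
  let ?x2 = "x [^]\<^bsub>G\<^esub> (n * n)"
  have x2: "?x2 \<in> C" using G.inf_class_pow[OF C xy(1) nn] .
  let ?s = "f ?x2"
  have s: "?s \<in> D" using f x2 by (auto simp: bij_betw_def)
  have "pow_to G y ?x2" unfolding n(2) using G.inf_pow_to_iff[OF cC[OF xy(1)]] n nn by simp
  then have "pow_to H ?s u" using rev[OF xy(2) x2] xy by simp
  then obtain r :: int where r: "r \<noteq> 0" "u = ?s [^]\<^bsub>H\<^esub> r" unfolding pow_to_def by blast
  let ?t = "?s [^]\<^bsub>H\<^esub> p"
  have t: "?t \<in> D" using p1 by (intro H.inf_class_pow[OF D s]) simp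
  obtain w where w: "w \<in> C" "f w = ?t" using t f by (auto simp: bij_betw_def)
  have "?v = ?t [^]\<^bsub>H\<^esub> r" using r cD[OF s] by (metis H.int_pow_pow mult.commute)
  then have "pow_to H ?t ?v" using r unfolding pow_to_def by blast
  then have "pow_to G x w" using rev[OF xy(1) w(1)] w xy by simp
  then obtain d :: int where d: "d \<noteq> 0" "w = x [^]\<^bsub>G\<^esub> d" unfolding pow_to_def by blast
  have "pow_to H ?s ?t" using p1 by (intro H.pow_toI) simp
  then have "pow_to G w ?x2" using rev[OF w(1) x2] w by simp
  then have dn: "d dvd n * n" using G.inf_pow_to_iff[OF cC[OF xy(1)]] d nn by blast
  have "d dvd n \<or> n dvd d"
  proof (cases "n dvd d")
    case False
    then have "coprime d n" using np prime_imp_coprime[of "\<bar>n\<bar>" d] by (simp add: coprime_commute)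
    then show ?thesis using dn coprime_dvd_mult_left_iff by blast
  qed blast
  then have "padj G w y" unfolding d(2) n(2) using G.inf_padj_iff[OF cC[OF xy(1)]] d n by blast
  then have "padj H ?t u" using rev[OF w(1) xy(2)] rev[OF xy(2) w(1)] w xy unfolding padj_def by auto
  then have "p dvd r \<or> r dvd p"
    using r p1 H.inf_padj_iff[OF cD[OF s], of p r] by auto
  moreover have "p dvd r" if "r dvd p"
  proof -
    have "\<bar>r\<bar> \<noteq> 1"
    proof
      assume "\<bar>r\<bar> = 1"
      then have "pow_to H u ?s" using H.inf_pow_to_base_iff[OF cD[OF s] r(1)] r by simp
      then have "pow_to G ?x2 (x [^]\<^bsub>G\<^esub> n)" using rev[OF x2 xy(2)] xy n by simp
      then have "n * n dvd n" using G.inf_pow_to_iff[OF cC[OF xy(1)]] n nn by blast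
      then show False using n n1 by simp
    qed
    then have "\<bar>r\<bar> = p" using pdvd that by blast
    then show ?thesis by (metis abs_dvd_iff dvd_abs_iff dvd_refl)
  qed
  ultimately obtain k where k: "r = p * k" by (auto elim: dvdE)
  have "?s [^]\<^bsub>H\<^esub> k \<in> D" using k r by (intro H.inf_class_pow[OF D s]) auto
  moreover have "(?s [^]\<^bsub>H\<^esub> k) [^]\<^bsub>H\<^esub> p = u"
    using r k cD[OF s] by (metis H.int_pow_pow mult.commute)
  ultimately show ?thesis by blast
qed

lemma (in group) prime_roots_imp_roots:
  assumes C: "inf_class G C" and r: "\<And>u p. u \<in> C \<Longrightarrow> prime (p::int) \<Longrightarrow> \<exists>s \<in> C. s [^] p = u"
    and u: "u \<in> C" and n: "n \<noteq> 0"
  shows "\<exists>s \<in> C. s [^] (n::int) = u"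
proof -
  have pos: "\<exists>s \<in> C. s [^] (int m) = u" if "m > 0" "u \<in> C" for m u
    using that
  proof (induction m arbitrary: u rule: less_induct)
    case (less m)
    show ?case
    proof (cases "m = 1")
      case True
      then show ?thesis using less.prems inf_class_carrier[OF C] by auto
    next
      case False
      then obtain p where p: "prime p" "p dvd m" using prime_factor_nat by blast
      then obtain k where k: "m = p * k" by blast
      have "k > 0" using k less.prems by (cases "k = 0") simp_all
      then have "k < m" using k p prime_gt_1_nat[of p] by simp
      obtain s where s: "s \<in> C" "s [^] int p = u" using r[OF less.prems(2), of "int p"] p by auto
      obtain s' where s': "s' \<in> C" "s' [^] int k = s" using less.IH[OF \<open>k < m\<close> \<open>k > 0\<close> s(1)] by blast
      have "s' [^] int m = u" using s s' k inf_class_carrier[OF C s'(1)]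
        by (metis int_pow_pow mult.commute of_nat_mult)
      then show ?thesis using s' by blast
    qed
  qed
  show ?thesis
  proof (cases "n > 0")
    case True
    then show ?thesis using pos[of "nat n" u] u by simp
  next
    case False
    then obtain s where s: "s \<in> C" "s [^] (- n) = u" using pos[of "nat (- n)" u] u n by auto
    have "s [^] (- 1 :: int) \<in> C" by (intro inf_class_pow[OF C s(1)]) simp
    moreover have "(s [^] (- 1 :: int)) [^] n = u"
      using s inf_class_carrier[OF C s(1)] by (simp only: int_pow_pow) simp
    ultimately show ?thesis by blast
  qed
qed

text \<open>
  Both classes admit all rational exponents, so their types agree.
\<close>

lemma reversal_dir_iso:
  assumes "group G" "group H" and C: "inf_class G C" and D: "inf_class H D"
    and f: "bij_betw f C D" and rev: "\<And>x y. x \<in> C \<Longrightarrow> y \<in> C \<Longrightarrow> pow_to G x y \<longleftrightarrow> pow_to H (f y) (f x)"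
  shows "dir_iso_on G C H D"
proof -
  interpret G: group G by fact
  interpret H: group H by fact
  let ?h = "inv_into C f"
  have h: "bij_betw ?h D C" using f by (rule bij_betw_inv_into)
  have rev': "pow_to H x y \<longleftrightarrow> pow_to G (?h y) (?h x)" if "x \<in> D" "y \<in> D" for x y
    using rev[of "?h y" "?h x"] that f h by (simp add: bij_betw_inv_into_right bij_betw_apply)
  note fw = assms(1,2) C D f rev and bw = assms(2,1) D C h rev'
  have "unique_roots H D" by (rule H.common_root_unique_roots[OF D]) (rule reversal_common_root[OF fw])
  moreover have "unique_roots G C" by (rule G.common_root_unique_roots[OF C]) (rule reversal_common_root[OF bw])
  moreover have rH: "\<exists>s \<in> D. s [^]\<^bsub>H\<^esub> n = u" if "u \<in> D" "n \<noteq> 0" for u and n :: int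
    using H.prime_roots_imp_roots[OF D reversal_prime_root[OF fw] that] by blast
  moreover have rG: "\<exists>s \<in> C. s [^]\<^bsub>G\<^esub> n = u" if "u \<in> C" "n \<noteq> 0" for u and n :: int
    using G.prime_roots_imp_roots[OF C reversal_prime_root[OF bw] that] by blast
  moreover obtain u where u: "u \<in> C" using G.inf_class_nonempty[OF C] by blast
  moreover have v: "f u \<in> D" using u f by (auto simp: bij_betw_def)
  ultimately show ?thesis
    using G.inf_class_pow[OF C u] H.inf_class_pow[OF D v]
    by (intro rank_one_dir_iso[OF assms(1,2) C _ D _ u v]) blast+
qed

text \<open>
  The three cases are an infinite cyclic class, an isomorphism that preserves the direction of all
  arcs, and one that reverses all of them.
\<close>

lemma inf_class_dir_iso:
  assumes "group G" "group H" and C: "inf_class G C" and D: "inf_class H D"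
    and f: "bij_betw f C D" and adj: "\<And>x y. x \<in> C \<Longrightarrow> y \<in> C \<Longrightarrow> padj G x y \<longleftrightarrow> padj H (f x) (f y)"
  shows "dir_iso_on G C H D"
proof -
  interpret G: group G by fact
  interpret H: group H by fact
  have fD: "f x \<in> D" if "x \<in> C" for x using f that by (auto simp: bij_betw_def)
  have cD: "x \<in> carrier H" if "x \<in> D" for x using that D H.inf_classD by blast
  have surj: "\<exists>x \<in> C. f x = y" if "y \<in> D" for y using f that by (auto simp: bij_betw_def)
  show ?thesis
  proof (cases "\<exists>d \<in> C. \<forall>w \<in> C. padj G d w")
    case True
    then obtain d where d: "d \<in> C" "\<And>w. w \<in> C \<Longrightarrow> padj G d w" by blast
    have cG: "pow_to G d w" if "w \<in> C" for w using G.dominated_class_cyclic[OF C d that] .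
    have cH: "pow_to H (f d) w" if "w \<in> D" for w
      using H.dominated_class_cyclic[OF D fD[OF d(1)] _ that] adj d surj by metis
    have "unique_roots G C" by (rule G.common_root_unique_roots[OF C]) (use cG d in blast)
    moreover have "unique_roots H D" by (rule H.common_root_unique_roots[OF D]) (use cH d fD in blast)
    ultimately show ?thesis
      using rank_one_dir_iso[OF assms(1,2) C _ D _ d(1) fD[OF d(1)]]
        G.cyclic_class_roots_iff[OF C d(1) cG] H.cyclic_class_roots_iff[OF D fD[OF d(1)] cH]
      by simp
  next
    case False
    let ?Q = "\<lambda>x y. pow_to H (f x) (f y)"
    have "orients G C ?Q"
      unfolding orients_def
    proof (intro conjI ballI impI)
      fix x y z assume "x \<in> C" "y \<in> C" "z \<in> C" "?Q x y" "?Q y z"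
      then show "?Q x z" using H.pow_to_trans cD fD by blast
    next
      fix x y assume "x \<in> C" "y \<in> C"
      then show "padj G x y \<longleftrightarrow> ?Q x y \<or> ?Q y x" using adj by (simp add: padj_def)
    next
      fix x y assume xy: "x \<in> C" "y \<in> C" and N: "\<forall>w \<in> C. padj G x w \<longleftrightarrow> padj G y w"
      show "?Q x y"
      proof (rule H.inf_twin_pow_to[OF D])
        fix w assume "w \<in> D"
        then obtain w' where "w' \<in> C" "f w' = w" using surj by blast
        then show "padj H (f x) w \<longleftrightarrow> padj H (f y) w" using N adj xy by blast
      qed (use xy fD in auto)
    qed
    then consider "\<forall>x \<in> C. \<forall>y \<in> C. ?Q x y \<longleftrightarrow> pow_to G x y" | "\<forall>x \<in> C. \<forall>y \<in> C. ?Q x y \<longleftrightarrow> pow_to G y x"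
      using G.orientation_unique[OF C] False by blast
    then show ?thesis
    proof cases
      case 1
      then show ?thesis using f unfolding dir_iso_on_def by blast
    next
      case 2
      then show ?thesis using reversal_dir_iso[OF assms(1,2) C D f] by blast
    qed
  qed
qed

section \<open>Commutators in nilpotent groups\<close>

text \<open>
  The terms of the series enter only as normal subgroups that absorb commutators, so the simplifier
  should not unfold them to generated sets.
\<close>

lemmas [simp del] = lower_central.simps(2)

context group
begin

definition commutator :: "'a \<Rightarrow> 'a \<Rightarrow> 'a" where
  "commutator x y = x \<otimes> y \<otimes> inv x \<otimes> inv y"

lemma inv_l_cancel: "x \<in> carrier G \<Longrightarrow> y \<in> carrier G \<Longrightarrow> inv x \<otimes> (x \<otimes> y) = y"
  by (simp add: m_assoc[symmetric])

lemma inv_r_cancel: "x \<in> carrier G \<Longrightarrow> y \<in> carrier G \<Longrightarrow> x \<otimes> (inv x \<otimes> y) = y"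
  by (simp add: m_assoc[symmetric])

lemmas word_simps = m_assoc inv_mult_group inv_l_cancel inv_r_cancel

lemma commutator_closed [simp, intro]: "x \<in> carrier G \<Longrightarrow> y \<in> carrier G \<Longrightarrow> commutator x y \<in> carrier G"
  by (simp add: commutator_def)

lemma commutator_swap: "x \<in> carrier G \<Longrightarrow> y \<in> carrier G \<Longrightarrow> x \<otimes> y = commutator x y \<otimes> (y \<otimes> x)"
  by (simp add: commutator_def word_simps)

lemma commutator_inverse: "x \<in> carrier G \<Longrightarrow> y \<in> carrier G \<Longrightarrow> inv (commutator x y) = commutator y x"
  by (simp add: commutator_def word_simps)

lemma commutator_eq_one_iff: "x \<in> carrier G \<Longrightarrow> y \<in> carrier G \<Longrightarrow> commutator x y = \<one> \<longleftrightarrow> x \<otimes> y = y \<otimes> x"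
  by (metis commutator_closed commutator_swap l_one m_closed one_closed right_cancel)

lemma conj_hom: "t \<in> carrier G \<Longrightarrow> group_hom G G (\<lambda>x. t \<otimes> x \<otimes> inv t)"
  by unfold_locales (auto simp: hom_def word_simps)

lemma conj_int_pow:
  "t \<in> carrier G \<Longrightarrow> x \<in> carrier G \<Longrightarrow> t \<otimes> x [^] (n::int) \<otimes> inv t = (t \<otimes> x \<otimes> inv t) [^] n"
  using group_hom.hom_int_pow[OF conj_hom] by blast

lemma conj_nat_pow:
  "t \<in> carrier G \<Longrightarrow> x \<in> carrier G \<Longrightarrow> t \<otimes> x [^] (n::nat) \<otimes> inv t = (t \<otimes> x \<otimes> inv t) [^] n"
  using group_hom.hom_nat_pow[OF conj_hom] by blast

text \<open>
  The set of commutators that generates the next term is closed under conjugation.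
\<close>

lemma lower_central_normal: "lower_central G n \<lhd> G"
proof (induction n)
  case 0
  then show ?case by (simp add: normal_self)
next
  case (Suc n)
  note sub = normal_invE(1)[OF Suc] and cl = normal_invE(2)[OF Suc]
  have car: "h \<in> carrier G" if "h \<in> lower_central G n" for h
    using that subgroup.subset[OF sub] by blast
  show ?case
    unfolding lower_central.simps
  proof (rule normal_generateI)
    show "(\<Union>h \<in> lower_central G n. \<Union>g \<in> carrier G. {h \<otimes> g \<otimes> inv h \<otimes> inv g}) \<subseteq> carrier G"
      using car by auto
    fix w t assume w: "w \<in> (\<Union>h \<in> lower_central G n. \<Union>g \<in> carrier G. {h \<otimes> g \<otimes> inv h \<otimes> inv g})"
      and t: "t \<in> carrier G"
    then obtain h g where hg: "h \<in> lower_central G n" "g \<in> carrier G" "w = h \<otimes> g \<otimes> inv h \<otimes> inv g"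
      by blast
    have h': "t \<otimes> h \<otimes> inv t \<in> lower_central G n" using cl t hg by blast
    have "t \<otimes> w \<otimes> inv t = (t \<otimes> h \<otimes> inv t) \<otimes> (t \<otimes> g \<otimes> inv t) \<otimes> inv (t \<otimes> h \<otimes> inv t) \<otimes> inv (t \<otimes> g \<otimes> inv t)"
      using t hg car[OF hg(1)] by (simp add: word_simps)
    then show "t \<otimes> w \<otimes> inv t \<in> (\<Union>h \<in> lower_central G n. \<Union>g \<in> carrier G. {h \<otimes> g \<otimes> inv h \<otimes> inv g})"
      using h' t hg by (intro UN_I[OF h'] UN_I[of "t \<otimes> g \<otimes> inv t"]) auto
  qed
qed

lemma lower_central_subgroup: "subgroup (lower_central G n) G"
  using normal_invE(1)[OF lower_central_normal] .

lemma lower_central_carrier: "h \<in> lower_central G n \<Longrightarrow> h \<in> carrier G"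
  using subgroup.subset[OF lower_central_subgroup] by blast

lemma commutator_lower_central:
  assumes "h \<in> lower_central G n" "g \<in> carrier G"
  shows "commutator h g \<in> lower_central G (Suc n)" "commutator g h \<in> lower_central G (Suc n)"
proof -
  show 1: "commutator h g \<in> lower_central G (Suc n)"
    using assms unfolding lower_central.simps commutator_def by (intro generate.incl) blast
  have "inv (commutator h g) \<in> lower_central G (Suc n)"
    using subgroup.m_inv_closed[OF lower_central_subgroup 1] .
  then show "commutator g h \<in> lower_central G (Suc n)"
    using commutator_inverse assms lower_central_carrier by simp
qed

text \<open>
  The identity \<open>[x\<^sup>n, y] = [x, y]\<^sup>n\<close>, which holds when \<open>x\<close> commutes with \<open>[x, y]\<close>.
\<close>

lemma commutator_pow_left:
  assumes xy: "x \<in> carrier G" "y \<in> carrier G" and c: "x \<otimes> commutator x y = commutator x y \<otimes> x"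
  shows "x [^] (n::nat) \<otimes> y = commutator x y [^] n \<otimes> (y \<otimes> x [^] n)"
proof (induction n)
  case 0
  then show ?case using xy by simp
next
  case (Suc n)
  let ?c = "commutator x y"
  have cc: "?c \<in> carrier G" using xy by simp
  have xc: "x \<otimes> ?c [^] n = ?c [^] n \<otimes> x"
    using group_commutes_pow[OF c[symmetric] cc xy(1)] by simp
  have "x [^] Suc n \<otimes> y = x \<otimes> (x [^] n \<otimes> y)"
    using xy by (metis m_assoc nat_pow_Suc2 nat_pow_closed)
  also have "\<dots> = x \<otimes> ?c [^] n \<otimes> (y \<otimes> x [^] n)"
    using Suc xy cc by (simp add: m_assoc)
  also have "\<dots> = ?c [^] n \<otimes> (x \<otimes> y) \<otimes> x [^] n"
    using xc xy cc by (simp add: m_assoc)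
  also have "\<dots> = ?c [^] n \<otimes> (?c \<otimes> (y \<otimes> x)) \<otimes> x [^] n"
    using commutator_swap[OF xy] by simp
  also have "\<dots> = ?c [^] Suc n \<otimes> (y \<otimes> x [^] Suc n)"
    using xy cc nat_pow_Suc2[OF xy(1), of n] by (simp add: m_assoc)
  finally show ?case .
qed

lemma commutator_pow_eq_one:
  assumes xy: "x \<in> carrier G" "y \<in> carrier G" and c: "x \<otimes> commutator x y = commutator x y \<otimes> x"
    and n: "x [^] (n::nat) \<otimes> y = y \<otimes> x [^] n"
  shows "commutator x y [^] n = \<one>"
  using commutator_pow_left[OF assms(1-3), of n] n xy
  by (metis commutator_closed m_closed nat_pow_closed r_cancel_one)

text \<open>
  The order of the central commutator divides both \<open>n\<close> and \<open>m\<close>.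
\<close>

lemma coprime_central_commutator:
  assumes xy: "x \<in> carrier G" "y \<in> carrier G"
    and c: "x \<otimes> commutator x y = commutator x y \<otimes> x" "y \<otimes> commutator x y = commutator x y \<otimes> y"
    and n: "x [^] (n::nat) \<otimes> y = y \<otimes> x [^] n" and m: "y [^] (m::nat) \<otimes> x = x \<otimes> y [^] m"
    and cop: "coprime n m"
  shows "x \<otimes> y = y \<otimes> x"
proof -
  have cc: "commutator x y \<in> carrier G" using xy by simp
  have i: "commutator y x = inv (commutator x y)" using commutator_inverse xy by simp
  have "y \<otimes> commutator y x = commutator y x \<otimes> y"
    unfolding i using c(2) xy cc by (metis inv_closed inv_solve_left' inv_solve_right' m_assoc m_closed)
  then have "commutator y x [^] m = \<one>" using commutator_pow_eq_one[OF xy(2,1) _ m] by blast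
  then have "ord (commutator x y) dvd m" using i xy cc by (metis inv_closed ord_inv pow_eq_id)
  moreover have "ord (commutator x y) dvd n" using commutator_pow_eq_one[OF xy c(1) n] cc pow_eq_id by blast
  ultimately have "ord (commutator x y) = 1" using cop coprime_common_divisor_nat by blast
  then show ?thesis using commutator_eq_one_iff[OF xy] ord_eq_1[OF cc] by blast
qed

lemma Mod_hom: "N \<lhd> G \<Longrightarrow> group_hom G (G Mod N) (\<lambda>a. N #> a)"
  by (simp add: group_hom_axioms_def group_hom_def is_group normal.factorgroup_is_group normal.r_coset_hom_Mod)

lemma coset_one_iff: "N \<lhd> G \<Longrightarrow> a \<in> carrier G \<Longrightarrow> N #> a = \<one>\<^bsub>G Mod N\<^esub> \<longleftrightarrow> a \<in> N"
  using coset_join1 coset_join2 normal_invE(1) by (auto simp: FactGroup_def)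

lemma hom_commutator:
  assumes "group_hom G H h" "x \<in> carrier G" "y \<in> carrier G"
  shows "h (commutator x y) = group.commutator H (h x) (h y)"
proof -
  interpret h: group_hom G H h by fact
  show ?thesis using assms by (simp add: commutator_def h.H.commutator_def)
qed

text \<open>
  If the commutator lies in the \<open>i\<close>-th term of the lower central series, it is central modulo the
  next term, and there it is trivial because its order divides two coprime numbers. So it lies in
  every term.
\<close>

lemma coprime_torsion_commute:
  assumes nil: "nilpotent G" and xy: "x \<in> carrier G" "y \<in> carrier G"
    and cop: "coprime (ord x) (ord y)"
  shows "x \<otimes> y = y \<otimes> x"
proof -
  have "commutator x y \<in> lower_central G i" for i
  proof (induction i)
    case 0
    then show ?case using xy by simp
  next
    case (Suc i)
    let ?N = "lower_central G (Suc i)" and ?c = "commutator x y"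
    have N: "?N \<lhd> G" by (rule lower_central_normal)
    let ?h = "\<lambda>a. ?N #> a"
    interpret h: group_hom G "G Mod ?N" ?h using Mod_hom[OF N] .
    have cc: "?c \<in> carrier G" using xy by simp
    have hc: "?h ?c = h.H.commutator (?h x) (?h y)" using hom_commutator[OF h.group_hom_axioms xy] .
    have comm: "?h z \<otimes>\<^bsub>G Mod ?N\<^esub> ?h ?c = ?h ?c \<otimes>\<^bsub>G Mod ?N\<^esub> ?h z" if z: "z \<in> carrier G" for z
    proof -
      have "commutator z ?c \<in> ?N" using commutator_lower_central(2)[OF Suc z] .
      then have "?h (commutator z ?c) = \<one>\<^bsub>G Mod ?N\<^esub>"
        using coset_one_iff[OF N, of "commutator z ?c"] z cc by blast
      then have "h.H.commutator (?h z) (?h ?c) = \<one>\<^bsub>G Mod ?N\<^esub>"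
        by (rule trans[OF hom_commutator[OF h.group_hom_axioms z cc, symmetric]])
      then show ?thesis using h.H.commutator_eq_one_iff z cc by simp
    qed
    have p: "?h z [^]\<^bsub>G Mod ?N\<^esub> ord z = \<one>\<^bsub>G Mod ?N\<^esub>" if z: "z \<in> carrier G" for z
      using h.hom_nat_pow[OF z, of "ord z"] z by simp
    have "?h x \<otimes>\<^bsub>G Mod ?N\<^esub> ?h y = ?h y \<otimes>\<^bsub>G Mod ?N\<^esub> ?h x"
    proof (rule h.H.coprime_central_commutator[of _ _ "ord x" "ord y"])
      show "?h x [^]\<^bsub>G Mod ?N\<^esub> ord x \<otimes>\<^bsub>G Mod ?N\<^esub> ?h y = ?h y \<otimes>\<^bsub>G Mod ?N\<^esub> ?h x [^]\<^bsub>G Mod ?N\<^esub> ord x"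
        "?h y [^]\<^bsub>G Mod ?N\<^esub> ord y \<otimes>\<^bsub>G Mod ?N\<^esub> ?h x = ?h x \<otimes>\<^bsub>G Mod ?N\<^esub> ?h y [^]\<^bsub>G Mod ?N\<^esub> ord y"
        by (simp_all only: p xy h.H.l_one h.H.r_one h.hom_closed)
    qed (use comm xy hc cop in auto)
    then have "?h ?c = \<one>\<^bsub>G Mod ?N\<^esub>" using hc h.H.commutator_eq_one_iff xy by simp
    then show ?case using coset_one_iff[OF N cc] by blast
  qed
  moreover obtain m where "lower_central G m = {\<one>}" using nil unfolding nilpotent_def by blast
  ultimately have "commutator x y = \<one>" by (metis singletonD)
  then show ?thesis using commutator_eq_one_iff xy by blast
qed

text \<open>
  Take \<open>z\<close> of finite order in the last term of the lower central series that contains a nontrivial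
  element of finite order. A commutator with \<open>z\<close> that commutes with \<open>z\<close> is of finite order and
  lies in a later term, so it is trivial. Applied from the end of the series upwards, this shows
  that \<open>z\<close> commutes with all later terms, hence with its commutators, hence with everything.
\<close>

lemma central_torsion_element:
  assumes nil: "nilpotent G" and nt: "torsion G \<noteq> {\<one>}"
  obtains z where "z \<in> torsion G" "z \<noteq> \<one>" "\<And>g. g \<in> carrier G \<Longrightarrow> z \<otimes> g = g \<otimes> z"
proof -
  obtain m where m: "lower_central G m = {\<one>}" using nil unfolding nilpotent_def by blast
  let ?P = "\<lambda>i. \<exists>z \<in> lower_central G i. z \<in> torsion G \<and> z \<noteq> \<one>"
  have P0: "?P 0" using nt one_torsion torsion_carrier by auto
  have "\<not> ?P m" using m by simp
  have dec: "lower_central G (Suc i) \<subseteq> lower_central G i" for i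
    unfolding lower_central.simps
  proof (rule generate_subgroup_incl[OF _ lower_central_subgroup])
    show "(\<Union>h \<in> lower_central G i. \<Union>g \<in> carrier G. {h \<otimes> g \<otimes> inv h \<otimes> inv g}) \<subseteq> lower_central G i"
    proof safe
      fix h g assume hg: "h \<in> lower_central G i" "g \<in> carrier G"
      have "h \<otimes> (g \<otimes> inv h \<otimes> inv g) \<in> lower_central G i"
        using hg normal_invE(2)[OF lower_central_normal] subgroup.m_closed[OF lower_central_subgroup]
          subgroup.m_inv_closed[OF lower_central_subgroup] by blast
      then show "h \<otimes> g \<otimes> inv h \<otimes> inv g \<in> lower_central G i"
        using hg lower_central_carrier by (simp add: m_assoc)
    qed
  qed
  have Pm: "\<not> ?P j" if "m \<le> j" for j
    using lift_Suc_antimono_le[of "lower_central G", OF dec that] m by auto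
  \<comment> \<open>the last term with a nontrivial element of finite order\<close>
  have "\<exists>i. ?P i \<and> (\<forall>j > i. \<not> ?P j)"
  proof -
    have bd: "i \<le> m" if "?P i" for i using Pm[of i] that by (meson linear)
    have fin: "finite {i. ?P i}" by (rule finite_subset[of _ "{..m}"]) (use bd in auto)
    have "{i. ?P i} \<noteq> {}" using P0 by blast
    then have "?P (Max {i. ?P i})" using Max_in[OF fin] by blast
    moreover have "\<not> ?P j" if "j > Max {i. ?P i}" for j using Max_ge[OF fin, of j] that by auto
    ultimately show ?thesis by blast
  qed
  then obtain i z where i: "\<And>j. j > i \<Longrightarrow> \<not> ?P j" and z: "z \<in> lower_central G i" "z \<in> torsion G" "z \<noteq> \<one>"
    by blast
  have zc: "z \<in> carrier G" "ord z \<noteq> 0" using z in_torsion_iff by auto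
  have comm_step: "z \<otimes> g = g \<otimes> z" if g: "g \<in> carrier G" and c: "commutator z g \<in> lower_central G j" "i < j"
    "z \<otimes> commutator z g = commutator z g \<otimes> z" for g j
  proof -
    have "z [^] ord z \<otimes> g = g \<otimes> z [^] ord z" using zc g by simp
    then have "commutator z g [^] ord z = \<one>" using commutator_pow_eq_one[OF zc(1) g c(3)] by blast
    then have "ord (commutator z g) \<noteq> 0" using zc g pow_eq_id by (metis commutator_closed dvd_0_left_iff)
    then have "commutator z g \<in> torsion G" using zc g by (simp add: in_torsion_iff)
    then have "commutator z g = \<one>" using i[OF c(2)] c(1) by blast
    then show ?thesis using commutator_eq_one_iff zc g by blast
  qed
  have "\<forall>h \<in> lower_central G j. z \<otimes> h = h \<otimes> z" if "i < j" "j \<le> max m (Suc i)" for j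
    using that(2,1)
  proof (induction j rule: inc_induct)
    case base
    have "lower_central G (max m (Suc i)) \<subseteq> {\<one>}"
      using lift_Suc_antimono_le[of "lower_central G", OF dec, of m "max m (Suc i)"] m by auto
    then show ?case using zc by auto
  next
    case (step j)
    show ?case
    proof
      fix h assume h: "h \<in> lower_central G j"
      have c: "commutator z h \<in> lower_central G (Suc j)"
        using commutator_lower_central(2)[OF h zc(1)] .
      show "z \<otimes> h = h \<otimes> z"
        using comm_step[OF lower_central_carrier[OF h] c] step c by simp
    qed
  qed
  from this[of "Suc i"] have cen: "z \<otimes> h = h \<otimes> z" if "h \<in> lower_central G (Suc i)" for h
    using that by auto
  have "z \<otimes> g = g \<otimes> z" if g: "g \<in> carrier G" for g
    using comm_step[OF g commutator_lower_central(1)[OF z(1) g]] cen[OF commutator_lower_central(1)[OF z(1) g]] by simp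
  then show ?thesis using that z by blast
qed

text \<open>
  In a torsion-free nilpotent group, \<open>g\<close> commutes with \<open>x\<close> if it commutes with \<open>x\<^sup>n\<close>; this is the
  same statement modulo a central torsion subgroup. The induction goes down the lower central
  series. The commutator \<open>c = [x, g]\<close> also commutes with \<open>x\<^sup>n\<close>, so by induction \<open>d = [x, c]\<close> is
  torsion and therefore central. Then \<open>[x\<^sup>n, g]\<close> is \<open>c\<^sup>n\<close> times a power of \<open>d\<close>, and \<open>c\<^sup>n\<close> is
  torsion.
\<close>

lemma root_commutes_imp_torsion_commutator:
  assumes nil: "nilpotent G" and cen: "\<And>t g. t \<in> torsion G \<Longrightarrow> g \<in> carrier G \<Longrightarrow> t \<otimes> g = g \<otimes> t"
    and xy: "x \<in> carrier G" "g \<in> carrier G" and n: "n > 0" "x [^] (n::nat) \<otimes> g = g \<otimes> x [^] n"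
  shows "commutator x g \<in> torsion G"
proof -
  obtain m where m: "lower_central G m = {\<one>}" using nil unfolding nilpotent_def by blast
  have "\<forall>g \<in> lower_central G i. x [^] n \<otimes> g = g \<otimes> x [^] n \<longrightarrow> commutator x g \<in> torsion G" if "i \<le> m" for i
    using that
  proof (induction i rule: inc_induct)
    case base
    then show ?case using m xy one_torsion by (simp add: commutator_def)
  next
    case (step i)
    show ?case
    proof (intro ballI impI)
      fix g assume g: "g \<in> lower_central G i" and xg: "x [^] n \<otimes> g = g \<otimes> x [^] n"
      have gc: "g \<in> carrier G" using g lower_central_carrier by blast
      let ?c = "commutator x g" and ?d = "commutator x (commutator x g)"
      have c: "?c \<in> lower_central G (Suc i)" using commutator_lower_central(2)[OF g xy(1)] .
      have cc: "?c \<in> carrier G" "?d \<in> carrier G" using xy gc by simp_all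
      have xx: "x [^] n \<otimes> x = x \<otimes> x [^] n" using xy nat_pow_comm[of x n 1] by simp
      have "x [^] n \<otimes> (?c \<otimes> (g \<otimes> x)) = ?c \<otimes> (g \<otimes> x) \<otimes> x [^] n"
        using commutator_swap[OF xy(1) gc, symmetric] xx xg xy gc by (metis m_assoc nat_pow_closed)
      moreover have "g \<otimes> x \<otimes> x [^] n = x [^] n \<otimes> (g \<otimes> x)"
        using xx xg xy gc by (metis m_assoc nat_pow_closed)
      ultimately have "x [^] n \<otimes> ?c \<otimes> (g \<otimes> x) = ?c \<otimes> x [^] n \<otimes> (g \<otimes> x)"
        using cc xy gc by (simp add: m_assoc)
      then have "x [^] n \<otimes> ?c = ?c \<otimes> x [^] n" using cc xy gc by simp
      then have d: "?d \<in> torsion G" using step c by blast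
      have dx: "?d \<otimes> a = a \<otimes> ?d" if "a \<in> carrier G" for a using cen[OF d that] .
      have "\<exists>t::nat. x [^] (k::nat) \<otimes> g = ?d [^] t \<otimes> (?c [^] k \<otimes> (g \<otimes> x [^] k))" for k
      proof (induction k)
        case 0
        show ?case using gc by (intro exI[of _ 0]) simp
      next
        case (Suc k)
        then obtain t :: nat where t: "x [^] k \<otimes> g = ?d [^] t \<otimes> (?c [^] k \<otimes> (g \<otimes> x [^] k))" by blast
        have dt: "?d [^] (j::nat) \<otimes> a = a \<otimes> ?d [^] j" if "a \<in> carrier G" for a j
          using group_commutes_pow[OF dx[OF that] cc(2) that] .
        have dc: "?d \<otimes> ?c = ?c \<otimes> ?d" using dx cc by blast
        have xck: "x \<otimes> ?c [^] k = ?d [^] k \<otimes> (?c [^] k \<otimes> x)"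
        proof -
          have "x \<otimes> ?c \<otimes> inv x = ?d \<otimes> ?c"
            using commutator_swap[OF xy(1) cc(1)] cc xy(1) by (simp add: word_simps)
          then have "x \<otimes> ?c [^] k \<otimes> inv x = ?d [^] k \<otimes> ?c [^] k"
            using conj_nat_pow[OF xy(1) cc(1)] pow_mult_distrib[OF dc cc(2,1)] by simp
          then have "x \<otimes> ?c [^] k = ?d [^] k \<otimes> ?c [^] k \<otimes> x"
            using inv_solve_right'[of "?d [^] k \<otimes> ?c [^] k" "x \<otimes> ?c [^] k" x] cc xy(1) by simp
          then show ?thesis using cc xy(1) by (simp add: m_assoc)
        qed
        have "x [^] Suc k \<otimes> g = x \<otimes> (x [^] k \<otimes> g)"
          using xy gc by (metis m_assoc nat_pow_Suc2 nat_pow_closed)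
        also have "\<dots> = ?d [^] t \<otimes> (x \<otimes> ?c [^] k \<otimes> (g \<otimes> x [^] k))"
          unfolding t using dt[of x t] xy gc cc by (simp add: m_assoc[symmetric])
        also have "\<dots> = ?d [^] t \<otimes> ?d [^] k \<otimes> (?c [^] k \<otimes> (x \<otimes> g) \<otimes> x [^] k)"
          unfolding xck using xy gc cc by (simp add: m_assoc)
        also have "\<dots> = ?d [^] (t + k) \<otimes> (?c [^] k \<otimes> (?c \<otimes> (g \<otimes> x)) \<otimes> x [^] k)"
          using commutator_swap[OF xy(1) gc] cc by (simp add: nat_pow_mult)
        also have "?c [^] k \<otimes> (?c \<otimes> (g \<otimes> x)) \<otimes> x [^] k = ?c [^] Suc k \<otimes> (g \<otimes> x [^] Suc k)"
          using xy cc gc nat_pow_Suc2[OF xy(1), of k] by (simp add: m_assoc)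
        finally show ?case by blast
      qed
      then obtain t :: nat where t: "x [^] n \<otimes> g = ?d [^] t \<otimes> (?c [^] n \<otimes> (g \<otimes> x [^] n))" by blast
      then have "(?d [^] t \<otimes> ?c [^] n) \<otimes> (g \<otimes> x [^] n) = g \<otimes> x [^] n"
        using xg cc xy gc by (simp add: m_assoc)
      then have "?d [^] t \<otimes> ?c [^] n = \<one>" using xy cc gc by (metis m_closed nat_pow_closed r_cancel_one)
      then have "?d [^] t = inv (?c [^] n)" using cc by (simp add: inv_equality)
      then have "?c [^] n = inv (?d [^] t)" using cc by simp
      moreover have "?d [^] t \<in> torsion G"
      proof -
        have "(?d [^] t) [^] ord ?d = \<one>" using cc pow_eq_id by (simp add: nat_pow_pow)
        then have "ord (?d [^] t) dvd ord ?d" using cc pow_eq_id by simp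
        then show ?thesis using d cc unfolding in_torsion_iff by (metis dvd_0_left_iff nat_pow_closed)
      qed
      ultimately have "?c [^] n \<in> torsion G" using cc in_torsion_iff by simp
      then show "?c \<in> torsion G" using int_pow_torsion_iff[of ?c "int n"] n cc by (simp add: int_pow_int)
    qed
  qed
  then show ?thesis using xy n(2) by (metis le0 lower_central.simps(1))
qed

text \<open>
  Each commutator with \<open>t\<close> multiplies the exponent of \<open>r\<close> by \<open>e - 1\<close>. After \<open>m\<close> steps the result
  is trivial, so the order \<open>p\<^bsup>m j\<^esup>\<close> of \<open>r\<close> divides \<open>(e - 1)\<^sup>m\<close>. The order is chosen large so that
  this says something about \<open>e - 1\<close> itself.
\<close>

lemma conj_power_congruence:
  assumes nil: "lower_central G m = {\<one>}" and t: "t \<in> carrier G" and r: "r \<in> carrier G"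
    and o: "ord r = p ^ (m * j)" and e: "t \<otimes> r \<otimes> inv t = r [^] (e::int)" and m: "m > 0"
  shows "int (p ^ j) dvd e - 1"
proof -
  have "r [^] ((e - 1) ^ i) \<in> lower_central G i" for i
  proof (induction i)
    case 0
    then show ?case using r by simp
  next
    case (Suc i)
    let ?b = "(e - 1) ^ i"
    have "commutator t (r [^] ?b) = (t \<otimes> r [^] ?b \<otimes> inv t) \<otimes> inv (r [^] ?b)"
      by (simp add: commutator_def)
    also have "\<dots> = r [^] (e * ?b) \<otimes> inv (r [^] ?b)"
      using conj_int_pow[OF t r] e r by (simp add: int_pow_pow)
    also have "\<dots> = r [^] (e * ?b - ?b)" using r by (simp only: int_pow_diff)
    also have "e * ?b - ?b = (e - 1) ^ Suc i" by (simp add: algebra_simps)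
    finally show ?case using commutator_lower_central(2)[OF Suc t] by simp
  qed
  then have "r [^] ((e - 1) ^ m) = \<one>" using nil by blast
  then have "int (ord r) dvd (e - 1) ^ m" using int_pow_eq_id r by blast
  then have "int (p ^ j) ^ m dvd (e - 1) ^ m" unfolding o by (simp add: power_mult[symmetric] mult.commute)
  then show ?thesis using m by simp
qed

end

section \<open>Finite cyclic subgroups and closed neighbourhoods\<close>

text \<open>
  A closed neighbourhood, as \<open>padj\<close> is reflexive on the carrier.
\<close>

definition nbr :: "('a, 'c) monoid_scheme \<Rightarrow> 'a \<Rightarrow> 'a set" where
  "nbr G x = {y \<in> carrier G. padj G x y}"

text \<open>
  If the orders of all torsion elements are powers of one prime, these are the powers and the
  twins of a torsion element \<open>x\<close>.
\<close>

definition dominators :: "('a, 'c) monoid_scheme \<Rightarrow> 'a \<Rightarrow> 'a set" where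
  "dominators G x = {y \<in> carrier G. nbr G x \<subseteq> nbr G y}"

definition strict_dominators :: "('a, 'c) monoid_scheme \<Rightarrow> 'a \<Rightarrow> 'a set" where
  "strict_dominators G x = {y \<in> carrier G. nbr G x \<subset> nbr G y}"

definition twins :: "('a, 'c) monoid_scheme \<Rightarrow> 'a \<Rightarrow> 'a set" where
  "twins G x = {y \<in> carrier G. nbr G y = nbr G x}"

definition powers :: "('a, 'c) monoid_scheme \<Rightarrow> 'a \<Rightarrow> 'a set" where
  "powers G x = {y. pow_to G x y}"

definition p_torsion :: "('a, 'c) monoid_scheme \<Rightarrow> nat \<Rightarrow> bool" where
  "p_torsion G p \<longleftrightarrow> prime p \<and> (\<forall>x \<in> torsion G. \<exists>k. group.ord G x = p ^ k)"

text \<open>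
  The nonempty sets of this kind are the finite cyclic subgroups of prime power order and the
  Pruefer subgroups.
\<close>

definition cyclic_chain :: "('a, 'c) monoid_scheme \<Rightarrow> 'a set \<Rightarrow> bool" where
  "cyclic_chain G S \<longleftrightarrow> S \<subseteq> torsion G \<and> (\<forall>x \<in> S. \<forall>y \<in> S. padj G x y) \<and>
     (\<forall>x \<in> S. \<forall>y. pow_to G x y \<longrightarrow> y \<in> S)"

context group
begin

lemma torsion_int_pow:
  assumes "x \<in> torsion G"
  shows "\<exists>k::nat. x [^] (n::int) = x [^] k"
proof -
  have x: "x \<in> carrier G" "ord x \<noteq> 0" using assms by (auto simp: in_torsion_iff)
  have "x [^] n = x [^] (n mod int (ord x))"
    unfolding int_pow_eq[OF x(1)] by (metis dvd_minus_mod dvd_minus_iff minus_diff_eq)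
  also have "\<dots> = x [^] int (nat (n mod int (ord x)))" using x by simp
  also have "\<dots> = x [^] nat (n mod int (ord x))" by (rule int_pow_int)
  finally show ?thesis by blast
qed

lemma torsion_pow_to_iff:
  assumes "x \<in> torsion G"
  shows "pow_to G x y \<longleftrightarrow> (\<exists>k::nat. y = x [^] k)"
proof
  assume "pow_to G x y"
  then show "\<exists>k::nat. y = x [^] k" using torsion_int_pow[OF assms] unfolding pow_to_def by metis
next
  have x: "x \<in> carrier G" "ord x \<noteq> 0" using assms by (auto simp: in_torsion_iff)
  assume "\<exists>k::nat. y = x [^] k"
  then obtain k :: nat where "y = x [^] k" by blast
  then have "y = x [^] (k + ord x)" using x by (simp flip: nat_pow_mult)
  then have "y = x [^] int (k + ord x)" by (simp only: int_pow_int)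
  then show "pow_to G x y" using x pow_toI[of "int (k + ord x)" x] by simp
qed

lemma torsion_pow_toI: "x \<in> torsion G \<Longrightarrow> pow_to G x (x [^] (k::nat))"
  using torsion_pow_to_iff by blast

lemma torsion_pow_to_one: "x \<in> torsion G \<Longrightarrow> pow_to G x \<one>"
  using torsion_pow_toI[of x 0] by simp

lemma torsion_pow_to_closed: "x \<in> torsion G \<Longrightarrow> pow_to G x y \<Longrightarrow> y \<in> torsion G"
  using pow_to_torsion_iff torsion_carrier by blast

lemma powers_conv: "x \<in> torsion G \<Longrightarrow> powers G x = (\<lambda>k. x [^] k) ` {0..ord x - 1}"
  using ord_elems_inf_carrier[of x] torsion_pow_to_iff[of x]
  by (auto simp: powers_def in_torsion_iff image_def)

lemma finite_powers: "x \<in> torsion G \<Longrightarrow> finite (powers G x)"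
  by (simp add: powers_conv)

lemma card_powers:
  assumes "x \<in> torsion G"
  shows "card (powers G x) = ord x"
  unfolding powers_conv[OF assms]
  using assms card_image[OF ord_inj[of x]] by (simp add: in_torsion_iff)

lemma pow_to_ord_dvd:
  assumes "x \<in> carrier G" "pow_to G x y"
  shows "ord y dvd ord x"
proof -
  obtain n :: int where n: "y = x [^] n" using assms unfolding pow_to_def by blast
  have "y [^] int (ord x) = (x [^] int (ord x)) [^] n"
    unfolding n using assms by (simp add: int_pow_pow mult.commute)
  also have "\<dots> = \<one>" using assms by (simp add: int_pow_int)
  finally have "y [^] ord x = \<one>" by (simp add: int_pow_int)
  then show ?thesis using pow_eq_id assms pow_to_closed by blast
qed

text \<open>
  A finite cyclic group has at most one subgroup of each order.
\<close>

lemma cyclic_pow_to: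
  assumes x: "x \<in> torsion G" and y: "pow_to G x y" and w: "pow_to G x w" and d: "ord y dvd ord w"
  shows "pow_to G w y"
proof -
  have xc: "x \<in> carrier G" "ord x \<noteq> 0" using x by (auto simp: in_torsion_iff)
  obtain i j :: nat where ij: "y = x [^] i" "w = x [^] j" using x y w torsion_pow_to_iff by blast
  have wT: "w \<in> torsion G" using torsion_pow_to_closed x w by blast
  define g where "g = gcd j (ord x)"
  obtain l where l: "ord x = g * l" unfolding g_def by (meson dvdE gcd_dvd2)
  obtain j' where j': "j = g * j'" unfolding g_def by (meson dvdE gcd_dvd1)
  have l0: "l \<noteq> 0" using l xc by auto
  have "j * l = ord x * j'" by (simp add: l j')
  then have "w [^] l = \<one>" unfolding ij using xc by (simp add: nat_pow_pow pow_eq_id)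
  then have "ord w dvd l" using pow_eq_id wT torsion_carrier by blast
  then have "ord y dvd l" using d dvd_trans by blast
  then have "y [^] l = \<one>" using ij xc pow_eq_id by simp
  then have "ord x dvd i * l" unfolding ij using xc by (simp add: nat_pow_pow pow_eq_id)
  then have "g dvd i" using l l0 by simp
  then obtain c where c: "i = g * c" by (rule dvdE)
  obtain u v :: int where uv: "u * int j + v * int (ord x) = int g"
    unfolding g_def using bezout_int[of "int j" "int (ord x)"] by auto
  have "int i = int g * int c" using c by simp
  also have "\<dots> = int j * (u * int c) + int (ord x) * (v * int c)"
    unfolding uv[symmetric] by (simp add: algebra_simps)
  finally have "int j * (u * int c) - int i = int (ord x) * (- (v * int c))" by simp
  then have "x [^] int i = x [^] (int j * (u * int c))"
    unfolding int_pow_eq[OF xc(1)] by (metis dvd_triv_left)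
  then have "y = w [^] (u * int c)" unfolding ij using xc by (metis int_pow_int int_pow_pow)
  then show ?thesis using torsion_int_pow[OF wT] torsion_pow_to_iff[OF wT] by metis
qed

lemma exists_power_of_order:
  assumes "x \<in> torsion G" "d dvd ord x"
  obtains w where "pow_to G x w" "ord w = d" "w \<in> torsion G"
proof
  have x: "x \<in> carrier G" "ord x \<noteq> 0" using assms by (auto simp: in_torsion_iff)
  show 1: "pow_to G x (x [^] (ord x div d))" using torsion_pow_toI assms by blast
  show "x [^] (ord x div d) \<in> torsion G" using 1 torsion_pow_to_closed assms by blast
  show "ord (x [^] (ord x div d)) = d"
    using assms x by (subst ord_pow) (auto elim!: dvdE)
qed

lemma card_generators:
  assumes "x \<in> torsion G"
  shows "card {y. pow_to G x y \<and> ord y = ord x} = totient (ord x)"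
proof -
  have x: "x \<in> carrier G" "ord x > 0" using assms by (auto simp: in_torsion_iff)
  have o: "ord (x [^] k) = ord x \<longleftrightarrow> coprime k (ord x)" for k
  proof
    assume e: "ord (x [^] k) = ord x"
    define g where "g = gcd k (ord x)"
    obtain l where l: "ord x = g * l" unfolding g_def by (meson dvdE gcd_dvd2)
    obtain j where j: "k = g * j" unfolding g_def by (meson dvdE gcd_dvd1)
    have l0: "l \<noteq> 0" using l x by auto
    have "k * l = ord x * j" by (simp add: l j)
    then have "(x [^] k) [^] l = \<one>" using x by (simp add: nat_pow_pow pow_eq_id)
    then have "ord x dvd l" using e pow_eq_id x by (metis nat_pow_closed)
    then have "g * l dvd 1 * l" using l by simp
    then have "gcd k (ord x) = 1" using l0 unfolding g_def[symmetric] by (simp del: mult_1)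
    then show "coprime k (ord x)" by (simp add: coprime_iff_gcd_eq_1)
  next
    assume c: "coprime k (ord x)"
    have "(x [^] k) [^] n = \<one> \<longleftrightarrow> ord x dvd n" for n
      using x c by (simp add: nat_pow_pow pow_eq_id coprime_dvd_mult_right_iff coprime_commute)
    then show "ord (x [^] k) = ord x" using ord_unique x by (metis nat_pow_closed)
  qed
  have "{y. pow_to G x y \<and> ord y = ord x} = (\<lambda>k. x [^] k) ` totatives (ord x)"
  proof safe
    fix y assume "pow_to G x y" and oy: "ord y = ord x"
    then have "y \<in> (\<lambda>k. x [^] k) ` {0..ord x - 1}" using powers_conv[OF assms] unfolding powers_def by blast
    then obtain k where k: "y = x [^] k" "k \<le> ord x - 1" by auto
    show "y \<in> (\<lambda>k. x [^] k) ` totatives (ord x)"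
    proof (cases "k = 0")
      case True
      then have "ord x = 1" using k oy by simp
      then have "x = \<one>" using ord_eq_1 x by blast
      then show ?thesis using k True by (intro image_eqI[of _ _ 1]) simp_all
    next
      case False
      then show ?thesis using k o[of k] oy by (intro image_eqI[of _ _ k]) (auto simp: in_totatives_iff)
    qed
  next
    fix k assume k: "k \<in> totatives (ord x)"
    show "pow_to G x (x [^] k)" using torsion_pow_toI assms by blast
    show "ord (x [^] k) = ord x" using o k by (simp add: in_totatives_iff)
  qed
  moreover have "inj_on (\<lambda>k. x [^] k) (totatives (ord x))"
    using ord_inj'[OF x(1)] by (rule inj_on_subset) (auto simp: in_totatives_iff)
  ultimately show ?thesis by (simp add: card_image totient_def)
qed

lemma card_powers_of_order:
  assumes x: "x \<in> torsion G" and d: "d dvd ord x"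
  shows "card {y. pow_to G x y \<and> ord y = d} = totient d"
proof -
  obtain w where w: "pow_to G x w" "ord w = d" "w \<in> torsion G"
    using exists_power_of_order[OF x d] .
  have "{y. pow_to G x y \<and> ord y = d} = {y. pow_to G w y \<and> ord y = ord w}"
    using w cyclic_pow_to[OF x _ w(1)] pow_to_trans[OF w(1)] torsion_carrier[OF x] by auto
  then show ?thesis using card_generators[OF w(3)] w by simp
qed

lemma nbr_torsion: "x \<in> torsion G \<Longrightarrow> nbr G x \<subseteq> torsion G"
  unfolding nbr_def padj_def using pow_to_torsion_iff torsion_carrier by blast

lemma nbr_self: "x \<in> carrier G \<Longrightarrow> x \<in> nbr G x"
  by (simp add: nbr_def padj_refl)

lemma nbr_one: "nbr G \<one> = torsion G"
proof
  show "torsion G \<subseteq> nbr G \<one>"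
    using torsion_pow_to_one torsion_carrier by (auto simp: nbr_def padj_def)
qed (rule nbr_torsion[OF one_torsion])

lemma dominators_padj: "x \<in> carrier G \<Longrightarrow> y \<in> dominators G x \<Longrightarrow> padj G x y"
  using nbr_self[of x] padj_sym[of G x y] by (auto simp: dominators_def nbr_def)

lemma dominators_torsion: "x \<in> torsion G \<Longrightarrow> dominators G x \<subseteq> torsion G"
  using dominators_padj nbr_torsion torsion_carrier unfolding dominators_def nbr_def by blast

lemma twins_alt: "twins G x = dominators G x - strict_dominators G x"
  by (auto simp: twins_def dominators_def strict_dominators_def)

lemma same_powers_nbr:
  assumes "x \<in> carrier G" "y \<in> carrier G" "pow_to G x y" "pow_to G y x"
  shows "nbr G x = nbr G y"
  using assms mutual_pow_padj by (auto simp: nbr_def)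

lemma cyclic_chainD:
  assumes "cyclic_chain G S"
  shows cyclic_chain_torsion: "\<And>x. x \<in> S \<Longrightarrow> x \<in> torsion G"
    and cyclic_chain_padj: "\<And>x y. x \<in> S \<Longrightarrow> y \<in> S \<Longrightarrow> padj G x y"
    and cyclic_chain_down: "\<And>x y. x \<in> S \<Longrightarrow> pow_to G x y \<Longrightarrow> y \<in> S"
  using assms unfolding cyclic_chain_def by blast+

lemma cyclic_chain_ord_le:
  assumes S: "cyclic_chain G S" and xy: "x \<in> S" "y \<in> S" and o: "ord y \<le> ord x"
  shows "pow_to G x y"
proof (rule ccontr)
  assume n: "\<not> pow_to G x y"
  note T = cyclic_chain_torsion[OF S xy(1)] cyclic_chain_torsion[OF S xy(2)]
  have yx: "pow_to G y x" using n cyclic_chain_padj[OF S xy] unfolding padj_def by blast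
  then have "ord x dvd ord y" using pow_to_ord_dvd T torsion_carrier by blast
  then have "ord x = ord y" using o T by (simp add: in_torsion_iff dvd_imp_le le_antisym)
  then have "pow_to G x y" using cyclic_pow_to[OF T(2) pow_to_refl yx] T torsion_carrier by simp
  then show False using n by blast
qed

lemma cyclic_chain_bounded:
  assumes S: "cyclic_chain G S" and ne: "S \<noteq> {}" and b: "\<And>x. x \<in> S \<Longrightarrow> ord x \<le> N"
  obtains z where "z \<in> S" "S = powers G z"
proof -
  have fin: "finite (ord ` S)" by (rule finite_subset[of _ "{..N}"]) (use b in auto)
  have "Max (ord ` S) \<in> ord ` S" using Max_in[OF fin] ne by simp
  then obtain z where z: "z \<in> S" "ord z = Max (ord ` S)" by auto
  have "S = powers G z"
    using z cyclic_chain_ord_le[OF S z(1)] cyclic_chain_down[OF S z(1)] Max_ge[OF fin]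
    unfolding powers_def by auto
  then show ?thesis using that z by blast
qed

lemma cyclic_chain_finite:
  assumes S: "cyclic_chain G S" and ne: "S \<noteq> {}" and fin: "finite S"
  obtains z where "z \<in> S" "S = powers G z" "card S = ord z"
proof -
  have "ord x \<le> Max (ord ` S)" if "x \<in> S" for x using that fin by simp
  then obtain z where z: "z \<in> S" "S = powers G z" using cyclic_chain_bounded[OF S ne] by blast
  then show ?thesis using that card_powers cyclic_chain_torsion[OF S] by metis
qed

lemma cyclic_chain_infinite:
  assumes p: "p_torsion G p" and S: "cyclic_chain G S" and inf: "infinite S"
  obtains w where "w \<in> S" "ord w = p ^ k"
proof -
  have "\<exists>y \<in> S. ord y > p ^ k"
  proof (rule ccontr)
    assume "\<not> ?thesis"
    then have b: "ord x \<le> p ^ k" if "x \<in> S" for x using that by (meson not_le)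
    have "S \<noteq> {}" using inf by auto
    then obtain z where "z \<in> S" "S = powers G z" using cyclic_chain_bounded[OF S _ b] by blast
    then show False using inf finite_powers cyclic_chain_torsion[OF S] by metis
  qed
  then obtain y where y: "y \<in> S" "ord y > p ^ k" by blast
  have yT: "y \<in> torsion G" using cyclic_chain_torsion[OF S y(1)] .
  then obtain j where j: "ord y = p ^ j" using p unfolding p_torsion_def by blast
  have "p > 1" using p prime_gt_1_nat unfolding p_torsion_def by blast
  then have "k < j" using y j by simp
  then have "p ^ k dvd ord y" unfolding j by (simp add: le_imp_power_dvd)
  then obtain w where "pow_to G y w" "ord w = p ^ k" using exists_power_of_order[OF yT] by metis
  then show ?thesis using that cyclic_chain_down[OF S y(1)] by blast
qed

lemma cyclic_chain_fibre:
  assumes S: "cyclic_chain G S" and x: "x \<in> S" and d: "d dvd ord x"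
  shows "{y \<in> S. ord y = d} = {y. pow_to G x y \<and> ord y = d}"
    and "finite {y \<in> S. ord y = d}" and "card {y \<in> S. ord y = d} = totient d"
proof -
  have xT: "x \<in> torsion G" using cyclic_chain_torsion[OF S x] .
  have "d \<le> ord x" using d xT by (simp add: in_torsion_iff dvd_imp_le)
  then show 1: "{y \<in> S. ord y = d} = {y. pow_to G x y \<and> ord y = d}"
    using cyclic_chain_ord_le[OF S x] cyclic_chain_down[OF S x] by blast
  show "finite {y \<in> S. ord y = d}"
    unfolding 1 using finite_powers[OF xT] unfolding powers_def by (rule rev_finite_subset) blast
  show "card {y \<in> S. ord y = d} = totient d" unfolding 1 using card_powers_of_order[OF xT d] .
qed

text \<open>
  In a chain the number of elements of each order depends only on \<open>p\<close> and on the cardinality of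
  the chain, both for finite and for infinite chains.
\<close>

lemma cyclic_chain_fibre_card:
  assumes p: "p_torsion G p" and S: "cyclic_chain G S"
  shows "finite {y \<in> S. ord y = d}"
    and "card {y \<in> S. ord y = d} = (if (\<exists>k. d = p ^ k) \<and> (infinite S \<or> d \<le> card S) then totient d else 0)"
proof -
  have p1: "p > 1" using p prime_gt_1_nat unfolding p_torsion_def by blast
  have pp: "\<exists>k. ord x = p ^ k" if "x \<in> S" for x
    using that p cyclic_chain_torsion[OF S] unfolding p_torsion_def by blast
  consider (empty) "{y \<in> S. ord y = d} = {}" | (mem) y where "y \<in> S" "ord y = d" by blast
  then have "finite {y \<in> S. ord y = d} \<and> card {y \<in> S. ord y = d} =
    (if (\<exists>k. d = p ^ k) \<and> (infinite S \<or> d \<le> card S) then totient d else 0)"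
  proof cases
    case empty
    have "\<not> ((\<exists>k. d = p ^ k) \<and> (infinite S \<or> d \<le> card S))"
    proof
      assume *: "(\<exists>k. d = p ^ k) \<and> (infinite S \<or> d \<le> card S)"
      then obtain k where k: "d = p ^ k" by blast
      show False
      proof (cases "finite S")
        case False
        then show ?thesis using cyclic_chain_infinite[OF p S] k empty by blast
      next
        case True
        then have le: "d \<le> card S" using * by blast
        then have "S \<noteq> {}" using k p1 by auto
        then obtain z where z: "z \<in> S" "card S = ord z" using cyclic_chain_finite[OF S _ True] by metis
        obtain j where j: "ord z = p ^ j" using pp z by blast
        have "k \<le> j" using le z k j p1 by simp
        then have "d dvd ord z" unfolding j k by (rule le_imp_power_dvd)
        then obtain w where "pow_to G z w" "ord w = d"
          using exists_power_of_order cyclic_chain_torsion[OF S z(1)] by metis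
        then show ?thesis using empty cyclic_chain_down[OF S z(1)] by blast
      qed
    qed
    then show ?thesis unfolding empty by (subst if_not_P) auto
  next
    case mem
    have "\<exists>k. d = p ^ k" using pp mem by metis
    moreover have "d \<le> card S" if fin: "finite S"
    proof -
      obtain z where z: "S = powers G z" "z \<in> S" "card S = ord z"
        using cyclic_chain_finite[OF S _ fin] mem by blast
      then have "d dvd ord z"
        using mem pow_to_ord_dvd cyclic_chain_torsion[OF S] torsion_carrier unfolding powers_def by blast
      then show ?thesis using z cyclic_chain_torsion[OF S z(2)] by (simp add: in_torsion_iff dvd_imp_le)
    qed
    ultimately show ?thesis using cyclic_chain_fibre[OF S mem(1), of d] mem by auto
  qed
  then show "finite {y \<in> S. ord y = d}"
    "card {y \<in> S. ord y = d} = (if (\<exists>k. d = p ^ k) \<and> (infinite S \<or> d \<le> card S) then totient d else 0)"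
    by blast+
qed

lemma p_torsion_cyclic_padj:
  assumes p: "p_torsion G p" and x: "x \<in> torsion G" and yw: "pow_to G x y" "pow_to G x w"
  shows "padj G y w"
proof -
  have T: "y \<in> torsion G" "w \<in> torsion G" using torsion_pow_to_closed[OF x] yw by blast+
  obtain i j where "ord y = p ^ i" "ord w = p ^ j" using p T unfolding p_torsion_def by metis
  then have "ord y dvd ord w \<or> ord w dvd ord y" by (metis le_imp_power_dvd linear)
  then show ?thesis using cyclic_pow_to[OF x] yw unfolding padj_def by blast
qed

text \<open>
  In a finite cyclic group of prime power order all subgroups are comparable, so whatever is
  adjacent to \<open>x\<close> is adjacent to its powers.
\<close>

lemma p_torsion_nbr_mono:
  assumes p: "p_torsion G p" and x: "x \<in> torsion G" and y: "pow_to G x y"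
  shows "nbr G x \<subseteq> nbr G y"
proof
  fix w assume w: "w \<in> nbr G x"
  then have wc: "w \<in> carrier G" "padj G x w" by (auto simp: nbr_def)
  then consider "pow_to G x w" | "pow_to G w x" unfolding padj_def by blast
  then have "padj G y w"
  proof cases
    case 1
    then show ?thesis using p_torsion_cyclic_padj[OF p x y] by blast
  next
    case 2
    then show ?thesis using pow_to_trans[OF _ y] wc unfolding padj_def by blast
  qed
  then show "w \<in> nbr G y" using wc by (simp add: nbr_def)
qed

lemma dominators_cyclic_chain:
  assumes p: "p_torsion G p" and x: "x \<in> torsion G"
  shows "cyclic_chain G (dominators G x)" "cyclic_chain G (strict_dominators G x)"
proof -
  have xc: "x \<in> carrier G" using x torsion_carrier by blast
  have sub: "strict_dominators G x \<subseteq> dominators G x" by (auto simp: dominators_def strict_dominators_def)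
  have pad: "padj G y w" if "y \<in> dominators G x" "w \<in> dominators G x" for y w
    using dominators_padj[OF xc that(1)] that unfolding dominators_def nbr_def by (auto simp: padj_sym)
  show "cyclic_chain G (dominators G x)"
    unfolding cyclic_chain_def
  proof (intro conjI ballI allI impI)
    show "dominators G x \<subseteq> torsion G" by (rule dominators_torsion[OF x])
    show "padj G y w" if "y \<in> dominators G x" "w \<in> dominators G x" for y w using pad that .
    show "w \<in> dominators G x" if "y \<in> dominators G x" "pow_to G y w" for y w
    proof -
      have yT: "y \<in> torsion G" using that dominators_torsion[OF x] by blast
      then have "w \<in> carrier G" using that torsion_pow_to_closed torsion_carrier by blast
      then show ?thesis using that p_torsion_nbr_mono[OF p yT that(2)] unfolding dominators_def by auto
    qed
  qed
  show "cyclic_chain G (strict_dominators G x)"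
    unfolding cyclic_chain_def
  proof (intro conjI ballI allI impI)
    show "strict_dominators G x \<subseteq> torsion G" using sub dominators_torsion[OF x] by blast
    show "padj G y w" if "y \<in> strict_dominators G x" "w \<in> strict_dominators G x" for y w using that pad sub by blast
    show "w \<in> strict_dominators G x" if "y \<in> strict_dominators G x" "pow_to G y w" for y w
    proof -
      have yT: "y \<in> torsion G" using that sub dominators_torsion[OF x] by blast
      then have "w \<in> carrier G" using that torsion_pow_to_closed torsion_carrier by blast
      then show ?thesis using that p_torsion_nbr_mono[OF p yT that(2)] unfolding strict_dominators_def by auto
    qed
  qed
qed

text \<open>
  Closed neighbourhoods decide the direction of an arc between vertices that are not twins. Only
  within a twin class are the orders needed.
\<close>

lemma p_torsion_pow_to_iff:
  assumes p: "p_torsion G p" and xy: "x \<in> torsion G" "y \<in> torsion G"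
  shows "pow_to G x y \<longleftrightarrow> nbr G x \<subset> nbr G y \<or> (nbr G x = nbr G y \<and> ord y \<le> ord x)"
proof
  have c: "x \<in> carrier G" "y \<in> carrier G" using xy torsion_carrier by blast+
  assume "pow_to G x y"
  then have "nbr G x \<subseteq> nbr G y" "ord y dvd ord x"
    using p_torsion_nbr_mono[OF p xy(1)] pow_to_ord_dvd[OF c(1)] by blast+
  then show "nbr G x \<subset> nbr G y \<or> (nbr G x = nbr G y \<and> ord y \<le> ord x)"
    using xy by (auto simp: in_torsion_iff dvd_imp_le)
next
  have c: "x \<in> carrier G" "y \<in> carrier G" using xy torsion_carrier by blast+
  assume a: "nbr G x \<subset> nbr G y \<or> (nbr G x = nbr G y \<and> ord y \<le> ord x)"
  then have "x \<in> nbr G y" using nbr_self[OF c(1)] by blast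
  then have "padj G x y" by (simp add: nbr_def padj_sym)
  moreover have "pow_to G x y" if yx: "pow_to G y x"
  proof -
    have "nbr G y \<subseteq> nbr G x" using p_torsion_nbr_mono[OF p xy(2) yx] .
    then have "ord y \<le> ord x" using a by auto
    moreover have "ord x dvd ord y" using pow_to_ord_dvd[OF c(2) yx] .
    ultimately have "ord y dvd ord x" using xy by (metis dvd_imp_le dvd_refl in_torsion_iff le_antisym neq0_conv)
    then show ?thesis using cyclic_pow_to[OF xy(2) pow_to_refl[OF c(2)] yx] by blast
  qed
  ultimately show "pow_to G x y" unfolding padj_def by blast
qed

end

section \<open>Isomorphisms of power graphs and torsion of prime power order\<close>

lemma bij_betw_of_fibres:
  assumes fin: "\<And>k. finite {x \<in> A. \<kappa> x = k}" "\<And>k. finite {y \<in> B. \<kappa>' y = k}"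
    and card: "\<And>k. card {x \<in> A. \<kappa> x = k} = card {y \<in> B. \<kappa>' y = k}"
  shows "\<exists>g. bij_betw g A B \<and> (\<forall>x \<in> A. \<kappa>' (g x) = \<kappa> x)"
proof -
  have "\<exists>h. bij_betw h {x \<in> A. \<kappa> x = k} {y \<in> B. \<kappa>' y = k}" for k
    by (rule finite_same_card_bij[OF fin card])
  then obtain h where h: "\<And>k. bij_betw (h k) {x \<in> A. \<kappa> x = k} {y \<in> B. \<kappa>' y = k}" by metis
  have gB: "h (\<kappa> x) x \<in> B" "\<kappa>' (h (\<kappa> x) x) = \<kappa> x" if "x \<in> A" for x
    using bij_betw_apply[OF h[of "\<kappa> x"], of x] that by auto
  have "inj_on (\<lambda>x. h (\<kappa> x) x) A"
  proof (rule inj_onI)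
    fix x y assume xy: "x \<in> A" "y \<in> A" and e: "h (\<kappa> x) x = h (\<kappa> y) y"
    then have k: "\<kappa> x = \<kappa> y" using gB by metis
    then show "x = y" using e xy inj_onD[OF bij_betw_imp_inj_on[OF h[of "\<kappa> x"]], of x y] by simp
  qed
  moreover have "(\<lambda>x. h (\<kappa> x) x) ` A = B"
  proof
    show "B \<subseteq> (\<lambda>x. h (\<kappa> x) x) ` A"
    proof
      fix y assume y: "y \<in> B"
      then have "y \<in> h (\<kappa>' y) ` {x \<in> A. \<kappa> x = \<kappa>' y}" using bij_betw_imp_surj_on[OF h[of "\<kappa>' y"]] by simp
      then show "y \<in> (\<lambda>x. h (\<kappa> x) x) ` A" by force
    qed
  qed (use gB in blast)
  ultimately show ?thesis using gB unfolding bij_betw_def by blast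
qed

locale power_graph_iso = G: group G + H: group H
  for G :: "('a, 'c) monoid_scheme" and H :: "('b, 'd) monoid_scheme" +
  fixes f :: "'a \<Rightarrow> 'b"
  assumes bij: "bij_betw f (carrier G) (carrier H)"
    and adj: "\<And>x y. x \<in> carrier G \<Longrightarrow> y \<in> carrier G \<Longrightarrow> padj G x y \<longleftrightarrow> padj H (f x) (f y)"
begin

lemma f_closed: "x \<in> carrier G \<Longrightarrow> f x \<in> carrier H"
  using bij by (rule bij_betw_apply)

lemma f_inj: "x \<in> carrier G \<Longrightarrow> y \<in> carrier G \<Longrightarrow> f x = f y \<longleftrightarrow> x = y"
  using bij by (auto simp: bij_betw_def dest: inj_onD)

lemma f_surj: assumes "y \<in> carrier H" obtains x where "x \<in> carrier G" "f x = y"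
proof -
  have "y \<in> f ` carrier G" using assms bij by (simp add: bij_betw_def)
  then show ?thesis using that by (elim imageE) simp
qed

lemma image_Collect:
  assumes "\<And>x. x \<in> carrier G \<Longrightarrow> P x \<longleftrightarrow> Q (f x)"
  shows "{y \<in> carrier H. Q y} = f ` {x \<in> carrier G. P x}"
  using assms f_closed by (auto elim!: f_surj)

lemma f_nbr: "x \<in> carrier G \<Longrightarrow> nbr H (f x) = f ` nbr G x"
  unfolding nbr_def by (rule image_Collect, simp add: adj)

lemma nbr_carrier: "nbr G x \<subseteq> carrier G"
  by (auto simp: nbr_def)

lemma f_nbr_subset_iff:
  assumes "x \<in> carrier G" "y \<in> carrier G"
  shows "nbr H (f x) \<subseteq> nbr H (f y) \<longleftrightarrow> nbr G x \<subseteq> nbr G y"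
  unfolding f_nbr[OF assms(1)] f_nbr[OF assms(2)]
  using nbr_carrier f_inj by (auto simp: nbr_def)

lemma f_nbr_eq_iff:
  assumes "x \<in> carrier G" "y \<in> carrier G"
  shows "nbr H (f x) = nbr H (f y) \<longleftrightarrow> nbr G x = nbr G y"
  using f_nbr_subset_iff assms by (metis order_antisym order_refl)

lemma f_nbr_psubset_iff:
  assumes "x \<in> carrier G" "y \<in> carrier G"
  shows "nbr H (f x) \<subset> nbr H (f y) \<longleftrightarrow> nbr G x \<subset> nbr G y"
  using f_nbr_subset_iff f_nbr_eq_iff assms unfolding psubset_eq by blast

lemma f_dominators: "x \<in> carrier G \<Longrightarrow> dominators H (f x) = f ` dominators G x"
  unfolding dominators_def by (rule image_Collect, simp add: f_nbr_subset_iff)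

lemma f_strict_dominators: "x \<in> carrier G \<Longrightarrow> strict_dominators H (f x) = f ` strict_dominators G x"
  unfolding strict_dominators_def by (rule image_Collect, simp add: f_nbr_psubset_iff)

lemma f_twins: "x \<in> carrier G \<Longrightarrow> twins H (f x) = f ` twins G x"
  unfolding twins_def by (rule image_Collect, simp add: f_nbr_eq_iff)

lemma f_card: "A \<subseteq> carrier G \<Longrightarrow> card (f ` A) = card A \<and> (finite (f ` A) \<longleftrightarrow> finite A)"
  using bij_betw_imp_inj_on[OF bij] inj_on_subset[of f "carrier G" A] card_image finite_image_iff by metis

lemma f_commens:
  assumes "x \<in> carrier G" "y \<in> carrier G"
  shows "commens H (f x) (f y) \<longleftrightarrow> commens G x y"
proof -
  have "(\<exists>z \<in> carrier H. padj H (f x) z \<and> padj H z (f y)) \<longleftrightarrow> (\<exists>z \<in> carrier G. padj G x z \<and> padj G z y)"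
    using adj assms f_closed f_surj by metis
  then show ?thesis
    using G.commens_iff_padj H.commens_iff_padj assms f_closed by simp
qed

lemma f_commens_class: "x \<in> carrier G \<Longrightarrow> commens_class H (f x) = f ` commens_class G x"
  unfolding commens_class_def by (rule image_Collect, simp add: f_commens)

lemma inverse_iso: "power_graph_iso H G (inv_into (carrier G) f)"
proof
  let ?h = "inv_into (carrier G) f"
  show "bij_betw ?h (carrier H) (carrier G)" using bij by (rule bij_betw_inv_into)
  fix x y assume xy: "x \<in> carrier H" "y \<in> carrier H"
  have "?h x \<in> carrier G" "?h y \<in> carrier G" "f (?h x) = x" "f (?h y) = y"
    using xy bij by (auto simp: bij_betw_def inv_into_into f_inv_into_f)
  then show "padj H x y \<longleftrightarrow> padj G (?h x) (?h y)" using adj by metis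
qed

end

locale torsion_preserving_iso = power_graph_iso +
  assumes tor: "f ` torsion G = torsion H"
begin

lemma f_torsion_iff:
  assumes "x \<in> carrier G"
  shows "f x \<in> torsion H \<longleftrightarrow> x \<in> torsion G"
proof
  note x = assms
  assume "f x \<in> torsion H"
  then have "f x \<in> f ` torsion G" using tor by simp
  then obtain x' where "x' \<in> torsion G" "f x = f x'" by (rule imageE)
  then show "x \<in> torsion G" using f_inj[OF x] G.torsion_carrier by blast
qed (metis imageI tor)

lemma f_torsion: "x \<in> torsion G \<Longrightarrow> f x \<in> torsion H"
  by (metis imageI tor)

lemma f_torsion_surj: assumes "y \<in> torsion H" obtains x where "x \<in> torsion G" "f x = y"
proof -
  have "y \<in> f ` torsion G" using assms tor by simp
  then show ?thesis using that by (elim imageE) simp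
qed

lemma inverse_torsion_iso: "torsion_preserving_iso H G (inv_into (carrier G) f)"
proof -
  have "inv_into (carrier G) f ` torsion H = torsion G"
    unfolding tor[symmetric]
    using inv_into_image_cancel[OF bij_betw_imp_inj_on[OF bij], of "torsion G"] G.torsion_carrier by blast
  then show ?thesis
    using inverse_iso by (simp add: torsion_preserving_iso_def torsion_preserving_iso_axioms_def)
qed

text \<open>
  A twin class is the difference of two chains, which \<open>f\<close> maps to the corresponding chains.
\<close>

lemma p_torsion_fibre_card:
  assumes pG: "p_torsion G p" and pH: "p_torsion H p" and x: "x \<in> torsion G"
  shows "finite {z \<in> twins G x. G.ord z = d} \<and> finite {z \<in> twins H (f x). H.ord z = d} \<and>
    card {z \<in> twins G x. G.ord z = d} = card {z \<in> twins H (f x). H.ord z = d}"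
proof -
  have xc: "x \<in> carrier G" using x G.torsion_carrier by blast
  note cG = G.dominators_cyclic_chain[OF pG x] and cH = H.dominators_cyclic_chain[OF pH f_torsion[OF x]]
  note fG = G.cyclic_chain_fibre_card[OF pG cG(1), of d] G.cyclic_chain_fibre_card[OF pG cG(2), of d]
  note fH = H.cyclic_chain_fibre_card[OF pH cH(1), of d] H.cyclic_chain_fibre_card[OF pH cH(2), of d]
  have sub: "{z \<in> strict_dominators G x. G.ord z = d} \<subseteq> {z \<in> dominators G x. G.ord z = d}"
    "{z \<in> strict_dominators H (f x). H.ord z = d} \<subseteq> {z \<in> dominators H (f x). H.ord z = d}"
    by (auto simp: dominators_def strict_dominators_def)
  have tw: "{z \<in> twins G x. G.ord z = d} = {z \<in> dominators G x. G.ord z = d} - {z \<in> strict_dominators G x. G.ord z = d}"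
    "{z \<in> twins H (f x). H.ord z = d} = {z \<in> dominators H (f x). H.ord z = d} - {z \<in> strict_dominators H (f x). H.ord z = d}"
    by (auto simp: G.twins_alt H.twins_alt)
  have ab: "dominators G x \<subseteq> carrier G" "strict_dominators G x \<subseteq> carrier G" by (auto simp: dominators_def strict_dominators_def)
  have same: "card (dominators H (f x)) = card (dominators G x)" "finite (dominators H (f x)) \<longleftrightarrow> finite (dominators G x)"
    "card (strict_dominators H (f x)) = card (strict_dominators G x)" "finite (strict_dominators H (f x)) \<longleftrightarrow> finite (strict_dominators G x)"
    using f_dominators[OF xc] f_strict_dominators[OF xc] f_card[OF ab(1)] f_card[OF ab(2)] by simp_all
  show ?thesis
    unfolding tw using fG(1,3) fH(1,3) card_Diff_subset[OF fG(3) sub(1)] card_Diff_subset[OF fH(3) sub(2)]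
    by (simp add: fG(2,4) fH(2,4) same)
qed

text \<open>
  The isomorphism agrees with \<open>f\<close> on twin classes, but inside a twin class it is chosen to
  preserve orders.
\<close>

lemma p_torsion_dir_iso:
  assumes pG: "p_torsion G p" and pH: "p_torsion H p"
  shows "dir_iso_on G (torsion G) H (torsion H)"
proof -
  let ?k = "\<lambda>x. (nbr H (f x), G.ord x)" and ?k' = "\<lambda>y. (nbr H y, H.ord y)"
  have fibres: "finite {x \<in> torsion G. ?k x = K} \<and> finite {y \<in> torsion H. ?k' y = K} \<and>
    card {x \<in> torsion G. ?k x = K} = card {y \<in> torsion H. ?k' y = K}" for K
  proof (cases "\<exists>x \<in> torsion G. nbr H (f x) = fst K")
    case True
    then obtain x where x: "x \<in> torsion G" "nbr H (f x) = fst K" by blast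
    have xc: "x \<in> carrier G" using x G.torsion_carrier by blast
    have tT: "twins G x \<subseteq> torsion G" "twins H (f x) \<subseteq> torsion H"
      using G.dominators_torsion[OF x(1)] H.dominators_torsion[OF f_torsion[OF x(1)]]
      by (auto simp: twins_def dominators_def)
    have "{z \<in> torsion G. ?k z = K} = {z \<in> twins G x. G.ord z = snd K}"
      using tT x f_nbr_eq_iff[OF _ xc] G.torsion_carrier unfolding twins_def by (auto simp: prod_eq_iff)
    moreover have "{z \<in> torsion H. ?k' z = K} = {z \<in> twins H (f x). H.ord z = snd K}"
      using tT x H.torsion_carrier unfolding twins_def by (auto simp: prod_eq_iff)
    ultimately show ?thesis using p_torsion_fibre_card[OF pG pH x(1)] by simp
  next
    case False
    then have "{z \<in> torsion G. ?k z = K} = {}" "{z \<in> torsion H. ?k' z = K} = {}"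
      using f_torsion_surj by (auto simp: prod_eq_iff) metis
    then show ?thesis by (simp only: finite.emptyI card.empty simp_thms)
  qed
  obtain g where g: "bij_betw g (torsion G) (torsion H)" "\<And>x. x \<in> torsion G \<Longrightarrow> ?k' (g x) = ?k x"
    using bij_betw_of_fibres[of "torsion G" ?k "torsion H" ?k'] fibres by blast
  have "pow_to G x y \<longleftrightarrow> pow_to H (g x) (g y)" if xy: "x \<in> torsion G" "y \<in> torsion G" for x y
  proof -
    have "g x \<in> torsion H" "g y \<in> torsion H" using g xy bij_betw_apply by metis+
    then show ?thesis
      using G.p_torsion_pow_to_iff[OF pG xy] H.p_torsion_pow_to_iff[OF pH, of "g x" "g y"]
        g(2)[OF xy(1)] g(2)[OF xy(2)] f_nbr_eq_iff f_nbr_psubset_iff xy G.torsion_carrier by simp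
  qed
  then show ?thesis using g unfolding dir_iso_on_def by blast
qed

end

context group
begin

text \<open>
  The elements strictly dominating \<open>v\<close> form a cyclic group, which contains all twins of \<open>u\<close> and
  has order at most \<open>\<phi>(ord v)\<close>, the number of generators of the group generated by \<open>v\<close>. Removing
  \<open>e\<close>, a twin of \<open>1\<close>, makes the inequality strict; it stands for the vertex that corresponds to
  \<open>1\<close> in the other group.
\<close>

lemma p_torsion_twins_card:
  assumes p: "p_torsion G p" and uv: "u \<in> torsion G" "v \<in> torsion G" and lt: "nbr G v \<subset> nbr G u"
    and fin: "finite (twins G v)" and e: "e \<in> carrier G" "nbr G e = torsion G"
  shows "finite (twins G u)" "card (twins G u - {e}) < card (twins G v)"
proof -
  let ?S = "strict_dominators G v"
  have S: "cyclic_chain G ?S" using dominators_cyclic_chain(2)[OF p uv(2)] .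
  have tu: "twins G u \<subseteq> ?S" using lt by (auto simp: twins_def strict_dominators_def)
  have uS: "u \<in> ?S" using lt uv torsion_carrier by (auto simp: strict_dominators_def)
  have vS: "pow_to G v y \<and> \<not> pow_to G y v" if "y \<in> ?S" for y
  proof -
    have yT: "y \<in> torsion G" using cyclic_chain_torsion[OF S that] .
    have "nbr G v \<subset> nbr G y" using that by (simp add: strict_dominators_def)
    then show ?thesis
      using p_torsion_pow_to_iff[OF p uv(2) yT] p_torsion_pow_to_iff[OF p yT uv(2)] by auto
  qed
  then have "?S \<subseteq> powers G v" by (auto simp: powers_def)
  then have finS: "finite ?S" using finite_powers[OF uv(2)] finite_subset by blast
  then show "finite (twins G u)" using tu finite_subset by blast
  obtain z where z: "z \<in> ?S" "card ?S = ord z" using cyclic_chain_finite[OF S _ finS] uS by (metis empty_iff)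
  have zT: "z \<in> torsion G" using cyclic_chain_torsion[OF S z(1)] .
  \<comment> \<open>one element of the cyclic group is not counted: \<open>e\<close> if it is a twin of \<open>u\<close>, and \<open>1\<close> otherwise\<close>
  obtain w where w: "w \<in> ?S" "twins G u - {e} \<subseteq> ?S - {w}"
  proof (cases "e \<in> twins G u")
    case True
    then show ?thesis using that[of e] tu by blast
  next
    case False
    have "\<one> \<in> ?S" using cyclic_chain_down[OF S uS] torsion_pow_to_one uv by blast
    moreover have "\<one> \<notin> twins G u" using False e nbr_one by (auto simp: twins_def)
    ultimately show ?thesis using that[of \<one>] tu by blast
  qed
  then have "card (twins G u - {e}) \<le> card ?S - 1"
    using card_mono[OF _ w(2)] finS by simp
  also have "\<dots> < ord z" using z zT by (simp add: in_torsion_iff)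
  also have "\<dots> \<le> totient (ord v)"
  proof -
    obtain a k where ak: "ord z = p ^ a" "ord v = p ^ k" using p zT uv unfolding p_torsion_def by metis
    have pp: "prime p" "p > 1" using p prime_gt_1_nat unfolding p_torsion_def by blast+
    have "\<not> k \<le> a"
    proof
      assume "k \<le> a"
      then have "ord v dvd ord z" unfolding ak by (rule le_imp_power_dvd)
      then show False
        using cyclic_pow_to[OF uv(2) pow_to_refl] vS[OF z(1)] uv torsion_carrier by blast
    qed
    then have k: "k > 0" "a \<le> k - 1" by auto
    have "p ^ a \<le> p ^ (k - 1)" using k pp by simp
    also have "\<dots> \<le> p ^ (k - 1) * (p - 1)" using pp by simp
    finally show ?thesis unfolding ak totient_prime_power[OF pp(1) k(1)] .
  qed
  also have "\<dots> \<le> card (twins G v)"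
  proof -
    have "{y. pow_to G v y \<and> ord y = ord v} \<subseteq> twins G v"
    proof safe
      fix y assume y: "pow_to G v y" "ord y = ord v"
      have vc: "v \<in> carrier G" using uv torsion_carrier by blast
      have "pow_to G y v" using cyclic_pow_to[OF uv(2) pow_to_refl[OF vc] y(1)] y by simp
      then show "y \<in> twins G v" using same_powers_nbr[OF vc] y pow_to_closed vc by (auto simp: twins_def)
    qed
    then show ?thesis using card_mono[OF fin] card_generators[OF uv(2)] by metis
  qed
  finally show "card (twins G u - {e}) < card (twins G v)" .
qed

end

section \<open>Torsion with several prime orders\<close>

definition mixed_torsion :: "('a, 'c) monoid_scheme \<Rightarrow> bool" where
  "mixed_torsion G \<longleftrightarrow> (\<exists>t \<in> torsion G. \<exists>t' \<in> torsion G.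
     prime (group.ord G t) \<and> prime (group.ord G t') \<and> group.ord G t \<noteq> group.ord G t')"

lemma not_dvd_primepow:
  fixes m n :: nat
  assumes "n \<noteq> 0" "m \<noteq> 0" "\<not> n dvd m"
  obtains p k where "prime p" "p ^ k dvd n" "\<not> p ^ k dvd m"
proof -
  obtain p where p: "prime p" "\<not> multiplicity p n \<le> multiplicity p m"
    using multiplicity_le_imp_dvd[of n m] assms by blast
  have "\<not> p ^ multiplicity p n dvd m"
    using p power_dvd_iff_le_multiplicity[of m p] assms prime_gt_1_nat[OF p(1)] by auto
  then show ?thesis using that p(1) multiplicity_dvd by blast
qed

lemma not_primepow_obtain_prime:
  fixes n p :: nat
  assumes "n \<noteq> 0" "prime p" "\<nexists>k. n = p ^ k"
  obtains q where "prime q" "q \<noteq> p" "q dvd n"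
proof -
  obtain y where y: "n = p ^ multiplicity p n * y" "\<not> p dvd y"
    using multiplicity_decompose'[of n p] assms not_prime_unit[of p] by blast
  then have "y \<noteq> 1" using assms by auto
  then obtain q where "prime q" "q dvd y" using prime_factor_nat by blast
  then show ?thesis using that y by (metis dvd_mult)
qed

text \<open>
  The only coincidence \<open>\<phi>(m) = \<phi>(n)\<close> between a proper divisor \<open>m\<close> and \<open>n\<close> is \<open>n = 2 m\<close> with \<open>m\<close>
  odd.
\<close>

lemma totient_eq_imp_parity:
  fixes m n :: nat
  assumes "m dvd n" "n > 0" "m \<noteq> n" "totient n \<le> totient m"
  shows "odd m \<and> even n"
proof -
  obtain k where k: "n = m * k" using assms(1) by (rule dvdE)
  then obtain p where p: "prime p" "p dvd k" using prime_factor_nat[of k] assms by auto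
  have m0: "totient m > 0" using k assms by (cases "m = 0") auto
  have p1: "p > 1" using p prime_gt_1_nat by blast
  have d: "p * m dvd n" using k p by (simp add: mult.commute)
  then have le: "totient (p * m) \<le> totient m" using totient_dvd_mono[OF d] assms by simp
  show ?thesis
  proof (cases "p dvd m")
    case True
    then have "gcd p m = p" by (simp add: gcd_nat.absorb1)
    then have "totient (p * m) * (p - 1) = (p - 1) * totient m * p"
      using totient_gcd[of p m] totient_prime[OF p(1)] by simp
    then have "totient (p * m) = p * totient m" using p1 by simp
    then show ?thesis using le m0 p1 by simp
  next
    case False
    then have "coprime p m" using p prime_imp_coprime by blast
    then have "totient (p * m) = (p - 1) * totient m"
      using totient_mult_coprime totient_prime[OF p(1)] by simp
    then have "p = 2" using le m0 p1 by simp
    then show ?thesis using False d by (meson dvd_mult_left)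
  qed
qed

context group
begin

lemma mixed_torsion_iff:
  "mixed_torsion G \<longleftrightarrow> (\<exists>t \<in> torsion G. \<exists>t' \<in> torsion G. prime (ord t) \<and> prime (ord t') \<and> ord t \<noteq> ord t')"
  by (simp add: mixed_torsion_def)

lemma p_torsion_or_mixed: "(\<exists>p. p_torsion G p) \<or> mixed_torsion G"
proof (cases "torsion G = {\<one>}")
  case True
  then have "p_torsion G 2" by (auto simp: p_torsion_def intro: exI[of _ 0])
  then show ?thesis by blast
next
  case False
  then obtain x where x: "x \<in> torsion G" "x \<noteq> \<one>" using one_torsion by blast
  then have "ord x \<noteq> 1" using ord_eq_1 torsion_carrier by blast
  then obtain p where p: "prime p" "p dvd ord x" using prime_factor_nat by blast
  obtain t where t: "t \<in> torsion G" "ord t = p" using exists_power_of_order[OF x(1) p(2)] by metis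
  show ?thesis
  proof (cases "p_torsion G p")
    case False
    then obtain y where y: "y \<in> torsion G" "\<nexists>k. ord y = p ^ k" using p unfolding p_torsion_def by blast
    have "ord y \<noteq> 0" using y by (simp add: in_torsion_iff)
    then obtain q where q: "prime q" "q \<noteq> p" "q dvd ord y" using not_primepow_obtain_prime p y by metis
    obtain t' where "t' \<in> torsion G" "ord t' = q" using exists_power_of_order[OF y(1) q(3)] by metis
    then show ?thesis using t p q unfolding mixed_torsion_iff by metis
  qed blast
qed

lemma mixed_other_prime:
  assumes "mixed_torsion G" "prime (p::nat)"
  obtains t where "t \<in> torsion G" "prime (ord t)" "coprime p (ord t)"
  using assms primes_coprime unfolding mixed_torsion_iff by metis

lemma coprime_pow_to:
  assumes x: "x \<in> torsion G" and c: "coprime k (ord x)"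
  shows "pow_to G (x [^] (k::nat)) x"
proof -
  have xc: "x \<in> carrier G" using x torsion_carrier by blast
  have "(x [^] k) [^] n = \<one> \<longleftrightarrow> ord x dvd n" for n
    using xc c by (simp add: nat_pow_pow pow_eq_id coprime_dvd_mult_right_iff coprime_commute)
  then have "ord (x [^] k) = ord x" using ord_unique xc by (metis nat_pow_closed)
  then show ?thesis using cyclic_pow_to[OF x pow_to_refl[OF xc] torsion_pow_toI[OF x]] by simp
qed

lemma coprime_product:
  assumes ab: "a \<in> torsion G" "b \<in> torsion G" and com: "a \<otimes> b = b \<otimes> a" and cop: "coprime (ord a) (ord b)"
  shows "a \<otimes> b \<in> torsion G" "pow_to G (a \<otimes> b) a" "pow_to G (a \<otimes> b) b" "ord (a \<otimes> b) dvd ord a * ord b"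
proof -
  have c: "a \<in> carrier G" "b \<in> carrier G" "ord a * ord b \<noteq> 0" using ab by (auto simp: in_torsion_iff)
  show o: "ord (a \<otimes> b) dvd ord a * ord b" using ord_mul_divides[OF com c(1,2)] .
  then have "ord (a \<otimes> b) \<noteq> 0" using c(3) by (metis dvd_0_left_iff)
  then show T: "a \<otimes> b \<in> torsion G" using c by (simp add: in_torsion_iff)
  have "(a \<otimes> b) [^] ord b = a [^] ord b" "(a \<otimes> b) [^] ord a = b [^] ord a"
    using pow_mult_distrib[OF com c(1,2)] c by simp_all
  moreover have "pow_to G (a [^] ord b) a" "pow_to G (b [^] ord a) b"
    using coprime_pow_to ab cop by (simp_all add: coprime_commute)
  ultimately show "pow_to G (a \<otimes> b) a" "pow_to G (a \<otimes> b) b"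
    using torsion_pow_toI[OF T, of "ord b"] torsion_pow_toI[OF T, of "ord a"] pow_to_trans torsion_carrier[OF T]
    by metis+
qed

lemma coprime_not_padj:
  assumes ab: "a \<in> torsion G" "b \<in> torsion G" "a \<noteq> \<one>" "b \<noteq> \<one>" and cop: "coprime (ord a) (ord b)"
  shows "\<not> padj G a b"
proof
  have c: "a \<in> carrier G" "b \<in> carrier G" using ab torsion_carrier by blast+
  assume "padj G a b"
  then have "ord a dvd ord b \<or> ord b dvd ord a" using pow_to_ord_dvd c unfolding padj_def by blast
  then have "ord a = 1 \<or> ord b = 1" using cop coprime_absorb_left coprime_absorb_right by auto
  then show False using ab ord_eq_1 c by blast
qed

text \<open>
  Suppose the order of \<open>y\<close> is smaller. Comparing \<open>y\<close> with a power of \<open>x\<close> whose order is a prime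
  power \<open>p\<^sup>k\<close> not dividing the order of \<open>y\<close> shows that \<open>y\<close> has \<open>p\<close>-power order. An element \<open>t\<close> of
  another prime order commutes with \<open>y\<close>, and \<open>y t\<close> is adjacent to \<open>y\<close> but not to \<open>x\<close>.
\<close>

lemma mixed_twin_order:
  assumes mix: "mixed_torsion G" and nil: "nilpotent G" and x: "x \<in> torsion G" and xy: "pow_to G x y"
    and tw: "nbr G x = nbr G y" and y1: "y \<noteq> \<one>"
  shows "ord y = ord x"
proof (rule ccontr)
  assume ne: "ord y \<noteq> ord x"
  have c: "x \<in> carrier G" "y \<in> carrier G" and yT: "y \<in> torsion G"
    using x xy torsion_carrier torsion_pow_to_closed by blast+
  have "ord y dvd ord x" using pow_to_ord_dvd[OF c(1) xy] .
  then have "\<not> ord x dvd ord y" using ne dvd_antisym by blast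
  then obtain p k where p: "prime p" "p ^ k dvd ord x" "\<not> p ^ k dvd ord y"
    using not_dvd_primepow x yT in_torsion_iff by metis
  obtain w where w: "pow_to G x w" "ord w = p ^ k" "w \<in> torsion G"
    using exists_power_of_order[OF x p(2)] .
  have "w \<in> nbr G x" using w torsion_carrier by (auto simp: nbr_def padj_def)
  then have "padj G y w" unfolding tw by (simp add: nbr_def)
  moreover have "\<not> pow_to G y w" using pow_to_ord_dvd[OF c(2)] w p by metis
  ultimately have "ord y dvd p ^ k" using pow_to_ord_dvd[of w y] w torsion_carrier unfolding padj_def by metis
  then obtain j where j: "ord y = p ^ j" using divides_primepow_nat p by blast
  obtain t where t: "t \<in> torsion G" "prime (ord t)" "coprime p (ord t)"
    using mixed_other_prime[OF mix p(1)] .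
  have cop: "coprime (ord y) (ord t)" unfolding j using t by simp
  have com: "y \<otimes> t = t \<otimes> y" using coprime_torsion_commute[OF nil c(2) torsion_carrier[OF t(1)] cop] .
  note v = coprime_product[OF yT t(1) com cop]
  have "y \<otimes> t \<in> nbr G y" using v torsion_carrier by (auto simp: nbr_def padj_def)
  then have "padj G x (y \<otimes> t)" unfolding tw[symmetric] by (simp add: nbr_def)
  then consider "pow_to G x (y \<otimes> t)" | "pow_to G (y \<otimes> t) x" unfolding padj_def by blast
  then show False
  proof cases
    case 1
    then have "pow_to G x t" using v(3) pow_to_trans c by blast
    then have "t \<in> nbr G y" unfolding tw[symmetric] using t torsion_carrier by (auto simp: nbr_def padj_def)
    then have "padj G y t" by (simp add: nbr_def)
    moreover have "t \<noteq> \<one>" using t(2) by auto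
    ultimately show False using coprime_not_padj[OF yT t(1) y1 _ cop] by blast
  next
    case 2
    then have "ord x dvd p ^ j * ord t" using pow_to_ord_dvd v(1,4) torsion_carrier j dvd_trans by metis
    then have "p ^ k dvd p ^ j * ord t" using p dvd_trans by blast
    moreover have "coprime (p ^ k) (ord t)" using t by simp
    ultimately have "p ^ k dvd ord y" unfolding j using coprime_dvd_mult_left_iff by blast
    then show False using p by blast
  qed
qed

lemma mixed_twins:
  assumes mix: "mixed_torsion G" and nil: "nilpotent G" and x: "x \<in> torsion G" and nd: "nbr G x \<noteq> torsion G"
  shows "twins G x = {y. pow_to G x y \<and> ord y = ord x}"
proof safe
  have xc: "x \<in> carrier G" using x torsion_carrier by blast
  fix y
  {
    assume "y \<in> twins G x"
    then have y: "y \<in> carrier G" "nbr G y = nbr G x" by (auto simp: twins_def)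
    have "y \<in> nbr G x" using y nbr_self by blast
    then have yT: "y \<in> torsion G" and pad: "padj G x y" using nbr_torsion[OF x] by (auto simp: nbr_def)
    have ne: "x \<noteq> \<one>" "y \<noteq> \<one>" using nd y nbr_one by auto
    have o: "ord y = ord x"
      using pad mixed_twin_order[OF mix nil x _ y(2)[symmetric] ne(2)] mixed_twin_order[OF mix nil yT _ y(2) ne(1)]
      unfolding padj_def by auto
    then show "ord y = ord x" .
    show "pow_to G x y"
      using pad cyclic_pow_to[OF yT pow_to_refl[OF y(1)]] o unfolding padj_def by auto
  }
  assume y: "pow_to G x y" "ord y = ord x"
  have "pow_to G y x" using cyclic_pow_to[OF x pow_to_refl[OF xc] y(1)] y by simp
  then show "y \<in> twins G x" using same_powers_nbr[OF xc] y pow_to_closed xc by (auto simp: twins_def)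
qed

text \<open>
  If some \<open>w\<close> were not a power of \<open>z\<close>, a power of \<open>w\<close> of prime power order would be a root of \<open>z\<close>;
  then \<open>z\<close> has prime power order and is not adjacent to elements of another prime order.
\<close>

lemma mixed_dominating:
  assumes mix: "mixed_torsion G" and z: "z \<in> torsion G" "z \<noteq> \<one>" "nbr G z = torsion G"
  shows "torsion G = powers G z"
proof
  have zc: "z \<in> carrier G" using z torsion_carrier by blast
  show "powers G z \<subseteq> torsion G" using z torsion_pow_to_closed by (auto simp: powers_def)
  show "torsion G \<subseteq> powers G z"
  proof
    fix w assume w: "w \<in> torsion G"
    then have pad: "padj G z w" using z by (auto simp: nbr_def)
    show "w \<in> powers G z"
    proof (cases "pow_to G z w")
      case False
      then have wz: "pow_to G w z" using pad unfolding padj_def by blast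
      have "\<not> ord w dvd ord z" using cyclic_pow_to[OF w pow_to_refl wz] w torsion_carrier False by blast
      then obtain p k where p: "prime p" "p ^ k dvd ord w" "\<not> p ^ k dvd ord z"
        using not_dvd_primepow w z in_torsion_iff by metis
      obtain w' where w': "ord w' = p ^ k" "w' \<in> torsion G" using exists_power_of_order[OF w p(2)] by metis
      then have "padj G z w'" using z by (auto simp: nbr_def)
      moreover have "\<not> pow_to G z w'" using pow_to_ord_dvd[OF zc] w' p by metis
      ultimately have "ord z dvd p ^ k" using pow_to_ord_dvd[of w' z] w' torsion_carrier unfolding padj_def by metis
      then obtain j where j: "ord z = p ^ j" using divides_primepow_nat p by blast
      obtain t where t: "t \<in> torsion G" "prime (ord t)" "coprime p (ord t)"
        using mixed_other_prime[OF mix p(1)] .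
      have "t \<noteq> \<one>" using t(2) by auto
      moreover have "coprime (ord z) (ord t)" unfolding j using t by simp
      ultimately have "\<not> padj G z t" using coprime_not_padj[OF z(1) t(1) z(2)] by blast
      then show ?thesis using z t by (auto simp: nbr_def)
    qed (simp add: powers_def)
  qed
qed

text \<open>
  An edge between an element \<open>x\<close> of prime order and a product \<open>v\<close> of \<open>x\<close> with an element of
  another prime order.
\<close>

lemma mixed_edge:
  assumes mix: "mixed_torsion G" and nil: "nilpotent G"
  obtains x v where "x \<in> torsion G" "v \<in> torsion G" "pow_to G v x" "nbr G x \<noteq> torsion G"
    "\<not> nbr G v \<subseteq> nbr G x" "v \<noteq> \<one>"
proof -
  obtain x y where xy: "x \<in> torsion G" "y \<in> torsion G" "prime (ord x)" "prime (ord y)" "ord x \<noteq> ord y"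
    using mix unfolding mixed_torsion_iff by blast
  have cop: "coprime (ord x) (ord y)" using xy primes_coprime by blast
  have ne: "x \<noteq> \<one>" "y \<noteq> \<one>" using xy by auto
  have com: "x \<otimes> y = y \<otimes> x" using coprime_torsion_commute[OF nil _ _ cop] xy torsion_carrier by blast
  note v = coprime_product[OF xy(1,2) com cop]
  have yx: "y \<notin> nbr G x" using coprime_not_padj[OF xy(1,2) ne cop] by (simp add: nbr_def)
  moreover have "y \<in> nbr G (x \<otimes> y)" using v xy torsion_carrier by (auto simp: nbr_def padj_def)
  moreover have "x \<otimes> y \<noteq> \<one>"
  proof
    assume "x \<otimes> y = \<one>"
    then have "ord x dvd ord \<one>" using pow_to_ord_dvd[OF one_closed] v(2) by simp
    then show False using xy by simp
  qed
  ultimately show ?thesis using that[OF xy(1) v(1,2)] xy by blast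
qed

end

context torsion_preserving_iso
begin

text \<open>
  Let \<open>x\<close> and \<open>v\<close> be as in \<open>mixed_edge\<close>. In \<open>H\<close> the element \<open>v\<close> has at least as many twins as \<open>x\<close>,
  even without counting \<open>1\<close>, since \<open>\<phi>(ord x)\<close> divides \<open>\<phi>(ord v)\<close>. In \<open>G\<close> the neighbourhoods of the
  corresponding vertices must be nested, and then \<open>p_torsion_twins_card\<close> gives the opposite strict
  inequality.
\<close>

lemma p_torsion_not_mixed:
  assumes p: "p_torsion G p" and mix: "mixed_torsion H" and nil: "nilpotent H"
  shows False
proof -
  obtain x' v' where xv': "x' \<in> torsion H" "v' \<in> torsion H" "pow_to H v' x'" "nbr H x' \<noteq> torsion H"
    "\<not> nbr H v' \<subseteq> nbr H x'" "v' \<noteq> \<one>\<^bsub>H\<^esub>"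
    using H.mixed_edge[OF mix nil] by metis
  obtain x v where xv: "x \<in> torsion G" "f x = x'" "v \<in> torsion G" "f v = v'"
    using f_torsion_surj xv'(1,2) by metis
  obtain e where e: "e \<in> carrier G" "f e = \<one>\<^bsub>H\<^esub>" using f_surj[OF H.one_closed] .
  have c: "x \<in> carrier G" "v \<in> carrier G" using xv G.torsion_carrier by blast+
  have "nbr H (f e) = f ` torsion G" using e tor H.nbr_one by simp
  then have "f ` nbr G e = f ` torsion G" using f_nbr[OF e(1)] by simp
  then have ne: "nbr G e = torsion G"
    using inj_on_image_eq_iff[OF bij_betw_imp_inj_on[OF bij] nbr_carrier] G.torsion_carrier by (metis subsetI)
  have tx: "twins H x' = {y. pow_to H x' y \<and> H.ord y = H.ord x'}" using H.mixed_twins[OF mix nil xv'(1,4)] .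
  have "padj H (f x) (f v)" using xv' xv by (simp add: padj_def)
  then have "padj G x v" using adj c by blast
  moreover have nsub: "\<not> nbr G v \<subseteq> nbr G x" using xv'(5) f_nbr_subset_iff c xv by blast
  ultimately have "pow_to G x v" using G.p_torsion_nbr_mono[OF p xv(3)] unfolding padj_def by blast
  then have lt: "nbr G x \<subset> nbr G v" using G.p_torsion_nbr_mono[OF p xv(1)] nsub by blast
  have finx: "finite (twins G x)"
  proof -
    have "finite (twins H x')"
      unfolding tx using H.finite_powers[OF xv'(1)] unfolding powers_def by (rule rev_finite_subset) blast
    then show ?thesis using f_twins[OF c(1)] f_card[of "twins G x"] xv by (auto simp: twins_def)
  qed
  note tc = G.p_torsion_twins_card[OF p xv(3,1) lt finx e(1) ne]
  have sub: "twins G v \<subseteq> carrier G" "twins G x \<subseteq> carrier G" by (auto simp: twins_def)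
  have im: "twins H v' - {\<one>\<^bsub>H\<^esub>} = f ` (twins G v - {e})"
    using f_twins[OF c(2)] xv(4) e inj_on_image_set_diff[OF bij_betw_imp_inj_on[OF bij], of "twins G v" "{e}"] sub
    by auto
  have "card (twins H v' - {\<one>\<^bsub>H\<^esub>}) = card (twins G v - {e})"
    unfolding im using f_card[of "twins G v - {e}"] sub by blast
  also have "\<dots> < card (twins G x)" by (rule tc(2))
  also have "\<dots> = card (twins H x')" using f_twins[OF c(1)] f_card[OF sub(2)] xv by simp
  also have "\<dots> = totient (H.ord x')" unfolding tx by (rule H.card_generators[OF xv'(1)])
  also have "\<dots> \<le> totient (H.ord v')"
    using H.pow_to_ord_dvd[OF H.torsion_carrier[OF xv'(2)] xv'(3)] xv'(2)
    by (intro totient_dvd_mono) (auto simp: H.in_torsion_iff)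
  also have "\<dots> \<le> card (twins H v' - {\<one>\<^bsub>H\<^esub>})"
  proof -
    have v'c: "v' \<in> carrier H" using xv' H.torsion_carrier by blast
    have "{y. pow_to H v' y \<and> H.ord y = H.ord v'} \<subseteq> twins H v' - {\<one>\<^bsub>H\<^esub>}"
    proof safe
      fix y assume y: "pow_to H v' y" "H.ord y = H.ord v'"
      have "pow_to H y v'" using H.cyclic_pow_to[OF xv'(2) H.pow_to_refl[OF v'c] y(1)] y by simp
      then show "y \<in> twins H v'" using H.same_powers_nbr[OF v'c] y H.pow_to_closed v'c by (auto simp: twins_def)
    next
      assume "H.ord \<one>\<^bsub>H\<^esub> = H.ord v'"
      then show False using xv'(6) H.ord_eq_1[OF v'c] by simp
    qed
    moreover have "finite (twins H v' - {\<one>\<^bsub>H\<^esub>})" unfolding im using tc(1) by simp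
    ultimately show ?thesis using card_mono H.card_generators[OF xv'(2)] by metis
  qed
  finally show False by simp
qed

end

context group
begin

lemma powers_pow_to_iff:
  assumes z: "z \<in> torsion G" and xy: "x \<in> powers G z" "y \<in> powers G z"
  shows "pow_to G x y \<longleftrightarrow> ord y dvd ord x"
proof -
  have "x \<in> carrier G" using xy pow_to_closed torsion_carrier[OF z] unfolding powers_def by blast
  then show ?thesis using pow_to_ord_dvd cyclic_pow_to[OF z, of y x] xy unfolding powers_def by blast
qed

lemma powers_fibre_card:
  assumes z: "z \<in> torsion G"
  shows "finite {y \<in> powers G z. ord y = d}"
    and "card {y \<in> powers G z. ord y = d} = (if d dvd ord z then totient d else 0)"
proof -
  show "finite {y \<in> powers G z. ord y = d}" using finite_powers[OF z] by simp
  have "{y \<in> powers G z. ord y = d} = {y. pow_to G z y \<and> ord y = d}" by (simp add: powers_def)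
  moreover have "{y. pow_to G z y \<and> ord y = d} = {}" if "\<not> d dvd ord z"
    using that pow_to_ord_dvd torsion_carrier[OF z] by blast
  ultimately show "card {y \<in> powers G z. ord y = d} = (if d dvd ord z then totient d else 0)"
    using card_powers_of_order[OF z] by (metis card.empty)
qed

end

text \<open>
  Inside a finite cyclic group the power relation is divisibility of orders.
\<close>

lemma cyclic_dir_iso:
  assumes "group G" "group H" and z: "z \<in> torsion G" "z' \<in> torsion H" and o: "group.ord G z = group.ord H z'"
  shows "dir_iso_on G (powers G z) H (powers H z')"
proof -
  interpret G: group G by fact
  interpret H: group H by fact
  obtain g where g: "bij_betw g (powers G z) (powers H z')" "\<And>x. x \<in> powers G z \<Longrightarrow> H.ord (g x) = G.ord x"
    using bij_betw_of_fibres[of "powers G z" G.ord "powers H z'" H.ord]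
      G.powers_fibre_card[OF z(1)] H.powers_fibre_card[OF z(2)] o by auto
  have "pow_to G x y \<longleftrightarrow> pow_to H (g x) (g y)" if "x \<in> powers G z" "y \<in> powers G z" for x y
    using G.powers_pow_to_iff[OF z(1) that] H.powers_pow_to_iff[OF z(2), of "g x" "g y"] g that
      bij_betw_apply[OF g(1)] by simp
  then show ?thesis using g unfolding dir_iso_on_def by blast
qed

context torsion_preserving_iso
begin

lemma f_dominating_iff: "x \<in> torsion G \<Longrightarrow> nbr H (f x) = torsion H \<longleftrightarrow> nbr G x = torsion G"
  using f_nbr[of x] tor inj_on_image_eq_iff[OF bij_betw_imp_inj_on[OF bij] nbr_carrier, of "torsion G" x]
    G.torsion_carrier by (metis subsetI)

text \<open>
  If \<open>f\<close> reversed the arc from \<open>x\<close> to \<open>y\<close>, the totients of all four orders would agree, so \<open>y\<close> has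
  odd order and \<open>f y\<close> even order. An involution among the powers of \<open>f y\<close> comes from an involution
  adjacent to \<open>y\<close>, since involutions are the nontrivial elements without other twins.
\<close>

lemma mixed_forward:
  assumes G: "mixed_torsion G" "nilpotent G" and H: "mixed_torsion H" "nilpotent H"
    and dG: "\<And>x. x \<in> torsion G \<Longrightarrow> nbr G x = torsion G \<Longrightarrow> x = \<one>\<^bsub>G\<^esub>"
    and dH: "\<And>x. x \<in> torsion H \<Longrightarrow> nbr H x = torsion H \<Longrightarrow> x = \<one>\<^bsub>H\<^esub>"
    and xy: "x \<in> torsion G" "y \<in> torsion G" and p: "pow_to G x y"
  shows "pow_to H (f x) (f y)"
proof (rule ccontr)
  assume n: "\<not> pow_to H (f x) (f y)"
  have c: "x \<in> carrier G" "y \<in> carrier G" using xy G.torsion_carrier by blast+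
  have fT: "f x \<in> torsion H" "f y \<in> torsion H" using f_torsion xy by blast+
  then have fc: "f x \<in> carrier H" "f y \<in> carrier H" using H.torsion_carrier by blast+
  have f1: "f \<one>\<^bsub>G\<^esub> = \<one>\<^bsub>H\<^esub>"
    using dH f_dominating_iff[OF G.one_torsion] f_torsion[OF G.one_torsion] G.nbr_one by blast
  \<comment> \<open>the number of twins is the number of generators\<close>
  have tot: "totient (H.ord (f u)) = totient (G.ord u)" if u: "u \<in> torsion G" for u
  proof (cases "u = \<one>\<^bsub>G\<^esub>")
    case False
    have uc: "u \<in> carrier G" using u G.torsion_carrier by blast
    have nd: "nbr G u \<noteq> torsion G" "nbr H (f u) \<noteq> torsion H" using dG u False f_dominating_iff by blast+
    have "totient (G.ord u) = card (twins G u)"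
      unfolding G.mixed_twins[OF G u nd(1)] using G.card_generators[OF u] by simp
    also have "\<dots> = card (twins H (f u))"
      using f_twins[OF uc] f_card[of "twins G u"] by (auto simp: twins_def)
    also have "\<dots> = totient (H.ord (f u))"
      unfolding H.mixed_twins[OF H f_torsion[OF u] nd(2)] using H.card_generators[OF f_torsion[OF u]] by simp
    finally show ?thesis by simp
  qed (simp add: f1)
  have "padj H (f x) (f y)" using p adj c unfolding padj_def by blast
  then have q: "pow_to H (f y) (f x)" using n unfolding padj_def by blast
  have tw: "nbr G x \<noteq> nbr G y"
  proof
    assume "nbr G x = nbr G y"
    then have e: "nbr H (f x) = nbr H (f y)" using f_nbr_eq_iff c by blast
    show False
    proof (cases "nbr H (f x) = torsion H")
      case True
      then have "f x = f y" using dH fT e by metis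
      then show False using n H.pow_to_refl fc by simp
    next
      case False
      have "f y \<in> twins H (f x)" using e fc by (simp add: twins_def)
      then show False using n H.mixed_twins[OF H fT(1) False] by blast
    qed
  qed
  have ne: "G.ord y \<noteq> G.ord x"
  proof
    assume "G.ord y = G.ord x"
    then have "pow_to G y x" using G.cyclic_pow_to[OF xy(1) G.pow_to_refl[OF c(1)] p] by simp
    then show False using G.same_powers_nbr[OF c p] tw by blast
  qed
  have ne': "H.ord (f x) \<noteq> H.ord (f y)"
  proof
    assume "H.ord (f x) = H.ord (f y)"
    then have "pow_to H (f x) (f y)" using H.cyclic_pow_to[OF fT(2) H.pow_to_refl[OF fc(2)] q] by simp
    then show False using n by blast
  qed
  have d: "G.ord y dvd G.ord x" "H.ord (f x) dvd H.ord (f y)"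
    using G.pow_to_ord_dvd[OF c(1) p] H.pow_to_ord_dvd[OF fc(2) q] .
  have pos: "G.ord x > 0" "H.ord (f y) > 0" using xy fT by (auto simp: G.in_torsion_iff H.in_torsion_iff)
  have le: "totient (G.ord x) \<le> totient (G.ord y)"
    using totient_dvd_mono[OF d(2) pos(2)] tot xy by simp
  have le': "totient (H.ord (f y)) \<le> totient (H.ord (f x))"
    using totient_dvd_mono[OF d(1) pos(1)] tot xy by simp
  have par: "odd (G.ord y)" "even (H.ord (f y))"
    using totient_eq_imp_parity[OF d(1) pos(1) ne le] totient_eq_imp_parity[OF d(2) pos(2) ne' le'] by blast+
  obtain i' where i': "pow_to H (f y) i'" "H.ord i' = 2" "i' \<in> torsion H"
    using H.exists_power_of_order[OF fT(2) par(2)] .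
  obtain i where i: "i \<in> torsion G" "f i = i'" using f_torsion_surj[OF i'(3)] .
  have ic: "i \<in> carrier G" using i G.torsion_carrier by blast
  have "i \<noteq> \<one>\<^bsub>G\<^esub>" using i i'(2) f1 by auto
  then have "G.ord i \<noteq> 1" using G.ord_eq_1 ic by blast
  moreover have "G.ord i \<noteq> 0" using i by (simp add: G.in_torsion_iff)
  moreover have "\<not> G.ord i > 2" using totient_gt_1[of "G.ord i"] tot[OF i(1)] i i'(2) by auto
  ultimately have oi: "G.ord i = 2" by linarith
  have "padj H (f y) (f i)" using i i'(1) by (simp add: padj_def)
  then have "padj G y i" using adj c ic by blast
  then consider "pow_to G y i" | "pow_to G i y" unfolding padj_def by blast
  then show False
  proof cases
    case 1
    then show False using G.pow_to_ord_dvd[OF c(2) 1] oi par by simp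
  next
    case 2
    then have "G.ord y dvd 2" using G.pow_to_ord_dvd[OF ic 2] oi by simp
    then have "G.ord y = 1 \<or> G.ord y = 2" using two_is_prime_nat prime_nat_iff by blast
    then have "G.ord y = 1" using par by auto
    then have "f y = \<one>\<^bsub>H\<^esub>" using G.ord_eq_1[OF c(2)] f1 by simp
    then show False using par by simp
  qed
qed

lemma mixed_dir_iso:
  assumes G: "mixed_torsion G" "nilpotent G" and H: "mixed_torsion H" "nilpotent H"
  shows "dir_iso_on G (torsion G) H (torsion H)"
proof (cases "\<exists>z \<in> torsion G. z \<noteq> \<one>\<^bsub>G\<^esub> \<and> nbr G z = torsion G")
  case True
  then obtain z where z: "z \<in> torsion G" "z \<noteq> \<one>\<^bsub>G\<^esub>" "nbr G z = torsion G" by blast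
  have "f z \<noteq> f \<one>\<^bsub>G\<^esub>" using z f_inj G.torsion_carrier by simp
  \<comment> \<open>at most one of the dominating elements \<open>z\<close> and \<open>1\<close> is mapped to \<open>1\<close>\<close>
  then obtain u where u: "u \<in> torsion G" "nbr G u = torsion G" "f u \<noteq> \<one>\<^bsub>H\<^esub>"
    using z G.one_torsion G.nbr_one by metis
  have TG: "torsion G = powers G z" using G.mixed_dominating[OF G(1) z] .
  have TH: "torsion H = powers H (f u)"
    using H.mixed_dominating[OF H(1) f_torsion[OF u(1)] u(3)] f_dominating_iff u by blast
  have "G.ord z = card (torsion G)" using G.card_powers[OF z(1)] TG by simp
  also have "\<dots> = card (torsion H)" using f_card[of "torsion G"] tor by (simp add: torsion_def)
  also have "\<dots> = H.ord (f u)" using H.card_powers[OF f_torsion[OF u(1)]] TH by simp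
  finally show ?thesis
    using cyclic_dir_iso[OF G.is_group H.is_group z(1) f_torsion[OF u(1)]] TG TH by simp
next
  case False
  then have dG: "x = \<one>\<^bsub>G\<^esub>" if "x \<in> torsion G" "nbr G x = torsion G" for x using that by blast
  have dH: "y = \<one>\<^bsub>H\<^esub>" if y: "y \<in> torsion H" "nbr H y = torsion H" for y
  proof -
    obtain x where x: "x \<in> torsion G" "f x = y" using f_torsion_surj[OF y(1)] .
    obtain e where e: "e \<in> torsion G" "f e = \<one>\<^bsub>H\<^esub>" using f_torsion_surj[OF H.one_torsion] .
    have "x = \<one>\<^bsub>G\<^esub>" using dG x y f_dominating_iff by metis
    moreover have "e = \<one>\<^bsub>G\<^esub>" using dG e H.nbr_one f_dominating_iff by metis
    ultimately show ?thesis using x e by simp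
  qed
  let ?h = "inv_into (carrier G) f"
  interpret inv: torsion_preserving_iso H G ?h by (rule inverse_torsion_iso)
  have "pow_to G x y \<longleftrightarrow> pow_to H (f x) (f y)" if xy: "x \<in> torsion G" "y \<in> torsion G" for x y
  proof
    show "pow_to H (f x) (f y)" if "pow_to G x y" using mixed_forward[OF G H dG dH xy that] by blast
    show "pow_to G x y" if "pow_to H (f x) (f y)"
    proof -
      have "pow_to G (?h (f x)) (?h (f y))"
        using inv.mixed_forward[OF H G dH dG f_torsion[OF xy(1)] f_torsion[OF xy(2)] that] by blast
      moreover have "?h (f x) = x" "?h (f y) = y"
        using inv_into_f_f[OF bij_betw_imp_inj_on[OF bij]] xy G.torsion_carrier by blast+
      ultimately show ?thesis by simp
    qed
  qed
  moreover have "bij_betw f (torsion G) (torsion H)"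
    using bij_betw_subset[OF bij _ tor] G.torsion_carrier by blast
  ultimately show ?thesis unfolding dir_iso_on_def by blast
qed

end

section \<open>The prime is determined by a finite set of vertices\<close>

context group
begin

text \<open>
  An element of order \<open>p\<^sup>j\<close> in an infinite chain is a power of an element of order \<open>p\<^bsup>m j\<^esup>\<close> for
  any \<open>m > 0\<close>, and \<open>t\<close> acts on the latter as an exponent congruent to \<open>1\<close> modulo \<open>p\<^sup>j\<close> when \<open>m\<close> is
  the length of the lower central series. So a Pruefer subgroup that is normalised is centralised.
\<close>

lemma long_chain_centralized:
  assumes nil: "nilpotent G" and p: "p_torsion G p" and S: "cyclic_chain G S" and inf: "infinite S"
    and t: "t \<in> carrier G" and cl: "\<And>s. s \<in> S \<Longrightarrow> t \<otimes> s \<otimes> inv t \<in> S" and s: "s \<in> S"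
  shows "t \<otimes> s = s \<otimes> t"
proof -
  obtain m where m: "lower_central G m = {\<one>}" using nil unfolding nilpotent_def by blast
  have sT: "s \<in> torsion G" using cyclic_chain_torsion[OF S s] .
  then have sc: "s \<in> carrier G" using torsion_carrier by blast
  show ?thesis
  proof (cases "m = 0")
    case True
    then show ?thesis using m t sc by simp
  next
    case False
    obtain j where j: "ord s = p ^ j" using p sT unfolding p_torsion_def by blast
    obtain r where r: "r \<in> S" "ord r = p ^ (m * j)" using cyclic_chain_infinite[OF p S inf] .
    have rc: "r \<in> carrier G" and rT: "r \<in> torsion G" using cyclic_chain_torsion[OF S r(1)] torsion_carrier by blast+
    have "(t \<otimes> r \<otimes> inv t) [^] ord r = \<one>" using conj_nat_pow[OF t rc, of "ord r"] t rc by simp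
    then have "ord (t \<otimes> r \<otimes> inv t) dvd ord r" using pow_eq_id t rc by simp
    then have "ord (t \<otimes> r \<otimes> inv t) \<le> ord r" using rT by (simp add: in_torsion_iff dvd_imp_le)
    then have "pow_to G r (t \<otimes> r \<otimes> inv t)" using cyclic_chain_ord_le[OF S r(1) cl[OF r(1)]] by blast
    then obtain e :: int where e: "t \<otimes> r \<otimes> inv t = r [^] e" unfolding pow_to_def by blast
    have d: "int (ord s) dvd e - 1"
      unfolding j using conj_power_congruence[OF m t rc r(2) e] False by blast
    have p1: "p > 1" using p prime_gt_1_nat unfolding p_torsion_def by blast
    have "ord s \<le> ord r" unfolding j r(2) using p1 False by (intro power_increasing) simp_all
    then obtain l :: int where l: "s = r [^] l" using cyclic_chain_ord_le[OF S r(1) s] unfolding pow_to_def by blast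
    have "t \<otimes> s \<otimes> inv t = (r [^] e) [^] l" unfolding l conj_int_pow[OF t rc] e ..
    also have "\<dots> = s [^] e" unfolding l using rc by (simp add: int_pow_pow mult.commute)
    also have "\<dots> = s [^] (1::int)" unfolding int_pow_eq[OF sc] using d by (metis dvd_minus_iff minus_diff_eq)
    finally have "t \<otimes> s \<otimes> inv t = s" using sc by simp
    then show ?thesis using t sc inv_solve_right'[of s "t \<otimes> s" t] by simp
  qed
qed

lemma cyclic_chain_quotient:
  assumes S: "cyclic_chain G S" and ab: "a \<in> S" "b \<in> S"
  shows "inv a \<otimes> b \<in> S"
proof -
  have main: "inv a \<otimes> b \<in> S" if c: "c \<in> S" and ca: "pow_to G c a" and cb: "pow_to G c b" for c
  proof -
    have cT: "c \<in> torsion G" using cyclic_chain_torsion[OF S c] .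
    then have cc: "c \<in> carrier G" using torsion_carrier by blast
    obtain i j :: int where ij: "a = c [^] i" "b = c [^] j" using ca cb unfolding pow_to_def by blast
    have "inv a \<otimes> b = c [^] (- i + j)" unfolding ij using cc by (simp only: int_pow_mult int_pow_neg)
    then have "pow_to G c (inv a \<otimes> b)" using torsion_int_pow[OF cT] torsion_pow_toI[OF cT] by metis
    then show ?thesis using cyclic_chain_down[OF S c] by blast
  qed
  have "pow_to G a a" "pow_to G b b" using ab cyclic_chain_torsion[OF S] torsion_carrier pow_to_refl by blast+
  then show ?thesis using main ab cyclic_chain_padj[OF S ab] unfolding padj_def by blast
qed

text \<open>
  Otherwise the closed neighbourhood \<open>P\<close> of \<open>x\<close> is a Pruefer group that contains all roots of its
  nontrivial elements. There is an element \<open>t\<close> of order \<open>p\<close> outside \<open>P\<close> that centralises \<open>P\<close>: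
  either a central one or, if \<open>P\<close> contains a nontrivial central element, any one, since then \<open>x\<close>
  is central and \<open>P\<close> is normal. For \<open>s\<close> in \<open>P\<close> of order \<open>p\<^sup>2\<close> the product \<open>s t\<close> is a root of
  \<open>s\<^sup>p\<close>, so it lies in \<open>P\<close>, and so does \<open>t\<close>.
\<close>

lemma finite_dominators:
  assumes nil: "nilpotent G" and p: "p_torsion G p" and x: "x \<in> torsion G" "ord x = p" and nd: "nbr G x \<noteq> torsion G"
  shows "finite (dominators G x)"
proof (rule ccontr)
  let ?P = "dominators G x"
  assume inf: "infinite ?P"
  have xc: "x \<in> carrier G" using x torsion_carrier by blast
  have pp: "prime p" "p > 1" using p prime_gt_1_nat unfolding p_torsion_def by blast+
  have S: "cyclic_chain G ?P" using dominators_cyclic_chain(1)[OF p x(1)] .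
  have PT: "s \<in> torsion G" "s \<in> carrier G" if "s \<in> ?P" for s
    using that cyclic_chain_torsion[OF S] torsion_carrier by blast+
  have xP: "x \<in> ?P" using xc by (simp add: dominators_def)
  \<comment> \<open>every neighbour of \<open>x\<close> is adjacent to an element of \<open>P\<close> of larger order, hence is a power of it\<close>
  have nP: "nbr G x = ?P"
  proof
    show "?P \<subseteq> nbr G x" using dominators_padj[OF xc] PT by (auto simp: nbr_def)
    show "nbr G x \<subseteq> ?P"
    proof
      fix y assume y: "y \<in> nbr G x"
      then have yT: "y \<in> torsion G" using nbr_torsion x by blast
      then obtain k where k: "ord y = p ^ k" using p unfolding p_torsion_def by blast
      obtain w where w: "w \<in> ?P" "ord w = p ^ Suc k" using cyclic_chain_infinite[OF p S inf] .
      have "y \<in> nbr G w" using w y by (auto simp: dominators_def)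
      then have "padj G w y" by (simp add: nbr_def)
      moreover have "\<not> pow_to G y w"
      proof
        assume "pow_to G y w"
        then have "p ^ Suc k dvd p ^ k" using pow_to_ord_dvd yT torsion_carrier w k by metis
        then show False using pp by (simp add: power_dvd_imp_le)
      qed
      ultimately have "pow_to G w y" unfolding padj_def by blast
      then show "y \<in> ?P" using cyclic_chain_down[OF S w(1)] by blast
    qed
  qed
  have to_x: "pow_to G s x" if s: "s \<in> ?P" "s \<noteq> \<one>" for s
  proof -
    obtain k where k: "ord s = p ^ k" using p PT(1)[OF s(1)] unfolding p_torsion_def by blast
    have "k \<noteq> 0" using k s ord_eq_1 PT(2) by (metis power_0)
    then have "ord x \<le> ord s" unfolding x(2) k using pp self_le_power[of p k] by simp
    then show ?thesis using cyclic_chain_ord_le[OF S s(1) xP] by blast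
  qed
  have in_P: "s \<in> ?P" if "s \<in> carrier G" "pow_to G s x" for s
    using that unfolding nP[symmetric] by (simp add: nbr_def padj_def)
  have ordp: "\<exists>t. pow_to G u t \<and> ord t = p" if u: "u \<in> torsion G" "u \<noteq> \<one>" for u
  proof -
    obtain k where k: "ord u = p ^ k" using p u(1) unfolding p_torsion_def by blast
    have "k \<noteq> 0" using k u ord_eq_1 torsion_carrier by (metis power_0)
    then have "p dvd ord u" unfolding k by simp
    then show ?thesis using exists_power_of_order[OF u(1)] by metis
  qed
  have "\<exists>t \<in> torsion G - ?P. ord t = p \<and> (\<forall>s \<in> ?P. t \<otimes> s = s \<otimes> t)"
  proof -
    have "torsion G \<noteq> {\<one>}" using x pp ord_id by auto
    then obtain z where z: "z \<in> torsion G" "z \<noteq> \<one>" "\<And>g. g \<in> carrier G \<Longrightarrow> z \<otimes> g = g \<otimes> z"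
      using central_torsion_element[OF nil] by metis
    have zc: "z \<in> carrier G" using z torsion_carrier by blast
    show ?thesis
    proof (cases "z \<in> ?P")
      case False
      obtain t where t: "pow_to G z t" "ord t = p" using ordp z by blast
      have tT: "t \<in> torsion G" using t z torsion_pow_to_closed by blast
      have "t \<notin> ?P"
      proof
        assume "t \<in> ?P"
        moreover have "t \<noteq> \<one>" using t pp by auto
        ultimately have "pow_to G z x" using to_x pow_to_trans[OF t(1)] zc by blast
        then show False using in_P zc False by blast
      qed
      moreover obtain k :: nat where "t = z [^] k" using t z torsion_pow_to_iff by blast
      then have "\<forall>s \<in> ?P. t \<otimes> s = s \<otimes> t" using group_commutes_pow z(3) zc PT by blast
      ultimately show ?thesis using t tT by blast
    next
      case True
      have "pow_to G z x" using to_x z True by blast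
      then obtain k :: nat where "x = z [^] k" using torsion_pow_to_iff z by blast
      then have xcen: "x \<otimes> g = g \<otimes> x" if "g \<in> carrier G" for g using group_commutes_pow z(3) zc that by blast
      obtain u where u: "u \<in> torsion G" "u \<notin> ?P"
        using nd nP nbr_torsion[OF x(1)] by blast
      have "\<one> \<in> ?P" using cyclic_chain_down[OF S xP] torsion_pow_to_one x by blast
      then have "u \<noteq> \<one>" using u by blast
      then obtain t where t: "pow_to G u t" "ord t = p" using ordp u by blast
      have tT: "t \<in> torsion G" using t u torsion_pow_to_closed by blast
      have tc: "t \<in> carrier G" using tT torsion_carrier by blast
      have "t \<notin> ?P"
      proof
        assume "t \<in> ?P"
        moreover have "t \<noteq> \<one>" using t pp by auto
        ultimately have "pow_to G u x" using to_x pow_to_trans[OF t(1)] u torsion_carrier by blast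
        then show False using in_P u torsion_carrier by blast
      qed
      moreover have "t \<otimes> s \<otimes> inv t \<in> ?P" if s: "s \<in> ?P" for s
      proof (cases "s = \<one>")
        case True
        then show ?thesis using tc s by simp
      next
        case False
        then obtain k :: int where k: "k \<noteq> 0" "x = s [^] k" using to_x[OF s] unfolding pow_to_def by blast
        have "(t \<otimes> s \<otimes> inv t) [^] k = t \<otimes> x \<otimes> inv t"
          using conj_int_pow[OF tc, of s k] PT(2)[OF s] k by simp
        also have "\<dots> = x" using xcen[OF tc, symmetric] tc xc by (simp add: m_assoc)
        finally have "pow_to G (t \<otimes> s \<otimes> inv t) x" using k unfolding pow_to_def by metis
        then show ?thesis using in_P tc PT(2)[OF s] by simp
      qed
      then have "\<forall>s \<in> ?P. t \<otimes> s = s \<otimes> t" using long_chain_centralized[OF nil p S inf tc] by blast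
      ultimately show ?thesis using t tT by blast
    qed
  qed
  then obtain t where t: "t \<in> torsion G" "t \<notin> ?P" "ord t = p" "\<And>s. s \<in> ?P \<Longrightarrow> t \<otimes> s = s \<otimes> t" by blast
  have tc: "t \<in> carrier G" using t torsion_carrier by blast
  obtain s where s: "s \<in> ?P" "ord s = p ^ 2" using cyclic_chain_infinite[OF p S inf] .
  have sc: "s \<in> carrier G" using PT s by blast
  have "(s \<otimes> t) [^] p = s [^] p \<otimes> t [^] p" using pow_mult_distrib[OF t(4)[OF s(1), symmetric] sc tc] .
  also have "\<dots> = s [^] p" using t(3) tc sc by (metis nat_pow_closed pow_ord_eq_1 r_one)
  finally have e: "(s \<otimes> t) [^] p = s [^] p" .
  have "pow_to G s (s [^] p)" using torsion_pow_toI PT(1)[OF s(1)] by blast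
  then have spP: "s [^] p \<in> ?P" using cyclic_chain_down[OF S s(1)] by blast
  have "s [^] p \<noteq> \<one>" using s(2) sc pp pow_eq_id by (simp add: power2_eq_square)
  then have "pow_to G (s [^] p) x" using to_x spP by blast
  moreover have "pow_to G (s \<otimes> t) (s [^] p)"
    using pow_toI[of "int p" "s \<otimes> t"] pp e by (simp add: int_pow_int)
  ultimately have "s \<otimes> t \<in> ?P" using in_P pow_to_trans sc tc m_closed by blast
  then have "inv s \<otimes> (s \<otimes> t) \<in> ?P" using cyclic_chain_quotient[OF S s(1)] by blast
  then show False using t(2) sc tc by (simp add: inv_l_cancel)
qed

end

context torsion_preserving_iso
begin

text \<open>
  The set of dominators is a finite cyclic group, so its cardinality is a power of \<open>p\<close> and also of
  \<open>q\<close>.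
\<close>

lemma equal_primes_of_dominators:
  assumes pG: "p_torsion G p" and pH: "p_torsion H q" and x: "x \<in> torsion G"
    and fin: "finite (dominators G x)" and two: "card (dominators G x) \<noteq> 1"
  shows "p = q"
proof -
  have xc: "x \<in> carrier G" using x G.torsion_carrier by blast
  have sub: "dominators G x \<subseteq> carrier G" by (auto simp: dominators_def)
  have finH: "finite (dominators H (f x))" and card: "card (dominators H (f x)) = card (dominators G x)"
    using f_dominators[OF xc] f_card[OF sub] fin by simp_all
  have ne: "dominators G x \<noteq> {}" "dominators H (f x) \<noteq> {}" using xc f_closed by (auto simp: dominators_def)
  obtain z where z: "z \<in> dominators G x" "card (dominators G x) = G.ord z"
    using G.cyclic_chain_finite[OF G.dominators_cyclic_chain(1)[OF pG x] ne(1) fin] by metis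
  obtain z' where z': "z' \<in> dominators H (f x)" "card (dominators H (f x)) = H.ord z'"
    using H.cyclic_chain_finite[OF H.dominators_cyclic_chain(1)[OF pH f_torsion[OF x]] ne(2) finH] by metis
  obtain a where a: "G.ord z = p ^ a" using pG z G.dominators_torsion[OF x] unfolding p_torsion_def by blast
  obtain b where b: "H.ord z' = q ^ b" using pH z' H.dominators_torsion[OF f_torsion[OF x]] unfolding p_torsion_def by blast
  have "p ^ a = q ^ b" using z z' a b card by simp
  moreover have "a \<noteq> 0"
  proof
    assume "a = 0"
    then show False using z(2) a two by simp
  qed
  ultimately have "p dvd q ^ b" by (metis dvd_power neq0_conv)
  then show ?thesis using pG pH prime_dvd_power primes_dvd_imp_eq unfolding p_torsion_def by blast
qed

text \<open>
  The dominators of \<open>1\<close> decide if they are finite and there is more than one. If \<open>1\<close> is alone, the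
  dominators of an element of order \<open>p\<close> decide. If they are infinite, they exhaust the torsion
  elements.
\<close>

lemma equal_primes_or_complete:
  assumes nil: "nilpotent G" and pG: "p_torsion G p" and pH: "p_torsion H q"
  shows "torsion G = {\<one>\<^bsub>G\<^esub>} \<or> p = q \<or> (infinite (torsion G) \<and> cyclic_chain G (torsion G))"
proof (cases "torsion G = {\<one>\<^bsub>G\<^esub>}")
  case False
  let ?D = "dominators G \<one>\<^bsub>G\<^esub>"
  have D: "cyclic_chain G ?D" using G.dominators_cyclic_chain(1)[OF pG G.one_torsion] .
  have nD: "nbr G y = torsion G" if "y \<in> ?D" for y
    using that G.nbr_one G.nbr_torsion G.dominators_torsion[OF G.one_torsion] unfolding dominators_def by blast
  have oD: "\<one>\<^bsub>G\<^esub> \<in> ?D" by (simp add: dominators_def)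
  show ?thesis
  proof (cases "finite ?D")
    case fin: True
    show ?thesis
    proof (cases "card ?D = 1")
      case True
      then have D1: "?D = {\<one>\<^bsub>G\<^esub>}" using oD by (metis card_1_singletonE singletonD)
      obtain u where u: "u \<in> torsion G" "u \<noteq> \<one>\<^bsub>G\<^esub>" using False G.one_torsion by blast
      obtain k where k: "G.ord u = p ^ k" using pG u unfolding p_torsion_def by blast
      have "k \<noteq> 0" using k u G.ord_eq_1 G.torsion_carrier by (metis power_0)
      then have "p dvd G.ord u" unfolding k by simp
      then obtain x where x: "x \<in> torsion G" "G.ord x = p" using G.exists_power_of_order[OF u(1)] by metis
      have p1: "p > 1" using pG prime_gt_1_nat unfolding p_torsion_def by blast
      have xc: "x \<in> carrier G" using x G.torsion_carrier by blast
      have x1: "x \<noteq> \<one>\<^bsub>G\<^esub>" using x p1 by auto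
      have "nbr G x \<noteq> torsion G"
      proof
        assume "nbr G x = torsion G"
        then have "x \<in> ?D" using xc G.nbr_one by (simp add: dominators_def)
        then show False using D1 x1 by blast
      qed
      then have fin': "finite (dominators G x)" using G.finite_dominators[OF nil pG x] by blast
      have "\<one>\<^bsub>G\<^esub> \<in> dominators G x" using G.nbr_one G.nbr_torsion x by (simp add: dominators_def)
      moreover have "x \<in> dominators G x" using xc by (simp add: dominators_def)
      ultimately have "card (dominators G x) \<noteq> 1" using x1 by (metis card_1_singletonE singletonD)
      then show ?thesis using equal_primes_of_dominators[OF pG pH x(1) fin'] by blast
    qed (use equal_primes_of_dominators[OF pG pH G.one_torsion fin] in blast)
  next
    case inf: False
    have "torsion G \<subseteq> ?D"
    proof
      fix y assume y: "y \<in> torsion G"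
      obtain k where k: "G.ord y = p ^ k" using pG y unfolding p_torsion_def by blast
      obtain w where w: "w \<in> ?D" "G.ord w = p ^ Suc k" using G.cyclic_chain_infinite[OF pG D inf] .
      have "padj G w y" using nD[OF w(1)] y by (auto simp: nbr_def)
      moreover have "\<not> pow_to G y w"
      proof
        assume "pow_to G y w"
        then have "p ^ Suc k dvd p ^ k" using G.pow_to_ord_dvd y G.torsion_carrier w k by metis
        then show False using pG prime_gt_1_nat unfolding p_torsion_def by (metis Suc_n_not_le_n power_dvd_imp_le)
      qed
      ultimately show "y \<in> ?D" using G.cyclic_chain_down[OF D w(1)] unfolding padj_def by blast
    qed
    then have "torsion G = ?D" using G.dominators_torsion[OF G.one_torsion] by blast
    then show ?thesis using D inf by simp
  qed
qed blast

end

section \<open>The prime is determined by elements of infinite order\<close>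

context group
begin

lemma torsion_chain_central:
  assumes nil: "nilpotent G" and p: "p_torsion G p" and S: "cyclic_chain G (torsion G)" and inf: "infinite (torsion G)"
    and s: "s \<in> torsion G" and t: "t \<in> carrier G"
  shows "s \<otimes> t = t \<otimes> s"
proof -
  have "t \<otimes> r \<otimes> inv t \<in> torsion G" if r: "r \<in> torsion G" for r
  proof -
    have rc: "r \<in> carrier G" using r torsion_carrier by blast
    have "(t \<otimes> r \<otimes> inv t) [^] ord r = \<one>" using conj_nat_pow[OF t rc, of "ord r"] t rc by simp
    then have "ord (t \<otimes> r \<otimes> inv t) dvd ord r" using pow_eq_id t rc by simp
    then show ?thesis using r t rc unfolding in_torsion_iff by auto
  qed
  then show ?thesis using long_chain_centralized[OF nil p S inf t _ s] by simp
qed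

text \<open>
  Uniqueness of roots in torsion-free nilpotent groups, modulo a central torsion subgroup. The
  commutator of \<open>u\<close> and \<open>v\<close> is torsion, hence central, and the \<open>n\<close>-th power of \<open>u\<inverse> v\<close> is
  \<open>u\<^bsup>-n\<^esup> v\<^sup>n = 1\<close> up to a power of this commutator.
\<close>

lemma roots_differ_by_torsion:
  assumes nil: "nilpotent G" and cen: "\<And>t g. t \<in> torsion G \<Longrightarrow> g \<in> carrier G \<Longrightarrow> t \<otimes> g = g \<otimes> t"
    and uv: "u \<in> carrier G" "v \<in> carrier G" and n: "n > 0" "u [^] (n::nat) = v [^] n"
  obtains s where "s \<in> torsion G" "v = u \<otimes> s" "s [^] n = \<one>"
proof -
  let ?w = "inv u" and ?s = "inv u \<otimes> v"
  have wc: "?w \<in> carrier G" "?s \<in> carrier G" using uv by simp_all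
  have "u [^] n \<otimes> v = v \<otimes> u [^] n" unfolding n(2) using nat_pow_comm[of v n 1] uv by simp
  then have c0: "commutator v u \<in> torsion G"
    using root_commutes_imp_torsion_commutator[OF nil cen uv n(1)] commutator_inverse[OF uv] torsion_def
    by (metis (mono_tags, lifting) commutator_closed mem_Collect_eq ord_inv torsion_carrier uv)
  have cc: "commutator v u \<in> carrier G" using uv by simp
  have vu: "v \<otimes> u = commutator v u \<otimes> (u \<otimes> v)" using commutator_swap uv by blast
  have cu: "commutator v u \<otimes> g = g \<otimes> commutator v u" if "g \<in> carrier G" for g using cen[OF c0 that] .
    have vk: "v [^] (k::nat) \<otimes> u = commutator v u [^] k \<otimes> (u \<otimes> v [^] k)" for k
    using commutator_pow_left[OF uv(2,1)] cu[OF uv(2)] by simp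
  have conj: "u \<otimes> v [^] (k::nat) \<otimes> inv u = inv (commutator v u [^] k) \<otimes> v [^] k" for k
  proof -
    have "u \<otimes> v [^] k = inv (commutator v u [^] k) \<otimes> (v [^] k \<otimes> u)"
      using vk[of k] uv cc by (simp add: inv_l_cancel)
    then show ?thesis using uv cc by (simp add: m_assoc)
  qed
  have ex: "\<exists>t::int. u [^] (k::nat) \<otimes> ?s [^] k = commutator v u [^] t \<otimes> v [^] k" for k
  proof (induction k)
    case 0
    then show ?case by (intro exI[of _ 0]) simp
  next
    case (Suc k)
    then obtain t :: int where t: "u [^] k \<otimes> ?s [^] k = commutator v u [^] t \<otimes> v [^] k" by blast
    have ct: "commutator v u [^] t \<otimes> u = u \<otimes> commutator v u [^] t"
    proof -
      have "commutator v u [^] t \<in> torsion G"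
        using torsion_int_pow[OF c0, of t] torsion_pow_toI[OF c0] torsion_pow_to_closed[OF c0] by metis
      then show ?thesis using cen uv by blast
    qed
    have "u [^] Suc k \<otimes> ?s [^] Suc k = u \<otimes> (u [^] k \<otimes> ?s [^] k) \<otimes> ?s"
      using uv wc nat_pow_Suc2[OF uv(1), of k] by (simp add: m_assoc[symmetric])
    also have "\<dots> = u \<otimes> commutator v u [^] t \<otimes> v [^] k \<otimes> inv u \<otimes> v"
      unfolding t using uv cc by (simp add: m_assoc)
    also have "\<dots> = commutator v u [^] t \<otimes> (u \<otimes> v [^] k \<otimes> inv u) \<otimes> v"
      unfolding ct[symmetric] using uv cc by (simp add: m_assoc)
    also have "\<dots> = (commutator v u [^] t \<otimes> inv (commutator v u [^] k)) \<otimes> v [^] Suc k"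
      unfolding conj using uv cc by (simp add: m_assoc)
    also have "commutator v u [^] t \<otimes> inv (commutator v u [^] k) = commutator v u [^] (t - int k)"
      using cc by (simp add: int_pow_diff int_pow_int)
    finally show ?case by blast
  qed
  obtain t :: int where t: "u [^] n \<otimes> ?s [^] n = commutator v u [^] t \<otimes> v [^] n" using ex by blast
  have cT: "commutator v u [^] t \<in> torsion G"
    using torsion_int_pow[OF c0, of t] torsion_pow_toI[OF c0] torsion_pow_to_closed[OF c0] by metis
  have "u [^] n \<otimes> ?s [^] n = u [^] n \<otimes> commutator v u [^] t"
    using t cen[OF cT, of "u [^] n"] n uv by simp
  then have "?s [^] n = commutator v u [^] t" using uv wc cc by simp
  then have "?s [^] int n \<in> torsion G" using cT by (simp add: int_pow_int)
  then have sT: "?s \<in> torsion G" using int_pow_torsion_iff[of ?s "int n"] wc n by simp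
  have v: "v = u \<otimes> ?s" using uv by (simp add: inv_r_cancel)
  have "u [^] n = u [^] n \<otimes> ?s [^] n"
    using pow_mult_distrib[OF cen[OF sT uv(1), symmetric] uv(1) wc(2), of n] v n by simp
  then have "?s [^] n = \<one>" using uv wc by simp
  then show ?thesis using that sT v by blast
qed

text \<open>
  The commutator of \<open>u\<close> and \<open>v\<close> is central with order dividing \<open>m\<close> and \<open>n\<close>, so \<open>u\<close> and \<open>v\<close>
  commute. If \<open>a m + b n = 1\<close>, then \<open>v\<^sup>a u\<^sup>b\<close> is a common root, by Bezout's identity.
\<close>

lemma distinct_prime_powers_common_root:
  assumes nil: "nilpotent G" and cen: "\<And>t g. t \<in> torsion G \<Longrightarrow> g \<in> carrier G \<Longrightarrow> t \<otimes> g = g \<otimes> t"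
    and uv: "u \<in> carrier G" "v \<in> carrier G" and e: "u [^] (m::nat) = v [^] (n::nat)"
    and mn: "m > 0" "n > 0" "coprime m n"
  obtains s where "s \<in> carrier G" "pow_to G s u" "pow_to G s v"
proof -
  have c1: "u [^] m \<otimes> v = v \<otimes> u [^] m" unfolding e using nat_pow_comm[of v n 1] uv by simp
  have c2: "v [^] n \<otimes> u = u \<otimes> v [^] n" unfolding e[symmetric] using nat_pow_comm[of u m 1] uv by simp
  have cT: "commutator u v \<in> torsion G" using root_commutes_imp_torsion_commutator[OF nil cen uv mn(1) c1] .
  have com: "u \<otimes> v = v \<otimes> u"
    using coprime_central_commutator[OF uv cen[OF cT uv(1), symmetric] cen[OF cT uv(2), symmetric] c1 c2 mn(3)] .
  obtain a b :: int where ab: "a * int m + b * int n = 1"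
    using bezout_int[of "int m" "int n"] mn(3) by (auto simp: coprime_iff_gcd_eq_1)
  have eI: "u [^] int m = v [^] int n" using e by (simp add: int_pow_int)
  let ?s = "v [^] a \<otimes> u [^] b"
  have comab: "v [^] a \<otimes> u [^] b = u [^] b \<otimes> v [^] a"
  proof -
    have *: "y [^] (k::int) \<otimes> x = x \<otimes> y [^] k" if "x \<otimes> y = y \<otimes> x" "x \<in> carrier G" "y \<in> carrier G" for x y k
    proof -
      have "x \<otimes> y \<otimes> inv x = y" using that by (simp add: m_assoc)
      then have "x \<otimes> y [^] k \<otimes> inv x = y [^] k" using conj_int_pow[OF that(2,3)] by simp
      then show ?thesis using inv_solve_right'[of "y [^] k" "x \<otimes> y [^] k" x] that by simp
    qed
    show ?thesis using *[OF *[OF com[symmetric] uv(2,1), of b, symmetric, symmetric], of a] uv by simp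
  qed
  have sc: "?s \<in> carrier G" using uv by simp
  have "?s [^] int n = v [^] (a * int n) \<otimes> u [^] (b * int n)"
    using int_pow_mult_distrib[OF comab, of "int n"] uv by (simp add: int_pow_pow)
  also have "v [^] (a * int n) = u [^] (a * int m)"
    using eI uv by (metis int_pow_pow mult.commute)
  also have "u [^] (a * int m) \<otimes> u [^] (b * int n) = u [^] (a * int m + b * int n)"
    using uv by (simp only: int_pow_mult)
  finally have 1: "?s [^] int n = u" using ab uv by simp
  have "?s [^] int m = v [^] (a * int m) \<otimes> u [^] (b * int m)"
    using int_pow_mult_distrib[OF comab, of "int m"] uv by (simp add: int_pow_pow)
  also have "u [^] (b * int m) = v [^] (b * int n)"
    using eI uv by (metis int_pow_pow mult.commute)
  also have "v [^] (a * int m) \<otimes> v [^] (b * int n) = v [^] (a * int m + b * int n)"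
    using uv by (simp only: int_pow_mult)
  finally have 2: "?s [^] int m = v" using ab uv by simp
  show ?thesis
    using that[OF sc] pow_toI[of "int n" ?s] pow_toI[of "int m" ?s] 1 2 mn by simp
qed

end

lemma dir_iso_on_sym:
  assumes "dir_iso_on G C H D"
  shows "dir_iso_on H D G C"
proof -
  obtain g where g: "bij_betw g C D" "\<And>x y. x \<in> C \<Longrightarrow> y \<in> C \<Longrightarrow> pow_to G x y \<longleftrightarrow> pow_to H (g x) (g y)"
    using assms unfolding dir_iso_on_def by blast
  have h: "bij_betw (inv_into C g) D C" using g(1) by (rule bij_betw_inv_into)
  have "pow_to H x y \<longleftrightarrow> pow_to G (inv_into C g x) (inv_into C g y)" if "x \<in> D" "y \<in> D" for x y
    using g(2)[of "inv_into C g x" "inv_into C g y"] that bij_betw_apply[OF h]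
    by (simp add: bij_betw_inv_into_right[OF g(1)])
  then show ?thesis using h unfolding dir_iso_on_def by blast
qed

text \<open>
  The torsion elements form a Pruefer group.
\<close>

definition quasicyclic_torsion :: "('a, 'c) monoid_scheme \<Rightarrow> nat \<Rightarrow> bool" where
  "quasicyclic_torsion G p \<longleftrightarrow> p_torsion G p \<and> infinite (torsion G) \<and> cyclic_chain G (torsion G)"

text \<open>
  For \<open>t\<close> of order \<open>p\<close> the \<open>p\<close> elements \<open>x t\<^sup>i\<close> with \<open>i < p\<close> are roots of \<open>x\<^sup>p\<close>, and no two of
  them have a common root. Their images in \<open>H\<close> are, up to inversion, roots of one element \<open>w\<close> of
  prime degrees, as nothing lies strictly between them and \<open>w\<close>. Roots of different prime degrees
  would have a common root, so there is one degree \<open>r\<close>. Roots of the same degree differ by torsion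
  of exponent \<open>r\<close>. So \<open>r = q\<close>, and there are at most \<open>q\<close> of them.
\<close>

lemma quasicyclic_prime_le:
  assumes "group G" "group H" and nil: "nilpotent G" "nilpotent H"
    and qG: "quasicyclic_torsion G p" and qH: "quasicyclic_torsion H q"
    and C: "inf_class G C" and D: "inf_class H D" and iso: "dir_iso_on G C H D"
  shows "p \<le> q"
proof -
  interpret G: group G by fact
  interpret H: group H by fact
  have pG: "p_torsion G p" "infinite (torsion G)" "cyclic_chain G (torsion G)"
    and pH: "p_torsion H q" "infinite (torsion H)" "cyclic_chain H (torsion H)"
    using qG qH unfolding quasicyclic_torsion_def by blast+
  have pp: "prime p" "prime q" "p > 1" using pG pH prime_gt_1_nat unfolding p_torsion_def by blast+
  note cenG = G.torsion_chain_central[OF nil(1) pG(1,3,2)]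
  note cenH = H.torsion_chain_central[OF nil(2) pH(1,3,2)]
  obtain g where g: "bij_betw g C D" "\<And>x y. x \<in> C \<Longrightarrow> y \<in> C \<Longrightarrow> pow_to G x y \<longleftrightarrow> pow_to H (g x) (g y)"
    using iso unfolding dir_iso_on_def by blast
  have cC: "x \<in> carrier G" "x \<notin> torsion G" if "x \<in> C" for x using that C G.inf_classD by blast+
  have cD: "x \<in> carrier H" "x \<notin> torsion H" if "x \<in> D" for x using that D H.inf_classD by blast+
  have gD: "g x \<in> D" if "x \<in> C" for x using bij_betw_apply[OF g(1) that] .
  have gsurj: "\<exists>x \<in> C. g x = y" if "y \<in> D" for y
    using that bij_betw_imp_surj_on[OF g(1)] by (metis imageE)
  obtain x where x: "x \<in> C" using G.inf_class_nonempty[OF C] by blast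
  obtain t where t: "t \<in> torsion G" "G.ord t = p ^ 1" using G.cyclic_chain_infinite[OF pG(1,3,2)] .
  have tc: "t \<in> carrier G" using t G.torsion_carrier by blast
  have xc: "x \<in> carrier G" using cC x by blast
  define xs where "xs i = x \<otimes>\<^bsub>G\<^esub> t [^]\<^bsub>G\<^esub> (i::nat)" for i
  define z where "z = x [^]\<^bsub>G\<^esub> p"
  have xsc: "xs i \<in> carrier G" for i using xc tc by (simp add: xs_def)
  have z: "z \<in> C" using G.inf_class_pow[OF C x, of "int p"] pp by (simp add: z_def int_pow_int)
  have xsp: "xs i [^]\<^bsub>G\<^esub> p = z" for i
  proof -
    have "t [^]\<^bsub>G\<^esub> i \<in> torsion G" using G.torsion_pow_to_closed[OF t(1) G.torsion_pow_toI[OF t(1)]] .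
    then have "xs i [^]\<^bsub>G\<^esub> p = x [^]\<^bsub>G\<^esub> p \<otimes>\<^bsub>G\<^esub> (t [^]\<^bsub>G\<^esub> i) [^]\<^bsub>G\<^esub> p"
      unfolding xs_def using G.pow_mult_distrib[OF cenG[symmetric] xc, of "t [^]\<^bsub>G\<^esub> i" p] xc tc by simp
    also have "(t [^]\<^bsub>G\<^esub> i) [^]\<^bsub>G\<^esub> p = \<one>\<^bsub>G\<^esub>" using tc t by (simp add: G.nat_pow_pow G.pow_eq_id)
    finally show ?thesis using xc by (simp add: z_def)
  qed
  have xspI: "xs i [^]\<^bsub>G\<^esub> int p = z" for i using xsp by (simp add: int_pow_int)
  have xz: "pow_to G (xs i) z" for i using G.pow_toI[of "int p" "xs i"] pp xspI by simp
  have xsC: "xs i \<in> C" for i using G.inf_class_root[OF C z xsc xz] .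
  have xs_inj: "i = j" if ij: "i < p" "j < p" "xs i = xs j" for i j
  proof -
    have "t [^]\<^bsub>G\<^esub> i = t [^]\<^bsub>G\<^esub> j" using ij(3) xc tc by (simp add: xs_def)
    then show ?thesis using inj_onD[OF G.ord_inj[OF tc], of i j] ij t by auto
  qed
  define w where "w = g z"
  have w: "w \<in> D" using gD z by (simp add: w_def)
  \<comment> \<open>the chosen roots of \<open>z\<close> have no roots in common\<close>
  have noroot: "i = j" if ij: "i < p" "j < p" "s \<in> carrier H" "pow_to H s (g (xs i))" "pow_to H s (g (xs j))" for i j s
  proof -
    have "s \<in> D" using H.inf_class_root[OF D gD[OF xsC] ij(3,4)] .
    then obtain r where r: "r \<in> C" "g r = s" using gsurj by blast
    then have "pow_to G r (xs i)" "pow_to G r (xs j)" using g(2) xsC ij by blast+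
    then obtain a b :: int where ab: "xs i = r [^]\<^bsub>G\<^esub> a" "xs j = r [^]\<^bsub>G\<^esub> b" unfolding pow_to_def by blast
    have "r [^]\<^bsub>G\<^esub> (a * int p) = r [^]\<^bsub>G\<^esub> (b * int p)"
      using xspI[of i] xspI[of j] ab cC[OF r(1)] by (metis G.int_pow_pow)
    then have "a = b" using G.inf_int_pow_eq[OF cC[OF r(1)]] pp by simp
    then show ?thesis using xs_inj ij ab by simp
  qed
  have root: "\<exists>y r. y \<in> D \<and> prime (r::nat) \<and> pow_to H y (g (xs i)) \<and> y [^]\<^bsub>H\<^esub> r = w" for i
  proof -
    let ?y = "g (xs i)"
    have y: "?y \<in> D" using gD xsC by blast
    have "pow_to H ?y w" unfolding w_def using g(2) xsC z xz by blast
    then obtain n :: int where n: "n \<noteq> 0" "w = ?y [^]\<^bsub>H\<^esub> n" unfolding pow_to_def by blast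
    have n1: "\<bar>n\<bar> \<noteq> 1"
    proof
      assume "\<bar>n\<bar> = 1"
      then have "pow_to H w ?y" using H.inf_pow_to_base_iff[OF cD[OF y] n(1)] n(2) by simp
      then have "pow_to G (xs i [^]\<^bsub>G\<^esub> int p) (xs i)" unfolding w_def xspI using g(2) xsC z by blast
      then have "\<bar>int p\<bar> = 1" using G.inf_pow_to_base_iff[OF cC[OF xsC]] pp by simp
      then show False using pp by simp
    qed
    have pr: "prime (nat \<bar>n\<bar>)"
      unfolding prime_nat_iff
    proof (intro conjI allI impI)
      show "1 < nat \<bar>n\<bar>" using n1 n by linarith
      fix m assume m: "m dvd nat \<bar>n\<bar>"
      then have m0: "m \<noteq> 0" using n by (intro notI) simp
      have mn: "int m dvd n" using m int_dvd_int_iff[of m "nat \<bar>n\<bar>"] by simp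
      let ?v = "?y [^]\<^bsub>H\<^esub> int m"
      have v: "?v \<in> D" using H.inf_class_pow[OF D y] m0 by simp
      obtain v0 where v0: "v0 \<in> C" "g v0 = ?v" using gsurj[OF v] by blast
      have "pow_to H ?y ?v" using H.pow_toI m0 by simp
      then have xv: "pow_to G (xs i) v0" using g(2)[OF xsC v0(1)] v0 by simp
      have "pow_to H ?v w" unfolding n(2) using H.inf_pow_to_iff[OF cD[OF y], of "int m" n] m0 n mn by simp
      then have vz: "pow_to G v0 z" using g(2)[OF v0(1) z] v0 unfolding w_def by simp
      obtain c :: int where c: "c \<noteq> 0" "v0 = xs i [^]\<^bsub>G\<^esub> c" using xv unfolding pow_to_def by blast
      have "c dvd int p" using vz unfolding c(2) xspI[of i, symmetric]
        using G.inf_pow_to_iff[OF cC[OF xsC], of c "int p"] c pp by simp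
      then have "nat \<bar>c\<bar> dvd p" by (simp add: nat_abs_dvd_iff)
      then consider "nat \<bar>c\<bar> = 1" | "nat \<bar>c\<bar> = p" using pp(1) prime_nat_iff by blast
      then show "m = 1 \<or> m = nat \<bar>n\<bar>"
      proof cases
        case 1
        then have "pow_to G v0 (xs i)" using c G.inf_pow_to_base_iff[OF cC[OF xsC] c(1)] by simp
        then have "pow_to H ?v ?y" using g(2)[OF v0(1) xsC] v0 by simp
        then have "\<bar>int m\<bar> = 1" using H.inf_pow_to_base_iff[OF cD[OF y]] m0 by simp
        then show ?thesis by simp
      next
        case 2
        then have "int p dvd c" by (metis abs_dvd_iff dvd_abs_iff dvd_refl int_nat_eq abs_ge_zero)
        then have "pow_to G z v0" unfolding c(2) xspI[of i, symmetric]
          using G.inf_pow_to_iff[OF cC[OF xsC], of "int p" c] c pp by simp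
        then have "pow_to H w ?v" using g(2)[OF z v0(1)] v0 unfolding w_def by simp
        then have "n dvd int m" unfolding n(2) using H.inf_pow_to_iff[OF cD[OF y]] n m0 by simp
        then have "nat \<bar>n\<bar> dvd m" by (simp add: nat_abs_dvd_iff)
        then show ?thesis using m dvd_antisym by blast
      qed
    qed
    show ?thesis
    proof (cases "n > 0")
      case True
      then have "?y [^]\<^bsub>H\<^esub> nat \<bar>n\<bar> = w" using n by simp
      then show ?thesis using y pr H.pow_to_refl cD by blast
    next
      case False
      have iy: "pow_to H ?y (inv\<^bsub>H\<^esub> ?y)" "pow_to H (inv\<^bsub>H\<^esub> ?y) ?y"
        using H.pow_to_inv[of ?y] H.pow_to_inv[of "inv\<^bsub>H\<^esub> ?y"] cD[OF y] by simp_all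
      have "(inv\<^bsub>H\<^esub> ?y) [^]\<^bsub>H\<^esub> nat \<bar>n\<bar> = inv\<^bsub>H\<^esub> ?y [^]\<^bsub>H\<^esub> (- n)" using False by simp
      also have "\<dots> = w" using cD[OF y] n by (simp add: H.int_pow_inv H.int_pow_neg)
      finally show ?thesis using pr iy H.inf_class_pow_to[OF D y] by blast
    qed
  qed
  then obtain y r where yr: "\<And>i. y i \<in> D" "\<And>i. prime (r i)" "\<And>i. pow_to H (y i) (g (xs i))" "\<And>i. y i [^]\<^bsub>H\<^esub> (r i :: nat) = w"
    by metis
  \<comment> \<open>the degrees agree, as roots of distinct prime degrees would have a common root\<close>
  have same: "r i = r 0" if i: "i < p" for i
  proof (rule ccontr)
    assume ne: "r i \<noteq> r 0"
    then have "i \<noteq> 0" by metis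
    have "coprime (r i) (r 0)" using ne yr(2) primes_coprime by blast
    then obtain s where s: "s \<in> carrier H" "pow_to H s (y i)" "pow_to H s (y 0)"
      using H.distinct_prime_powers_common_root[OF nil(2) cenH, of "y i" "y 0" "r i" "r 0"] yr cD prime_gt_0_nat
      by metis
    then have "pow_to H s (g (xs i))" "pow_to H s (g (xs 0))" using yr(3) H.pow_to_trans by blast+
    then show False using noroot[OF i _ s(1)] pp \<open>i \<noteq> 0\<close> by simp
  qed
  have "\<exists>s. s \<in> torsion H \<and> y i = y 0 \<otimes>\<^bsub>H\<^esub> s \<and> s [^]\<^bsub>H\<^esub> r 0 = \<one>\<^bsub>H\<^esub>" if "i < p" for i
    using H.roots_differ_by_torsion[OF nil(2) cenH, of "y 0" "y i" "r 0"] yr(4)[of i] yr(4)[of 0] same[OF that]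
      cD yr(1) prime_gt_0_nat[OF yr(2)] by metis
  then obtain s where s: "\<And>i. i < p \<Longrightarrow> s i \<in> torsion H" "\<And>i. i < p \<Longrightarrow> y i = y 0 \<otimes>\<^bsub>H\<^esub> s i"
    "\<And>i. i < p \<Longrightarrow> s i [^]\<^bsub>H\<^esub> r 0 = \<one>\<^bsub>H\<^esub>" by metis
  have s_inj: "inj_on s {..<p}"
  proof (rule inj_onI)
    fix i j assume ij: "i \<in> {..<p}" "j \<in> {..<p}" "s i = s j"
    then have "y i = y j" using s(2)[of i] s(2)[of j] by simp
    then have "pow_to H (y i) (g (xs j))" using yr(3)[of j] by simp
    then show "i = j" using noroot[OF _ _ _ yr(3)[of i]] ij cD[OF yr(1)] by simp
  qed
  have "r 0 = q"
  proof -
    have "s 0 \<noteq> s 1" using inj_onD[OF s_inj, of 0 1] pp by auto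
    then obtain i where i: "i < p" "s i \<noteq> \<one>\<^bsub>H\<^esub>" using pp(3) by (metis less_trans zero_less_one)
    have sc: "s i \<in> carrier H" using s(1)[OF i(1)] H.torsion_carrier by blast
    have d: "H.ord (s i) dvd r 0" using s(3)[OF i(1)] H.pow_eq_id sc by blast
    obtain k where k: "H.ord (s i) = q ^ k" using pH(1) s(1)[OF i(1)] unfolding p_torsion_def by blast
    have "k \<noteq> 0" using k i(2) H.ord_eq_1[OF sc] by (metis power_0)
    then have "q dvd r 0" using d k by (metis dvd_power dvd_trans neq0_conv)
    then show ?thesis using primes_dvd_imp_eq[OF pp(2) yr(2)[of 0]] by simp
  qed
  obtain v where v: "v \<in> torsion H" "H.ord v = q ^ 1" using H.cyclic_chain_infinite[OF pH(1,3,2)] .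
  have "s ` {..<p} \<subseteq> powers H v"
  proof safe
    fix i assume i: "i < p"
    have "H.ord (s i) dvd q" using s(3)[OF i] H.pow_eq_id H.torsion_carrier[OF s(1)[OF i]] \<open>r 0 = q\<close> by simp
    then have "H.ord (s i) \<le> H.ord v" using v pp(2) prime_gt_0_nat by (simp add: dvd_imp_le)
    then show "s i \<in> powers H v" using H.cyclic_chain_ord_le[OF pH(3) v(1) s(1)[OF i]] by (simp add: powers_def)
  qed
  then have "card (s ` {..<p}) \<le> card (powers H v)" using card_mono H.finite_powers[OF v(1)] by blast
  then show ?thesis using card_image[OF s_inj] H.card_powers[OF v(1)] v(2) by simp
qed

section \<open>Pruefer groups as groups of roots of unity\<close>

definition unity_root :: "nat \<Rightarrow> complex" where
  "unity_root n = cis (2 * pi / real n)"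

lemma unity_root_pow: "unity_root n ^ k = cis (2 * pi * real k / real n)"
  by (simp add: unity_root_def DeMoivre mult_ac)

lemma unity_root_self: "n > 0 \<Longrightarrow> unity_root n ^ n = 1"
  by (simp add: unity_root_pow cis_2pi)

lemma unity_root_pow_mod:
  assumes "n > 0"
  shows "unity_root n ^ k = unity_root n ^ (k mod n)"
proof -
  have "unity_root n ^ k = unity_root n ^ (n * (k div n) + k mod n)" by simp
  also have "\<dots> = unity_root n ^ (k mod n)"
    using unity_root_self[OF assms] by (simp only: power_add power_mult) simp
  finally show ?thesis .
qed

lemma unity_root_pow_eq_iff:
  assumes "n > 0"
  shows "unity_root n ^ i = unity_root n ^ j \<longleftrightarrow> i mod n = j mod n"
proof
  assume "unity_root n ^ i = unity_root n ^ j"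
  then have "unity_root n ^ (i mod n) = unity_root n ^ (j mod n)"
    using unity_root_pow_mod[OF assms] by simp
  moreover have "inj_on (\<lambda>k. unity_root n ^ k) {..<n}"
    using bij_betw_imp_inj_on[OF bij_betw_roots_unity[OF assms]] by (simp add: unity_root_pow)
  ultimately show "i mod n = j mod n" using assms by (auto dest: inj_onD)
qed (use unity_root_pow_mod[OF assms] in metis)

lemma unity_root_surj:
  assumes "n > 0" "z ^ n = 1"
  obtains k where "z = unity_root n ^ k"
proof -
  have "z \<in> (\<lambda>k. cis (2 * pi * real k / real n)) ` {..<n}"
    unfolding bij_betw_imp_surj_on[OF bij_betw_roots_unity[OF assms(1)]] using assms(2) by simp
  then show ?thesis using that by (auto simp: unity_root_pow)
qed

lemma unity_root_mult: "m > 0 \<Longrightarrow> unity_root (n * m) ^ m = unity_root n"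
  by (simp add: unity_root_pow) (simp add: unity_root_def)

context group
begin

lemma torsion_pow_eq_iff:
  assumes "x \<in> torsion G"
  shows "x [^] (i::nat) = x [^] j \<longleftrightarrow> i mod ord x = j mod ord x"
proof -
  have "x [^] i = x [^] j \<longleftrightarrow> int (ord x) dvd int j - int i"
    using int_pow_eq[OF torsion_carrier[OF assms], of "int i" "int j"] by (simp add: int_pow_int)
  also have "\<dots> \<longleftrightarrow> int i mod int (ord x) = int j mod int (ord x)"
    by (metis mod_eq_dvd_iff)
  finally show ?thesis by (simp flip: of_nat_mod)
qed

lemma quasicyclic_root_sequence:
  assumes q: "quasicyclic_torsion G p"
  obtains r :: "nat \<Rightarrow> 'a" where "\<And>k. r k \<in> torsion G" "\<And>k. ord (r k) = p ^ k" "\<And>k. r (Suc k) [^] p = r k"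
proof -
  have p: "p_torsion G p" "cyclic_chain G (torsion G)" "infinite (torsion G)"
    using q unfolding quasicyclic_torsion_def by blast+
  have pp: "prime p" "p > 1" using p prime_gt_1_nat unfolding p_torsion_def by blast+
  have step: "\<exists>y. (y \<in> torsion G \<and> ord y = p ^ Suc n) \<and> y [^] p = x" if x: "x \<in> torsion G \<and> ord x = p ^ n" for x n
  proof -
    obtain w where w: "w \<in> torsion G" "ord w = p ^ Suc n" using cyclic_chain_infinite[OF p] .
    have wc: "w \<in> carrier G" using w torsion_carrier by blast
    show ?thesis
    proof (cases "n = 0")
      case True
      then have "x = \<one>" using x ord_eq_1[of x] torsion_carrier[of x] by simp
      moreover have "w [^] p = \<one>" using w True wc pow_eq_id by simp
      ultimately show ?thesis using w by blast
    next
      case False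
      have wp: "pow_to G w (w [^] p)" using torsion_pow_toI[OF w(1)] .
      have "ord (w [^] p) = p ^ n" using w pp wc by (subst ord_pow) simp_all
      moreover have "pow_to G w x"
        using cyclic_chain_ord_le[OF p(2) w(1)] x w(2) pp by simp
      ultimately have "pow_to G (w [^] p) x" using cyclic_pow_to[OF w(1) _ wp] x by simp
      then obtain l :: nat where l: "x = (w [^] p) [^] l"
        using torsion_pow_to_iff torsion_pow_to_closed[OF w(1) wp] by blast
      let ?y = "w [^] l"
      have yp: "?y [^] p = x" using l wc by (simp add: nat_pow_pow mult.commute)
      have yT: "?y \<in> torsion G" using torsion_pow_to_closed[OF w(1) torsion_pow_toI[OF w(1)]] .
      obtain j where j: "ord ?y = p ^ j" using p(1) yT unfolding p_torsion_def by blast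
      have yc: "?y \<in> carrier G" using wc by simp
      have "j \<noteq> 0"
      proof
        assume "j = 0"
        then have "?y = \<one>" using j ord_eq_1[OF yc] by simp
        then have "x = \<one>" using yp by simp
        then show False using x False one_less_power[OF pp(2), of n] by simp
      qed
      then obtain i where i: "j = Suc i" using not0_implies_Suc by blast
      have "ord (?y [^] p) = p ^ i" using j i pp yc by (subst ord_pow) simp_all
      then have "p ^ i = p ^ n" using yp x by simp
      then have "i = n" using pp by simp
      then show ?thesis using yp yT j i by blast
    qed
  qed
  have "\<exists>r. \<forall>n. (r n \<in> torsion G \<and> ord (r n) = p ^ n) \<and> r (Suc n) [^] p = r n"
    using dependent_nat_choice[of "\<lambda>n x. x \<in> torsion G \<and> ord x = p ^ n" "\<lambda>n x y. y [^] p = x"] one_torsion step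
    by (metis ord_id power_0)
  then show ?thesis using that by blast
qed

text \<open>
  The isomorphism sends powers of the \<open>k\<close>-th generator to powers of the \<open>p\<^sup>k\<close>-th root of unity.
  Any two elements are powers of one common generator, which reduces all claims to a single finite
  cyclic group.
\<close>

lemma quasicyclic_is_pruefer:
  assumes q: "quasicyclic_torsion G p" and all: "torsion G = carrier G"
  shows "is_pruefer G"
proof -
  have p: "p_torsion G p" "cyclic_chain G (torsion G)" "infinite (torsion G)"
    using q unfolding quasicyclic_torsion_def by blast+
  have pp: "prime p" "p > 1" using p prime_gt_1_nat unfolding p_torsion_def by blast+
  have p0: "p ^ k > 0" for k using pp by simp
  obtain r where r: "\<And>k. r k \<in> torsion G" "\<And>k. ord (r k) = p ^ k" "\<And>k. r (Suc k) [^] p = r k"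
    using quasicyclic_root_sequence[OF q] by blast
  have rc: "r k \<in> carrier G" for k using r torsion_carrier by blast
  let ?u = "\<lambda>k. unity_root (p ^ k)"
  have lift_r: "r k = r (k + d) [^] (p ^ d)" for k d
  proof (induction d)
    case (Suc d)
    have "r (k + Suc d) [^] (p ^ Suc d) = (r (Suc (k + d)) [^] p) [^] (p ^ d)"
      using rc by (simp add: nat_pow_pow)
    then show ?case using Suc r(3) by simp
  qed (use rc in simp)
  have lift_u: "?u k = ?u (k + d) ^ (p ^ d)" for k d
    using unity_root_mult[of "p ^ d" "p ^ k"] p0 by (simp add: power_add)
  have lift: "\<exists>i'. r k [^] i = r m [^] i' \<and> ?u k ^ i = ?u m ^ i'" if "k \<le> m" for k m i :: nat
  proof -
    have m: "m = k + (m - k)" using that by simp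
    have "r k [^] i = r m [^] (p ^ (m - k) * i)"
      using lift_r[of k "m - k"] m rc by (simp add: nat_pow_pow)
    moreover have "?u k ^ i = ?u m ^ (p ^ (m - k) * i)"
      using lift_u[of k "m - k"] m by (simp add: power_mult)
    ultimately show ?thesis by blast
  qed
  have eq: "r m [^] i = r m [^] j \<longleftrightarrow> ?u m ^ i = ?u m ^ j" for m i j :: nat
    using torsion_pow_eq_iff[OF r(1)] unity_root_pow_eq_iff[OF p0] r(2) by simp
  have wd: "?u k ^ i = ?u l ^ j \<longleftrightarrow> r k [^] i = r l [^] j" for k l i j :: nat
  proof -
    obtain i' where i': "r k [^] i = r (max k l) [^] i'" "?u k ^ i = ?u (max k l) ^ i'"
      using lift[OF max.cobounded1[of k l], of i] by blast
    obtain j' where j': "r l [^] j = r (max k l) [^] j'" "?u l ^ j = ?u (max k l) ^ j'"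
      using lift[OF max.cobounded2[of l k], of j] by blast
    show ?thesis unfolding i' j' eq ..
  qed
  have cover: "\<exists>k i. x = r k [^] (i::nat)" if x: "x \<in> carrier G" for x
  proof -
    have xT: "x \<in> torsion G" using x all by simp
    obtain k where k: "ord x = p ^ k" using p(1) xT unfolding p_torsion_def by blast
    then have "pow_to G (r k) x" using cyclic_chain_ord_le[OF p(2) r(1) xT] r(2) by simp
    then show ?thesis using torsion_pow_to_iff[OF r(1)] by blast
  qed
  define h where "h x = (SOME c. \<exists>k i. x = r k [^] (i::nat) \<and> c = ?u k ^ i)" for x
  have h: "h (r k [^] i) = ?u k ^ i" for k i :: nat
    unfolding h_def
  proof (rule some_equality)
    show "\<exists>k' i'. r k [^] i = r k' [^] i' \<and> ?u k ^ i = ?u k' ^ i'" by (rule exI[of _ k], rule exI[of _ i]) simp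
    fix c assume "\<exists>k' i'. r k [^] i = r k' [^] i' \<and> c = ?u k' ^ i'"
    then obtain k' i' where "r k [^] i = r k' [^] i'" and c: "c = ?u k' ^ i'" by (elim exE conjE)
    then have "?u k ^ i = ?u k' ^ i'" using wd[of k i k' i'] by simp
    then show "c = ?u k ^ i" using c by simp
  qed
  have in_pr: "?u k ^ i \<in> carrier (pruefer p)" for k i :: nat
  proof -
    have "(?u k ^ i) ^ (p ^ k) = 1"
      using unity_root_self[OF p0, of k] by (metis power_commutes power_mult mult.commute power_one)
    then show ?thesis by (auto simp: pruefer_def)
  qed
  have "h \<in> hom G (pruefer p)"
  proof (rule homI)
    fix x assume "x \<in> carrier G"
    then obtain k i where "x = r k [^] (i::nat)" using cover by blast
    then show "h x \<in> carrier (pruefer p)" using h in_pr by simp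
  next
    fix x y assume xy: "x \<in> carrier G" "y \<in> carrier G"
    obtain k i l j where kl: "x = r k [^] (i::nat)" "y = r l [^] (j::nat)" using cover[OF xy(1)] cover[OF xy(2)] by blast
    obtain i' :: nat where i': "r k [^] i = r (max k l) [^] i'" using lift[OF max.cobounded1[of k l], of i] by blast
    obtain j' :: nat where j': "r l [^] j = r (max k l) [^] j'" using lift[OF max.cobounded2[of l k], of j] by blast
    have "h (x \<otimes> y) = h (r (max k l) [^] (i' + j'))" unfolding kl i' j' using rc by (simp add: nat_pow_mult)
    also have "\<dots> = h x * h y" unfolding kl i' j' h by (rule power_add)
    finally show "h (x \<otimes> y) = h x \<otimes>\<^bsub>pruefer p\<^esub> h y" by (simp add: pruefer_def)
  qed
  moreover have "bij_betw h (carrier G) (carrier (pruefer p))"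
    unfolding bij_betw_def
  proof
    show "inj_on h (carrier G)"
    proof (rule inj_onI)
      fix x y assume xy: "x \<in> carrier G" "y \<in> carrier G" "h x = h y"
      obtain k i l j where kl: "x = r k [^] (i::nat)" "y = r l [^] (j::nat)" using cover[OF xy(1)] cover[OF xy(2)] by blast
      then show "x = y" using xy(3) h wd by simp
    qed
    show "h ` carrier G = carrier (pruefer p)"
    proof
      show "h ` carrier G \<subseteq> carrier (pruefer p)" using cover h in_pr by force
      show "carrier (pruefer p) \<subseteq> h ` carrier G"
      proof
        fix z assume "z \<in> carrier (pruefer p)"
        then obtain k where "z ^ (p ^ k) = 1" by (auto simp: pruefer_def)
        then obtain i where "z = ?u k ^ i" using unity_root_surj[OF p0] by blast
        then have "z = h (r k [^] i)" using h by simp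
        then show "z \<in> h ` carrier G" using rc by blast
      qed
    qed
  qed
  ultimately have "G \<cong> pruefer p" by (auto simp: is_iso_def iso_def)
  then show ?thesis using pp unfolding is_pruefer_def by blast
qed

end

section \<open>Preservation of torsion\<close>

context power_graph_iso
begin

text \<open>
  An element of infinite order shares its closed neighbourhood only with itself and its inverse.
\<close>

lemma twin_image_inverse:
  assumes ab: "a \<in> torsion G" "b \<in> torsion G" and n1: "f \<one>\<^bsub>G\<^esub> \<notin> torsion H" and tw: "nbr G a = nbr G b"
  shows "f b = f a \<or> f b = inv\<^bsub>H\<^esub> (f a)"
proof -
  have c: "a \<in> carrier G" "b \<in> carrier G" using ab G.torsion_carrier by blast+
  have fa: "f a \<in> carrier H" "f a \<notin> torsion H"
    using f_closed[OF c(1)] n1 f_commens[OF G.one_closed c(1)] G.torsion_commens[OF G.one_torsion ab(1)]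
      H.commens_torsion f_closed[OF G.one_closed] by blast+
  have cl: "inf_class H (commens_class H (f a))" using fa unfolding inf_class_def by blast
  have mem: "f a \<in> commens_class H (f a)" "f b \<in> commens_class H (f a)"
    using fa H.commens_refl f_closed[OF c(2)] f_commens[OF c] G.torsion_commens[OF ab] by (auto simp: commens_class_def)
  have "nbr H (f a) = nbr H (f b)" using f_nbr_eq_iff[OF c] tw by blast
  then have N: "padj H (f a) w \<longleftrightarrow> padj H (f b) w" if "w \<in> commens_class H (f a)" for w
    using that by (auto simp: nbr_def commens_class_def set_eq_iff)
  have "pow_to H (f a) (f b)" "pow_to H (f b) (f a)"
    using H.inf_twin_pow_to[OF cl mem N] H.inf_twin_pow_to[OF cl mem(2,1)] N by blast+
  then show ?thesis using H.inf_mutual_pow[OF fa] by blast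
qed

text \<open>
  Otherwise \<open>d = f 1\<close> has infinite order, is adjacent to its whole class, and twin classes in the
  image of the torsion elements have two elements each. So the twin \<open>t\<close> of \<open>1\<close> is an involution,
  every nontrivial torsion element is a root of \<open>t\<close>, and all torsion elements other than \<open>1\<close> and
  \<open>t\<close> have order \<open>4\<close>. Then adjacent ones are twins, in contrast to \<open>d\<^sup>2\<close> and \<open>d\<^sup>4\<close>.
\<close>

lemma f_one_torsion: "f \<one>\<^bsub>G\<^esub> \<in> torsion H"
proof (rule ccontr)
  define d where "d = f \<one>\<^bsub>G\<^esub>"
  assume n1: "f \<one>\<^bsub>G\<^esub> \<notin> torsion H"
  then have dT: "d \<notin> torsion H" and dc: "d \<in> carrier H" using f_closed by (simp_all add: d_def)
  have img: "commens_class H d = f ` torsion G"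
    unfolding d_def using f_commens_class[OF G.one_closed] G.commens_class_torsion[OF G.one_torsion] by simp
  have powT: "\<exists>a \<in> torsion G. f a = d [^]\<^bsub>H\<^esub> n" if "n \<noteq> 0" for n :: int
  proof -
    have "d [^]\<^bsub>H\<^esub> n \<in> commens_class H d"
      using dc H.pow_to_commens[OF H.pow_toI[OF that]] by (simp add: commens_class_def)
    then show ?thesis unfolding img by (metis imageE)
  qed
  note inj_d = H.inf_int_pow_eq[OF dc dT]
  have d1: "d [^]\<^bsub>H\<^esub> (1::int) = d" "d [^]\<^bsub>H\<^esub> (- 1::int) = inv\<^bsub>H\<^esub> d" using dc by (simp_all add: H.int_pow_neg)
  have tcar: "x \<in> carrier G" if "x \<in> torsion G" for x using that G.torsion_carrier by blast
  obtain t where t: "t \<in> torsion G" "f t = inv\<^bsub>H\<^esub> d" using powT[of "- 1"] d1 by auto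
  have t1: "t \<noteq> \<one>\<^bsub>G\<^esub>"
  proof
    assume "t = \<one>\<^bsub>G\<^esub>"
    then have "d [^]\<^bsub>H\<^esub> (1::int) = d [^]\<^bsub>H\<^esub> (- 1::int)" using t d1 by (simp add: d_def)
    then show False using inj_d by simp
  qed
  have "nbr H (inv\<^bsub>H\<^esub> d) = nbr H d"
    using H.same_powers_nbr[of "inv\<^bsub>H\<^esub> d" d] H.pow_to_inv[of d] H.pow_to_inv[of "inv\<^bsub>H\<^esub> d"] dc by simp
  then have nt: "nbr G t = torsion G"
    using f_nbr_eq_iff[OF tcar[OF t(1)] G.one_closed] t G.nbr_one unfolding d_def by simp
  have same_inv: "nbr G (inv\<^bsub>G\<^esub> a) = nbr G a" "inv\<^bsub>G\<^esub> a \<in> torsion G" if a: "a \<in> torsion G" for a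
  proof -
    have i: "pow_to G a (inv\<^bsub>G\<^esub> a)" "pow_to G (inv\<^bsub>G\<^esub> a) a"
      using G.pow_to_inv[of a] G.pow_to_inv[of "inv\<^bsub>G\<^esub> a"] tcar[OF a] by simp_all
    then show "nbr G (inv\<^bsub>G\<^esub> a) = nbr G a" using G.same_powers_nbr tcar[OF a] by simp
    show "inv\<^bsub>G\<^esub> a \<in> torsion G" using G.torsion_pow_to_closed[OF a i(1)] .
  qed
  have "f (inv\<^bsub>G\<^esub> t) = d \<or> f (inv\<^bsub>G\<^esub> t) = inv\<^bsub>H\<^esub> d"
    using twin_image_inverse[OF G.one_torsion same_inv(2)[OF t(1)] n1] same_inv(1)[OF t(1)] nt G.nbr_one
    unfolding d_def by simp
  then have "inv\<^bsub>G\<^esub> t = \<one>\<^bsub>G\<^esub> \<or> inv\<^bsub>G\<^esub> t = t"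
    using f_inj[OF tcar[OF same_inv(2)[OF t(1)]]] tcar[OF t(1)] t(2) unfolding d_def by (metis G.one_closed)
  then have it: "inv\<^bsub>G\<^esub> t = t" using t1 tcar[OF t(1)] by (metis G.inv_inv G.inv_one)
  have inv_iff: "inv\<^bsub>G\<^esub> a = a \<longleftrightarrow> G.ord a dvd 2" if a: "a \<in> carrier G" for a
  proof -
    have "inv\<^bsub>G\<^esub> a = a \<longleftrightarrow> a \<otimes>\<^bsub>G\<^esub> a = \<one>\<^bsub>G\<^esub>" using a by (metis G.inv_equality G.r_inv)
    also have "\<dots> \<longleftrightarrow> a [^]\<^bsub>G\<^esub> (2::nat) = \<one>\<^bsub>G\<^esub>" using a by (simp add: numeral_2_eq_2)
    finally show ?thesis using G.pow_eq_id[OF a] by simp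
  qed
  have ord2: "G.ord a = 2" if a: "a \<in> carrier G" "a \<noteq> \<one>\<^bsub>G\<^esub>" "G.ord a dvd 2" for a
  proof -
    have "G.ord a = 1 \<or> G.ord a = 2" using a(3) two_is_prime_nat prime_nat_iff by blast
    then show ?thesis using a G.ord_eq_1 by blast
  qed
  have ot: "G.ord t = 2" using ord2 t1 inv_iff it tcar[OF t(1)] by blast
  have to_t: "pow_to G w t" if w: "w \<in> torsion G" "w \<noteq> \<one>\<^bsub>G\<^esub>" for w
  proof -
    have wc: "w \<in> carrier G" using tcar w by blast
    have "padj G t w" using w nt by (auto simp: nbr_def)
    moreover have "pow_to G w t" if tw: "pow_to G t w"
    proof -
      have "G.ord w = 2" using ord2[OF wc w(2)] G.pow_to_ord_dvd[OF tcar[OF t(1)] tw] ot by simp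
      then show ?thesis using G.cyclic_pow_to[OF t(1) G.pow_to_refl[OF tcar[OF t(1)]] tw] ot by simp
    qed
    ultimately show ?thesis unfolding padj_def by blast
  qed
  have ord4: "G.ord a = 4" if a: "a \<in> torsion G" "a \<noteq> \<one>\<^bsub>G\<^esub>" "a \<noteq> t" for a
  proof -
    have ac: "a \<in> carrier G" using tcar a by blast
    have "\<exists>k. G.ord a = 2 ^ k"
    proof (rule ccontr)
      assume "\<not> ?thesis"
      then obtain q where q: "prime q" "q \<noteq> 2" "q dvd G.ord a"
        using not_primepow_obtain_prime[of "G.ord a" 2] a G.in_torsion_iff two_is_prime_nat by metis
      obtain v where v: "v \<in> torsion G" "G.ord v = q" using G.exists_power_of_order[OF a(1) q(3)] by metis
      have "v \<noteq> \<one>\<^bsub>G\<^esub>" using v q by auto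
      then have "2 dvd q" using G.pow_to_ord_dvd[OF tcar[OF v(1)] to_t[OF v(1)]] v ot by simp
      then show False using q primes_dvd_imp_eq two_is_prime_nat by blast
    qed
    then obtain k where k: "G.ord a = 2 ^ k" by blast
    have n2: "\<not> G.ord a dvd 2"
    proof
      assume "G.ord a dvd 2"
      then have "G.ord a = 2" using ord2[OF ac a(2)] by blast
      then have "pow_to G t a" using G.cyclic_pow_to[OF a(1) G.pow_to_refl[OF ac] to_t[OF a(1,2)]] ot by simp
      then obtain j :: nat where j: "a = t [^]\<^bsub>G\<^esub> j" using G.torsion_pow_to_iff[OF t(1)] by blast
      have "t [^]\<^bsub>G\<^esub> j = t [^]\<^bsub>G\<^esub> (j mod 2)" using G.torsion_pow_eq_iff[OF t(1)] ot by simp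
      moreover have "j mod 2 = 0 \<or> j mod 2 = 1" by linarith
      ultimately show False using j a tcar[OF t(1)] by auto
    qed
    \<comment> \<open>\<open>a\<close>, its inverse and its cube are twins, so two of them coincide\<close>
    have a3: "pow_to G (a [^]\<^bsub>G\<^esub> (3::nat)) a"
      by (rule G.coprime_pow_to[OF a(1)]) (simp add: k)
    have a3T: "pow_to G a (a [^]\<^bsub>G\<^esub> (3::nat))" using G.torsion_pow_toI[OF a(1)] .
    have tw3: "nbr G a = nbr G (a [^]\<^bsub>G\<^esub> (3::nat))" using G.same_powers_nbr[OF ac _ a3T a3] ac by simp
    have f3: "f (a [^]\<^bsub>G\<^esub> (3::nat)) = f a \<or> f (a [^]\<^bsub>G\<^esub> (3::nat)) = inv\<^bsub>H\<^esub> (f a)"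
      using twin_image_inverse[OF a(1) G.torsion_pow_to_closed[OF a(1) a3T] n1 tw3] .
    have "f (inv\<^bsub>G\<^esub> a) = f a \<or> f (inv\<^bsub>G\<^esub> a) = inv\<^bsub>H\<^esub> (f a)"
      using twin_image_inverse[OF a(1) same_inv(2)[OF a(1)] n1 same_inv(1)[OF a(1), symmetric]] .
    moreover have "f (inv\<^bsub>G\<^esub> a) \<noteq> f a" using f_inj ac inv_iff n2 by simp
    ultimately have fi: "f (inv\<^bsub>G\<^esub> a) = inv\<^bsub>H\<^esub> (f a)" by blast
    have "a [^]\<^bsub>G\<^esub> (3::nat) = a \<or> a [^]\<^bsub>G\<^esub> (3::nat) = inv\<^bsub>G\<^esub> a"
      using f3 fi f_inj[of "a [^]\<^bsub>G\<^esub> (3::nat)" a] f_inj[of "a [^]\<^bsub>G\<^esub> (3::nat)" "inv\<^bsub>G\<^esub> a"] ac by auto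
    then have "a [^]\<^bsub>G\<^esub> (2::nat) = \<one>\<^bsub>G\<^esub> \<or> a [^]\<^bsub>G\<^esub> (4::nat) = \<one>\<^bsub>G\<^esub>"
    proof
      assume "a [^]\<^bsub>G\<^esub> (3::nat) = a"
      then have "a [^]\<^bsub>G\<^esub> (2::nat) \<otimes>\<^bsub>G\<^esub> a = a" using ac by (simp add: eval_nat_numeral)
      then show ?thesis using ac by simp
    next
      assume "a [^]\<^bsub>G\<^esub> (3::nat) = inv\<^bsub>G\<^esub> a"
      moreover have "a [^]\<^bsub>G\<^esub> (4::nat) = a [^]\<^bsub>G\<^esub> (3::nat) \<otimes>\<^bsub>G\<^esub> a" by (simp add: eval_nat_numeral)
      ultimately show ?thesis using ac by simp
    qed
    then have "G.ord a dvd 4" using n2 G.pow_eq_id[OF ac] by blast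
    then have "2 ^ k dvd (2::nat) ^ 2" using k by simp
    then have "k \<le> 2" by (rule power_dvd_imp_le) simp
    moreover have "\<not> k \<le> 1"
    proof
      assume "k \<le> 1"
      then have "k = 0 \<or> k = 1" by linarith
      then show False using n2 k by auto
    qed
    ultimately have "k = 2" by linarith
    then show ?thesis using k by simp
  qed
  obtain a where a: "a \<in> torsion G" "f a = d [^]\<^bsub>H\<^esub> (2::int)" using powT[of 2] by auto
  obtain b where b: "b \<in> torsion G" "f b = d [^]\<^bsub>H\<^esub> (4::int)" using powT[of 4] by auto
  have ab1: "a \<noteq> \<one>\<^bsub>G\<^esub>" "a \<noteq> t" "b \<noteq> \<one>\<^bsub>G\<^esub>" "b \<noteq> t"
    using a b t(2) inj_d[of 1] inj_d[of "- 1"] d1 unfolding d_def[symmetric]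
    by (metis d_def one_eq_numeral_iff numeral_eq_one_iff semiring_norm(83,85,88,89) one_neq_neg_numeral neg_one_neq_numeral numeral_neq_neg_one)+
  have o: "G.ord a = 4" "G.ord b = 4" using ord4 a b ab1 by blast+
  have "padj H (f a) (f b)"
    unfolding a(2) b(2) using H.inf_padj_iff[OF dc dT, of 2 4] by simp
  then have "padj G a b" using adj tcar a b by blast
  then have "pow_to G a b \<and> pow_to G b a"
    unfolding padj_def using G.cyclic_pow_to[OF a(1) G.pow_to_refl[OF tcar[OF a(1)]], of b]
      G.cyclic_pow_to[OF b(1) G.pow_to_refl[OF tcar[OF b(1)]], of a] o by auto
  then have "nbr G a = nbr G b" using G.same_powers_nbr tcar a(1) b(1) by blast
  then have "f b = f a \<or> f b = inv\<^bsub>H\<^esub> (f a)" using twin_image_inverse[OF a(1) b(1) n1] by blast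
  then have "d [^]\<^bsub>H\<^esub> (4::int) = d [^]\<^bsub>H\<^esub> (2::int) \<or> d [^]\<^bsub>H\<^esub> (4::int) = d [^]\<^bsub>H\<^esub> (- 2::int)"
    unfolding a(2) b(2) using dc by (simp add: H.int_pow_neg)
  then show False unfolding inj_d by simp
qed

lemma torsion_image: "f ` torsion G = torsion H"
  using f_commens_class[OF G.one_closed] G.commens_class_torsion[OF G.one_torsion]
    H.commens_class_torsion[OF f_one_torsion] by simp

lemma to_torsion_preserving: "torsion_preserving_iso G H f"
  using torsion_image power_graph_iso_axioms
  by (simp add: torsion_preserving_iso_def torsion_preserving_iso_axioms_def)

lemma nontorsion_class_dir_iso:
  assumes x: "x \<in> carrier G" "x \<notin> torsion G"
  shows "inf_class G (commens_class G x)" "inf_class H (commens_class H (f x))"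
    "dir_iso_on G (commens_class G x) H (commens_class H (f x))"
proof -
  interpret torsion_preserving_iso G H f by (rule to_torsion_preserving)
  show C: "inf_class G (commens_class G x)" using x unfolding inf_class_def by blast
  show D: "inf_class H (commens_class H (f x))"
    using f_closed[OF x(1)] f_torsion_iff[OF x(1)] x(2) unfolding inf_class_def by blast
  have sub: "commens_class G x \<subseteq> carrier G" by (auto simp: commens_class_def)
  show "dir_iso_on G (commens_class G x) H (commens_class H (f x))"
  proof (rule inf_class_dir_iso[OF G.is_group H.is_group C D])
    show "bij_betw f (commens_class G x) (commens_class H (f x))"
      using bij_betw_subset[OF bij sub] f_commens_class[OF x(1)] by simp
  qed (use adj sub in blast)
qed

end

section \<open>Assembling the directed isomorphism\<close>

context torsion_preserving_iso
begin

lemma cyclic_chain_image: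
  assumes S: "cyclic_chain G (torsion G)"
  shows "cyclic_chain H (torsion H)"
  unfolding cyclic_chain_def
proof (intro conjI ballI allI impI)
  show "padj H x y" if xy: "x \<in> torsion H" "y \<in> torsion H" for x y
  proof -
    obtain u where u: "u \<in> torsion G" "f u = x" using f_torsion_surj[OF xy(1)] .
    obtain v where v: "v \<in> torsion G" "f v = y" using f_torsion_surj[OF xy(2)] .
    show ?thesis using adj[of u v] G.cyclic_chain_padj[OF S u(1) v(1)] u v G.torsion_carrier by blast
  qed
qed (use H.torsion_pow_to_closed in blast)+

text \<open>
  If the torsion elements form a Pruefer group, the class of an element of infinite order provides
  the prime; such elements exist because \<open>G\<close> is not a Pruefer group.
\<close>

lemma torsion_dir_iso:
  assumes nil: "nilpotent G" "nilpotent H" and np: "\<not> is_pruefer G"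
  shows "dir_iso_on G (torsion G) H (torsion H)"
proof -
  interpret inv: torsion_preserving_iso H G "inv_into (carrier G) f" by (rule inverse_torsion_iso)
  consider (mm) "mixed_torsion G" "mixed_torsion H" | (pp) p q where "p_torsion G p" "p_torsion H q"
    using G.p_torsion_or_mixed H.p_torsion_or_mixed p_torsion_not_mixed[OF _ _ nil(2)] inv.p_torsion_not_mixed[OF _ _ nil(1)]
    by blast
  then show ?thesis
  proof cases
    case mm
    then show ?thesis using mixed_dir_iso nil by blast
  next
    case pp
    consider (triv) "torsion G = {\<one>\<^bsub>G\<^esub>}" | (eq) "p = q" | (chain) "infinite (torsion G)" "cyclic_chain G (torsion G)"
      using equal_primes_or_complete[OF nil(1) pp] by blast
    then show ?thesis
    proof cases
      case triv
      have "p_torsion G q" using pp(2) triv unfolding p_torsion_def by (auto intro: exI[of _ 0])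
      then show ?thesis using p_torsion_dir_iso pp(2) by blast
    next
      case eq
      then show ?thesis using p_torsion_dir_iso pp by blast
    next
      case chain
      have qG: "quasicyclic_torsion G p" using chain pp unfolding quasicyclic_torsion_def by blast
      have "infinite (torsion H)" using chain(1) tor finite_imageD[of f "torsion G"]
          inj_on_subset[OF bij_betw_imp_inj_on[OF bij]] G.torsion_carrier by (metis subsetI)
      then have qH: "quasicyclic_torsion H q"
        using cyclic_chain_image[OF chain(2)] pp unfolding quasicyclic_torsion_def by blast
      have "torsion G \<noteq> carrier G" using G.quasicyclic_is_pruefer[OF qG] np by blast
      then obtain x where x: "x \<in> carrier G" "x \<notin> torsion G" using G.torsion_carrier by blast
      note cl = nontorsion_class_dir_iso[OF x]
      have "p \<le> q" using quasicyclic_prime_le[OF G.is_group H.is_group nil qG qH cl] .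
      moreover have "q \<le> p"
        using quasicyclic_prime_le[OF H.is_group G.is_group nil(2,1) qH qG cl(2,1) dir_iso_on_sym[OF cl(3)]] .
      ultimately show ?thesis using p_torsion_dir_iso pp by simp
    qed
  qed
qed

end

context power_graph_iso
begin

text \<open>
  The map is chosen once for each class, not for each element, and arcs never join different
  classes.
\<close>

lemma glue_classes:
  assumes iso: "\<And>x. x \<in> carrier G \<Longrightarrow> dir_iso_on G (commens_class G x) H (commens_class H (f x))"
  shows "dir_iso_on G (carrier G) H (carrier H)"
proof -
  have "\<exists>g. \<forall>K \<in> commens_class G ` carrier G. bij_betw (g K) K (f ` K) \<and>
    (\<forall>x \<in> K. \<forall>y \<in> K. pow_to G x y \<longleftrightarrow> pow_to H (g K x) (g K y))"
    by (rule bchoice) (use iso f_commens_class in \<open>auto simp: dir_iso_on_def\<close>)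
  then obtain \<phi> where \<phi>: "\<And>x. x \<in> carrier G \<Longrightarrow> bij_betw (\<phi> (commens_class G x)) (commens_class G x) (f ` commens_class G x)"
    "\<And>x u v. x \<in> carrier G \<Longrightarrow> u \<in> commens_class G x \<Longrightarrow> v \<in> commens_class G x \<Longrightarrow>
      pow_to G u v \<longleftrightarrow> pow_to H (\<phi> (commens_class G x) u) (\<phi> (commens_class G x) v)"
    by blast
  define g where "g x = \<phi> (commens_class G x) x" for x
  have self: "x \<in> commens_class G x" if "x \<in> carrier G" for x using that G.commens_refl by (simp add: commens_class_def)
  have class_eq: "commens_class G x = commens_class G y" if "x \<in> carrier G" "y \<in> carrier G" "commens G x y" for x y
    using that G.commens_trans G.commens_sym unfolding commens_class_def by blast
  have g_mem: "g x \<in> f ` commens_class G x" if "x \<in> carrier G" for x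
    using bij_betw_apply[OF \<phi>(1)[OF that] self[OF that]] by (simp add: g_def)
  have g_car: "g x \<in> carrier H" if "x \<in> carrier G" for x
    using g_mem[OF that] f_closed by (auto simp: commens_class_def)
  have commens_back: "commens G x y" if xy: "x \<in> carrier G" "y \<in> carrier G" and c: "commens H (g x) (g y)" for x y
  proof -
    obtain u where u: "u \<in> carrier G" "commens G x u" "g x = f u" using g_mem[OF xy(1)] by (auto simp: commens_class_def)
    obtain v where v: "v \<in> carrier G" "commens G y v" "g y = f v" using g_mem[OF xy(2)] by (auto simp: commens_class_def)
    have "commens G u v" using f_commens[OF u(1) v(1)] c u v by simp
    then show ?thesis using G.commens_trans[OF G.commens_trans[OF u(2)] G.commens_sym[OF v(2)]] xy u v by blast
  qed
  have same: "g y = \<phi> (commens_class G x) y" "y \<in> commens_class G x" if "x \<in> carrier G" "y \<in> carrier G" "commens G x y" for x y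
    using class_eq[OF that] self[OF that(2)] by (simp_all add: g_def)
  have "inj_on g (carrier G)"
  proof (rule inj_onI)
    fix x y assume xy: "x \<in> carrier G" "y \<in> carrier G" "g x = g y"
    then have c: "commens G x y" using commens_back H.commens_refl g_car by simp
    show "x = y"
      using inj_onD[OF bij_betw_imp_inj_on[OF \<phi>(1)[OF xy(1)]], of x y] same[OF xy(1,2) c] xy(3) self[OF xy(1)]
      by (simp add: g_def)
  qed
  moreover have "g ` carrier G = carrier H"
  proof
    show "carrier H \<subseteq> g ` carrier G"
    proof
      fix y assume "y \<in> carrier H"
      then obtain x where x: "x \<in> carrier G" "f x = y" using f_surj by blast
      then have "y \<in> f ` commens_class G x" using self by blast
      then have "y \<in> \<phi> (commens_class G x) ` commens_class G x" using bij_betw_imp_surj_on[OF \<phi>(1)[OF x(1)]] by simp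
      then obtain u where u: "u \<in> commens_class G x" "y = \<phi> (commens_class G x) u" by blast
      then have uc: "u \<in> carrier G" "commens G x u" by (simp_all add: commens_class_def)
      then have "g u = y" using same(1)[OF x(1)] u(2) by simp
      then show "y \<in> g ` carrier G" using uc(1) by blast
    qed
  qed (use g_car in blast)
  moreover have "pow_to G x y \<longleftrightarrow> pow_to H (g x) (g y)" if xy: "x \<in> carrier G" "y \<in> carrier G" for x y
  proof (cases "commens G x y")
    case True
    show ?thesis using \<phi>(2)[OF xy(1) self[OF xy(1)] same(2)[OF xy True]] same(1)[OF xy True] by (simp add: g_def)
  next
    case False
    then show ?thesis using commens_back[OF xy] G.pow_to_commens H.pow_to_commens xy g_car by blast
  qed
  ultimately show ?thesis unfolding dir_iso_on_def bij_betw_def by blast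
qed

lemma carrier_dir_iso:
  assumes nil: "nilpotent G" "nilpotent H" and np: "\<not> is_pruefer G"
  shows "dir_iso_on G (carrier G) H (carrier H)"
proof (rule glue_classes)
  fix x assume x: "x \<in> carrier G"
  interpret torsion_preserving_iso G H f by (rule to_torsion_preserving)
  show "dir_iso_on G (commens_class G x) H (commens_class H (f x))"
  proof (cases "x \<in> torsion G")
    case True
    then show ?thesis
      using torsion_dir_iso[OF nil np] G.commens_class_torsion H.commens_class_torsion[OF f_torsion] by simp
  qed (use nontorsion_class_dir_iso x in blast)
qed

end

lemma pverts_directed: "pverts (directed_power_graph G) = carrier G"
  by (simp add: directed_power_graph_def)

lemma parcs_directed_iff:
  "(x, y) \<in> parcs (directed_power_graph G) \<longleftrightarrow> x \<in> carrier G \<and> y \<in> carrier G \<and> x \<noteq> y \<and> pow_to G x y"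
  by (auto simp: directed_power_graph_def pow_to_def)

lemma pverts_power_graph: "pverts (power_graph G) = carrier G"
  by (simp add: power_graph_def pverts_directed)

lemma parcs_power_graph_iff:
  "(x, y) \<in> parcs (power_graph G) \<longleftrightarrow> x \<in> carrier G \<and> y \<in> carrier G \<and> x \<noteq> y \<and> padj G x y"
  by (auto simp: power_graph_adjacent_iff parcs_directed_iff padj_def)

theorem theorem3p6:
  fixes G :: "('a, 'c) monoid_scheme" and H :: "('b, 'd) monoid_scheme"
  assumes "group G" and "nilpotent G" and "\<not> is_pruefer G"
    and "group H" and "nilpotent H" and "\<not> is_pruefer H"
    and "digraph_iso (with_proj (power_graph G)) (with_proj (power_graph H))"
  shows "digraph_iso (with_proj (directed_power_graph G)) (with_proj (directed_power_graph H))"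
proof -
  interpret G: group G by fact
  interpret H: group H by fact
  have sub: "parcs (power_graph K) \<subseteq> pverts (power_graph K) \<times> pverts (power_graph K)"
    "parcs (directed_power_graph K) \<subseteq> pverts (directed_power_graph K) \<times> pverts (directed_power_graph K)"
    for K :: "('k, 'm) monoid_scheme"
    by (auto simp: pverts_power_graph pverts_directed parcs_power_graph_iff parcs_directed_iff)
  obtain f where f: "bij_betw f (carrier G) (carrier H)"
    and arc: "\<And>x y. x \<in> carrier G \<Longrightarrow> y \<in> carrier G \<Longrightarrow>
      (x, y) \<in> parcs (power_graph G) \<longleftrightarrow> (f x, f y) \<in> parcs (power_graph H)"
    using assms(7) unfolding digraph_iso_pair_iff[OF sub(1) sub(1)] pverts_power_graph by blast
  have fc: "f x \<in> carrier H" if "x \<in> carrier G" for x using bij_betw_apply[OF f that] .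
  have inj: "f x = f y \<longleftrightarrow> x = y" if "x \<in> carrier G" "y \<in> carrier G" for x y
    using bij_betw_imp_inj_on[OF f] that by (auto dest: inj_onD)
  interpret power_graph_iso G H f
  proof
    fix x y assume xy: "x \<in> carrier G" "y \<in> carrier G"
    show "padj G x y \<longleftrightarrow> padj H (f x) (f y)"
      using arc[OF xy] inj[OF xy] fc[OF xy(1)] fc[OF xy(2)] xy G.padj_refl H.padj_refl
      unfolding parcs_power_graph_iff by (cases "x = y") simp_all
  qed (rule f)
  obtain g where g: "bij_betw g (carrier G) (carrier H)"
    and pw: "\<And>x y. x \<in> carrier G \<Longrightarrow> y \<in> carrier G \<Longrightarrow> pow_to G x y \<longleftrightarrow> pow_to H (g x) (g y)"
    using carrier_dir_iso[OF assms(2,5,3)] unfolding dir_iso_on_def by blast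
  have "(x, y) \<in> parcs (directed_power_graph G) \<longleftrightarrow> (g x, g y) \<in> parcs (directed_power_graph H)"
    if xy: "x \<in> carrier G" "y \<in> carrier G" for x y
    using pw[OF xy] bij_betw_apply[OF g xy(1)] bij_betw_apply[OF g xy(2)] xy inj_onD[OF bij_betw_imp_inj_on[OF g], of x y]
    unfolding parcs_directed_iff by auto
  then show ?thesis
    unfolding digraph_iso_pair_iff[OF sub(2) sub(2)] pverts_directed using g by blast
qed

end
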